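(* Let $\{X_t : t\in\mathbb{Z}\}$ be generated from the parametric time-series model $\{p_\theta:\theta\in\Theta\}$, $\Theta\subseteq\mathbb{R}^d$, with true parameter $\theta_0\in\Theta$, and let the observed series $X_{1:T}$, $T=Km$, be divided into $K$ consecutive subsequences $X_{[1]},\dots,X_{[K]}$ of length $m$. Let $\ell_T$ be the full log-likelihood, $\ell_k$ the pseudo log-likelihood of the $k$th subsequence, $\widehat\theta$ and $\widehat\theta_k$ the corresponding maximum likelihood estimators, and $\overline\theta=K^{-1}\sum_{k=1}^K\widehat\theta_k$. Suppose the following hypotheses hold. 1. (Stationarity and ergodicity) $\{X_t:t\in\mathbb{Z}\}$ is strictly stationary and ergodic. 2. (Mixing) The coefficients $\alpha(n)=\sup\{|\mathbb{P}_{\theta_0}(A)\mathbb{P}_{\theta_0}(B)-\mathbb{P}_{\theta_0}(A\cap B)| : A\in\sigma(\dots,X_{-1},X_0),\ B\in\sigma(X_n,X_{n+1},\dots)\}$ satisfy $\sum_{j=1}^\infty \alpha(j)^{\delta/(2+\delta)}<\infty$ for some $\delta>0$. 3. (Decay of the conditional score) There exist constants $\rho_0\in(0,1)$ and $C_0>0$ such that, for all sufficiently large integers $N$ and all $i,j>N$, $\mathbb{E}_{\theta_0}\big[\|\nabla_\theta\log p_{\theta_0}(X_1\mid X_{-i:0})-\nabla_\theta\log p_{\theta_0}(X_1\mid X_{-j:0})\|_1\big]\le C_0\rho_0^N$. 4. (Support) For all $t\ge1$ and all $\theta\in\Theta$, all possible conditional distributions $X_t\mid X_{1:(t-1)}$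 have the same support as the stationary distribution of $X_t$. 5. (Envelope) There is $\delta_0>0$ such that, with $B_{\delta_0}(\theta_0)=\{\theta\in\Theta:\|\theta-\theta_0\|\le\delta_0\}$: $\log p_\theta(X_t\mid X_{1:(t-1)})$ is three times differentiable in $\theta$ on $B_{\delta_0}(\theta_0)$; for each $t\ge1$ there is a function $M_t(X_{1:t})$ such that, for all $i,j,k\in\{1,\dots,d\}$, the suprema over $\theta\in B_{\delta_0}(\theta_0)$ of $|\partial_{\theta_i}\log p_\theta(X_t\mid X_{1:(t-1)})|$, $|\partial_{\theta_i}\partial_{\theta_j}\log p_\theta(X_t\mid X_{1:(t-1)})|$ and $|\partial_{\theta_i}\partial_{\theta_j}\partial_{\theta_k}\log p_\theta(X_t\mid X_{1:(t-1)})|$ are all at most $M_t(X_{1:t})$; and $\limsup_{T\to\infty}\mathbb{E}_{\theta_0}\big[T^{-1}\sum_{t=1}^T M_t(X_{1:t})^{4+2\delta}\big]<\infty$, with the same $\delta$ as in hypothesis 2. 6. (Asymptotic local quadratic behavior) The interchange of differentiation in $\theta$ at $\theta_0$ and integration with respect to $\mathbb{P}_{\theta_0}$ is valid; the score $\nabla_\theta\ell_k(\theta)$ at $\theta=\theta_0$ is a martingale (in $m\ge1$); $-T^{-1}\nabla_\theta^2\ell_T(\theta_0)\to I(\theta_0)$ in $\mathbb{P}_{\theta_0}$-probability as $T\to\infty$, where $I(\theta_0)$ is a positive definite matrix; and for all sufficiently large $m$, $-m^{-1}\nabla_\theta^2\ell_k(\theta)$ is positive definite with eigenvalues bounded below and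 above by constants for all $\theta\in B_{\delta_0}(\theta_0)$ and all values of $X_{[k]}$. 7. (Identifiability) For any $\eta>0$ there exists $\epsilon>0$ such that $\lim_{m\to\infty}\mathbb{P}_{\theta_0}\big(\sup_{\theta\in\Theta:\|\theta-\theta_0\|\ge\eta} m^{-1}\{\ell_1(\theta)-\ell_1(\theta_0)\}\le-\epsilon\big)=1$. 8. (Prior) The prior density $\pi_0$ is continuous at $\theta_0$, $0<\pi_0(\theta_0)<\infty$, and $\int_\Theta\|\theta\|^2\pi_0(\theta)\,d\theta<\infty$. 9. (Uniform integrability) Let $\psi(X_{[1]})$ be the expectation of $Km\|\theta-\widehat\theta_1\|^2$ when $\theta$ is distributed according to the subsequence posterior $\Pi(d\theta\mid X_{[1]})$. There is an integer $m_0\ge1$ such that $\lim_{C\to\infty}\sup_{m\ge m_0,\,K\ge1}\mathbb{E}_{\theta_0}\big[\psi(X_{[1]})\,\mathbb{I}\{\psi(X_{[1]})\ge C\}\big]=0$. Let $\xi=a^\top\theta+b$ for fixed $a\in\mathbb{R}^d$, $a\ne0$, and $b\in\mathbb{R}$; put $\xi_0=a^\top\theta_0+b$, $\overline\xi=a^\top\overline\theta+b$, $\widehat\xi=a^\top\widehat\theta+b$ and $I_\xi(\theta_0)=[a^\top I^{-1}(\theta_0)a]^{-1}$. Let $\Pi(d\xi\mid X_{1:T})$ and $\overline\Pi(d\xi\mid X_{1:T})$ be the distributions of $\xi$ under the full posterior and under the aggregated (Wasserstein barycenter) posterior. For a (data-dependent) distribution $Q(d\xi)$ on $\mathbb{R}$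 write $\mathrm{bias}[Q]=\int\xi\,Q(d\xi)-\xi_0$ and let $\mathrm{var}[Q]$ be its variance. Then: (a) $\mathrm{bias}[\overline\Pi(d\xi\mid X_{1:T})]=\overline\xi-\xi_0+o_{\theta_0}(T^{-1/2})$ and $\mathrm{bias}[\Pi(d\xi\mid X_{1:T})]=\widehat\xi-\xi_0+o_{\theta_0}(T^{-1/2})$. (b) $\mathrm{var}[\overline\Pi(d\xi\mid X_{1:T})]=T^{-1}I_\xi^{-1}(\theta_0)+o_{\theta_0}(T^{-1})$ and $\mathrm{var}[\Pi(d\xi\mid X_{1:T})]=T^{-1}I_\xi^{-1}(\theta_0)+o_{\theta_0}(T^{-1})$.
   Context: Model. $\{X_t:t\in\mathbb{Z}\}$ is a stochastic process with values in a Borel set $\mathbb{X}\subseteq\mathbb{R}^q$; $X_{s:t}=(X_s,\dots,X_t)$. For each $\theta\in\Theta\subseteq\mathbb{R}^d$ the model specifies a marginal density $p_\theta(X_1)$ and conditional densities $p_\theta(X_t\mid X_{1:(t-1)})$, $t\ge2$, with respect to Lebesgue measure; for $t=1$, $p_\theta(X_t\mid X_{1:(t-1)})$ means $p_\theta(X_1)$. The data are generated under $\mathbb{P}_{\theta_0}$, the law of the process with $\theta=\theta_0$; $\mathbb{E}_{\theta_0}$ is expectation under it. The density $p_\theta(X_1\mid X_{-i:0})$ is the model's conditional density of $X_1$ given $X_{-i},\dots,X_0$, and $\nabla_\theta\log p_{\theta_0}$ denotes the gradient in $\theta$ evaluated at $\theta_0$. Full log-likelihood: $\ell_T(\theta)=\log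 p_\theta(X_1)+\sum_{t=2}^T\log p_\theta(X_t\mid X_{1:(t-1)})$. Subsequences. $T=Km$ and $X_{[k]}=X_{(k-1)m+1:km}$, $k=1,\dots,K$. The pseudo-likelihood of the $k$th subsequence treats it as though it began at time one: $\tilde p_\theta(X_{[k]})=p_\theta(X_{(k-1)m+1})\prod_{t=(k-1)m+2}^{km}p_\theta(X_t\mid X_{(k-1)m+1:t-1})$, and $\ell_k(\theta)=\log\tilde p_\theta(X_{[k]})$. MLEs (assumed uniquely defined): $\widehat\theta_k=\arg\max_{\theta\in\Theta}\ell_k(\theta)$, $\widehat\theta=\arg\max_{\theta\in\Theta}\ell_T(\theta)$. Posteriors. The prior is $\Pi_0(d\theta)=\pi_0(\theta)\,d\theta$ on $\Theta$. Full posterior: $\Pi(d\theta\mid X_{1:T})\propto e^{\ell_T(\theta)}\,\Pi_0(d\theta)$. Subsequence posterior: $\Pi(d\theta\mid X_{[k]})=\tilde p_\theta(X_{[k]})^{K}\Pi_0(d\theta)\big/\int_\Theta\tilde p_\theta(X_{[k]})^{K}\Pi_0(d\theta)$ (the pseudo-likelihood is raised to the power $K=T/m$). Posteriors are assumed to admit Lebesgue densities. Wasserstein distance and aggregation. $W_2(\mu,\nu)=\{\inf_\lambda\int\|x-y\|^2\lambda(dx\,dy)\}^{1/2}$, the infimum over couplings $\lambda$ of $\mu,\nu$ (probability measures with finite second moments). The aggregated posterior is the Wasserstein-2 barycenter of the subsequence posteriors, i.e. the minimizer over $\mu$ of $\sum_{k=1}^K W_2^2(\mu,\Pi(\cdot\mid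 X_{[k]}))$, and is assumed to have a Lebesgue density. For the scalar functional $\xi=a^\top\theta+b$, $\Pi(d\xi\mid X_{1:T})$ and $\Pi(d\xi\mid X_{[k]})$ are the pushforwards of the full and subsequence posteriors under $\theta\mapsto a^\top\theta+b$, and $\overline\Pi(d\xi\mid X_{1:T})$ is the distribution on $\mathbb{R}$ with quantile function $\overline\Pi^{-1}(u\mid X_{1:T})=K^{-1}\sum_{k=1}^K\Pi^{-1}(u\mid X_{[k]})$, $u\in(0,1)$, where $\Pi^{-1}(u\mid X_{[k]})=\inf\{x\in\mathbb{R}:u\le\Pi(\xi\le x\mid X_{[k]})\}$; equivalently, it is the Wasserstein-2 barycenter on $\mathbb{R}$ of the laws $\Pi(d\xi\mid X_{[k]})$. Conventions. $\|\cdot\|$ is the Euclidean norm on vectors and Frobenius norm on matrices; $\|\cdot\|_1$ is the $\ell^1$ norm on $\mathbb{R}^d$. $\mathbb{I}$ denotes an indicator. For random variables $Z_n$ and a deterministic sequence $a_n$, $Z_n=o_{\theta_0}(a_n)$ means $\mathbb{P}_{\theta_0}(|Z_n/a_n|>\epsilon)\to0$ for every $\epsilon>0$. Asymptotic regime: $T=Km\to\infty$ with both $K\to\infty$ and $m\to\infty$ (so $m$ grows more slowly than $T$).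
   Formalization: The true parameter θ₀ is assumed to be an interior point of Θ; for a boundary point (e.g. Θ=[0,∞), i.i.d. N(θ,1), θ₀=0) the posterior is a truncated normal and the stated bias and variance expansions fail. *)

theory Defs
  imports "HOL-Probability.Probability"
begin

text \<open>
  A model is a function \<^term>\<open>p\<close> such that \<open>p \<theta> [x\<^sub>1, \<dots>, x\<^sub>t\<^sub>-\<^sub>1] y\<close> is the conditional density
  of \<open>X\<^sub>t\<close> at \<open>y\<close> given the past \<open>x\<^sub>1, \<dots>, x\<^sub>t\<^sub>-\<^sub>1\<close>; the empty history gives the marginal density
  of \<open>X\<^sub>1\<close>. Time is thus encoded by the length of the history. All densities are with respect to
  Lebesgue measure on the Borel set \<open>S\<close> of possible values.
\<close>

type_synonym ('q, 'd) ts_model = "real ^ 'd \<Rightarrow> (real ^ 'q) list \<Rightarrow> real ^ 'q \<Rightarrow> real"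

definition values_measure :: "(real ^ 'q) set \<Rightarrow> (real ^ 'q) measure" where
  "values_measure S = restrict_space lborel S"

definition density_model ::
  "(real ^ 'q) set \<Rightarrow> (real ^ 'd) set \<Rightarrow> ('q, 'd) ts_model \<Rightarrow> bool" where
  "density_model S \<Theta> p \<longleftrightarrow>
     S \<in> sets borel \<and> \<Theta> \<in> sets borel \<and>
     (\<forall>n. (\<lambda>(\<theta>, z). p \<theta> (map z [0..<n]) (z n))
        \<in> borel_measurable (restrict_space borel \<Theta> \<Otimes>\<^sub>M PiM {..n} (\<lambda>_. values_measure S))) \<and>
     (\<forall>\<theta>\<in>\<Theta>. \<forall>h. set h \<subseteq> S \<longrightarrow>
        (\<forall>y\<in>S. 0 \<le> p \<theta> h y) \<and> prob_space (density (values_measure S) (\<lambda>y. ennreal (p \<theta> h y))))"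

text \<open>
  The (pseudo-)likelihood of a stretch of data treats the stretch as though it began at time one.
\<close>

definition lik :: "('q, 'd) ts_model \<Rightarrow> real ^ 'd \<Rightarrow> (real ^ 'q) list \<Rightarrow> real" where
  "lik p \<theta> xs = (\<Prod>t<length xs. p \<theta> (take t xs) (xs ! t))"

text \<open>
  Since \<^prop>\<open>ln (0::real) = 0\<close> in the library, the log-likelihood is extended-real valued: a
  parameter under which the data have density zero has log-likelihood \<open>-\<infinity>\<close>.
\<close>

definition eln :: "real \<Rightarrow> ereal" where
  "eln r = (if 0 < r then ereal (ln r) else - \<infinity>)"

definition loglik :: "('q, 'd) ts_model \<Rightarrow> real ^ 'd \<Rightarrow> (real ^ 'q) list \<Rightarrow> ereal" where
  "loglik p \<theta> xs = (\<Sum>t<length xs. eln (p \<theta> (take t xs) (xs ! t)))"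

text \<open>
  The process is represented by its law \<open>P\<close> on the space of two-sided paths with values
  in \<open>S\<close>; \<open>X\<^sub>t\<close> is the coordinate \<open>x \<mapsto> x t\<close>.
\<close>

definition path_space :: "(real ^ 'q) set \<Rightarrow> (int \<Rightarrow> real ^ 'q) measure" where
  "path_space S = PiM UNIV (\<lambda>_. values_measure S)"

definition obs :: "(int \<Rightarrow> 'x) \<Rightarrow> int \<Rightarrow> int \<Rightarrow> 'x list" where
  "obs x s t = map x [s..t]"

definition subseq_obs :: "(int \<Rightarrow> 'x) \<Rightarrow> nat \<Rightarrow> nat \<Rightarrow> 'x list" where
  "subseq_obs x m k = obs x ((int k - 1) * int m + 1) (int k * int m)"

definition data_law ::
  "(real ^ 'q) set \<Rightarrow> ('q, 'd) ts_model \<Rightarrow> real ^ 'd \<Rightarrow> (int \<Rightarrow> real ^ 'q) measure \<Rightarrow> bool" where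
  "data_law S p \<theta>0 P \<longleftrightarrow>
     prob_space P \<and> sets P = sets (path_space S) \<and>
     (\<forall>n. distributed P (PiM {..<n} (\<lambda>_. values_measure S))
        (\<lambda>x. \<lambda>i\<in>{..<n}. x (int i + 1)) (\<lambda>z. ennreal (lik p \<theta>0 (map z [0..<n]))))"

definition strictly_stationary :: "(int \<Rightarrow> 'x) measure \<Rightarrow> bool" where
  "strictly_stationary P \<longleftrightarrow> (\<forall>h. distr P P (\<lambda>x t. x (t + h)) = P)"

definition ergodic :: "(int \<Rightarrow> 'x) measure \<Rightarrow> bool" where
  "ergodic P \<longleftrightarrow>
     (\<forall>A\<in>sets P. {x\<in>space P. (\<lambda>t. x (t + 1)) \<in> A} = A \<longrightarrow> measure P A = 0 \<or> measure P A = 1)"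

definition gen_algebra :: "(real ^ 'q) set \<Rightarrow> int set \<Rightarrow> (int \<Rightarrow> real ^ 'q) measure" where
  "gen_algebra S I =
     vimage_algebra (space (path_space S)) (\<lambda>x. restrict x I) (PiM I (\<lambda>_. values_measure S))"

definition mixing_coeff :: "(real ^ 'q) set \<Rightarrow> (int \<Rightarrow> real ^ 'q) measure \<Rightarrow> nat \<Rightarrow> real" where
  "mixing_coeff S P n =
     (SUP (A, B) \<in> sets (gen_algebra S {..0}) \<times> sets (gen_algebra S {int n..}).
        \<bar>measure P A * measure P B - measure P (A \<inter> B)\<bar>)"

definition is_martingale ::
  "'x measure \<Rightarrow> (nat \<Rightarrow> 'x measure) \<Rightarrow> (nat \<Rightarrow> 'x \<Rightarrow> real ^ 'd) \<Rightarrow> bool" where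
  "is_martingale P F Z \<longleftrightarrow>
     (\<forall>n\<ge>1. subalgebra P (F n) \<and> sets (F n) \<subseteq> sets (F (Suc n)) \<and>
        Z n \<in> borel_measurable (F n) \<and> integrable P (Z n) \<and>
        (\<forall>i. AE x in P. real_cond_exp P (F n) (\<lambda>y. Z (Suc n) y $ i) x = Z n x $ i))"

definition measure_support :: "'a::topological_space measure \<Rightarrow> 'a set" where
  "measure_support \<mu> = {x. \<forall>U. open U \<and> x \<in> U \<longrightarrow> 0 < emeasure \<mu> (U \<inter> space \<mu>)}"

text \<open>
  \<open>Z\<^sub>n = o(a\<^sub>n)\<close> in probability. The outer measure agrees with \<open>P\<close> on measurable sets, so this is the
  usual notion for random variables; for a non-measurable \<open>Z\<^sub>n\<close> it is more demanding
  than \<^const>\<open>measure\<close>, which is \<open>0\<close> on non-measurable sets.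
\<close>

definition little_o_prob :: "'x measure \<Rightarrow> (nat \<Rightarrow> 'x \<Rightarrow> real) \<Rightarrow> (nat \<Rightarrow> real) \<Rightarrow> bool" where
  "little_o_prob P Z a \<longleftrightarrow>
     (\<forall>\<epsilon>>0. (\<lambda>n. outer_measure_of P {x\<in>space P. \<epsilon> < \<bar>Z n x / a n\<bar>}) \<longlonglongrightarrow> 0)"

text \<open>
  Derivatives are taken within a set \<open>D\<close> of parameters, because a model is only specified on its
  parameter set. At interior points of \<open>D\<close> they are the ordinary partial derivatives.
\<close>

definition pd_within :: "(real ^ 'd) set \<Rightarrow> 'd \<Rightarrow> (real ^ 'd \<Rightarrow> real) \<Rightarrow> real ^ 'd \<Rightarrow> real" where
  "pd_within D i f \<theta> = frechet_derivative f (at \<theta> within D) (axis i 1)"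

definition grad_within :: "(real ^ 'd) set \<Rightarrow> (real ^ 'd \<Rightarrow> real) \<Rightarrow> real ^ 'd \<Rightarrow> real ^ 'd" where
  "grad_within D f \<theta> = (\<chi> i. pd_within D i f \<theta>)"

definition hess_within :: "(real ^ 'd) set \<Rightarrow> (real ^ 'd \<Rightarrow> real) \<Rightarrow> real ^ 'd \<Rightarrow> real ^ 'd ^ 'd" where
  "hess_within D f \<theta> = (\<chi> i j. pd_within D i (pd_within D j f) \<theta>)"

definition three_times_differentiable_on ::
  "(real ^ 'd \<Rightarrow> real) \<Rightarrow> (real ^ 'd) set \<Rightarrow> bool" where
  "three_times_differentiable_on f D \<longleftrightarrow>
     f differentiable_on D \<and> (\<forall>i. pd_within D i f differentiable_on D) \<and>
     (\<forall>i j. pd_within D i (pd_within D j f) differentiable_on D)"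

definition positive_definite :: "real ^ 'd ^ 'd \<Rightarrow> bool" where
  "positive_definite A \<longleftrightarrow> transpose A = A \<and> (\<forall>v. v \<noteq> 0 \<longrightarrow> 0 < v \<bullet> (A *v v))"

definition is_eigenvalue :: "real ^ 'd ^ 'd \<Rightarrow> real \<Rightarrow> bool" where
  "is_eigenvalue A c \<longleftrightarrow> (\<exists>v. v \<noteq> 0 \<and> A *v v = c *\<^sub>R v)"

definition l1_norm :: "real ^ 'd \<Rightarrow> real" where
  "l1_norm v = (\<Sum>i\<in>UNIV. \<bar>v $ i\<bar>)"

definition interchange_at ::
  "'x measure \<Rightarrow> (real ^ 'd) set \<Rightarrow> real ^ 'd \<Rightarrow> (real ^ 'd \<Rightarrow> 'x \<Rightarrow> real) \<Rightarrow> bool" where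
  "interchange_at P D \<theta>0 g \<longleftrightarrow>
     (\<exists>r>0. \<forall>\<theta>\<in>D \<inter> ball \<theta>0 r. integrable P (g \<theta>)) \<and>
     (\<forall>h. integrable P (\<lambda>x. frechet_derivative (\<lambda>\<theta>. g \<theta> x) (at \<theta>0 within D) h)) \<and>
     ((\<lambda>\<theta>. \<integral>x. g \<theta> x \<partial>P) has_derivative
        (\<lambda>h. \<integral>x. frechet_derivative (\<lambda>\<theta>. g \<theta> x) (at \<theta>0 within D) h \<partial>P)) (at \<theta>0 within D)"

text \<open>
  Under the law with parameter \<open>\<theta>0\<close>, the expectation of \<open>lik_ratio p \<theta>0 \<theta> X\<^sub>1\<^sub>:\<^sub>n\<close> is the Lebesgue
  integral of the joint density of \<open>X\<^sub>1\<^sub>:\<^sub>n\<close> with parameter \<open>\<theta>\<close>, and its derivative in \<open>\<theta>\<close> at \<open>\<theta>0\<close> is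
  the score. Interchange for this function and for its first partial derivatives is differentiation
  of that integral under the integral sign, to first and second order.
\<close>

definition lik_ratio ::
  "('q, 'd) ts_model \<Rightarrow> real ^ 'd \<Rightarrow> real ^ 'd \<Rightarrow> (real ^ 'q) list \<Rightarrow> real" where
  "lik_ratio p \<theta>0 \<theta> xs = lik p \<theta> xs / lik p \<theta>0 xs"

text \<open>
  The likelihood is raised to the power \<open>K\<close>. Taking \<open>K = 1\<close> and all of the data gives the
  full posterior, as \<^const>\<open>lik\<close> is the exponential of \<^const>\<open>loglik\<close>.
\<close>

definition posterior_weight ::
  "('q, 'd) ts_model \<Rightarrow> (real ^ 'd) set \<Rightarrow> (real ^ 'd \<Rightarrow> real) \<Rightarrow> nat \<Rightarrow> (real ^ 'q) list
    \<Rightarrow> real ^ 'd \<Rightarrow> ennreal" where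
  "posterior_weight p \<Theta> \<pi>0 K xs \<theta> = ennreal (lik p \<theta> xs ^ K * \<pi>0 \<theta>) * indicator \<Theta> \<theta>"

definition posterior ::
  "('q, 'd) ts_model \<Rightarrow> (real ^ 'd) set \<Rightarrow> (real ^ 'd \<Rightarrow> real) \<Rightarrow> nat \<Rightarrow> (real ^ 'q) list
    \<Rightarrow> (real ^ 'd) measure" where
  "posterior p \<Theta> \<pi>0 K xs =
     density lborel
       (\<lambda>\<theta>. posterior_weight p \<Theta> \<pi>0 K xs \<theta> / (\<integral>\<^sup>+\<theta>'. posterior_weight p \<Theta> \<pi>0 K xs \<theta>' \<partial>lborel))"

definition xi_law :: "real ^ 'd \<Rightarrow> real \<Rightarrow> (real ^ 'd) measure \<Rightarrow> real measure" where
  "xi_law a b \<mu> = distr \<mu> borel (\<lambda>\<theta>. a \<bullet> \<theta> + b)"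

definition quantile :: "real measure \<Rightarrow> real \<Rightarrow> real" where
  "quantile Q u = Inf {x. u \<le> measure Q {..x}}"

definition law_with_quantile :: "(real \<Rightarrow> real) \<Rightarrow> real measure" where
  "law_with_quantile q = (THE Q. real_distribution Q \<and> (\<forall>u\<in>{0<..<1}. quantile Q u = q u))"

definition full_xi_posterior ::
  "('q, 'd) ts_model \<Rightarrow> (real ^ 'd) set \<Rightarrow> (real ^ 'd \<Rightarrow> real) \<Rightarrow> real ^ 'd \<Rightarrow> real
    \<Rightarrow> nat \<Rightarrow> (int \<Rightarrow> real ^ 'q) \<Rightarrow> real measure" where
  "full_xi_posterior p \<Theta> \<pi>0 a b T x = xi_law a b (posterior p \<Theta> \<pi>0 1 (obs x 1 (int T)))"

text \<open>
  The Wasserstein-2 barycenter on the real line of the laws of \<open>\<xi>\<close> under the subsequence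
  posteriors: its quantile function is the average of theirs.
\<close>

definition aggregated_xi_posterior ::
  "('q, 'd) ts_model \<Rightarrow> (real ^ 'd) set \<Rightarrow> (real ^ 'd \<Rightarrow> real) \<Rightarrow> real ^ 'd \<Rightarrow> real
    \<Rightarrow> nat \<Rightarrow> nat \<Rightarrow> (int \<Rightarrow> real ^ 'q) \<Rightarrow> real measure" where
  "aggregated_xi_posterior p \<Theta> \<pi>0 a b K m x =
     law_with_quantile
       (\<lambda>u. (\<Sum>k=1..K. quantile (xi_law a b (posterior p \<Theta> \<pi>0 K (subseq_obs x m k))) u) / real K)"

definition bias :: "real \<Rightarrow> real measure \<Rightarrow> real" where
  "bias \<xi>0 Q = (\<integral>\<xi>. \<xi> \<partial>Q) - \<xi>0"

definition var :: "real measure \<Rightarrow> real" where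
  "var Q = (\<integral>\<xi>. (\<xi> - (\<integral>\<zeta>. \<zeta> \<partial>Q))\<^sup>2 \<partial>Q)"

text \<open>
  \<open>est xs\<close> is the maximum likelihood estimator computed from the stretch of data \<open>xs\<close>. The case
  \<open>k = 1\<close> covers the estimator from the full series.
\<close>

definition unique_mle ::
  "(real ^ 'q) set \<Rightarrow> (real ^ 'd) set \<Rightarrow> ('q, 'd) ts_model \<Rightarrow> (int \<Rightarrow> real ^ 'q) measure
    \<Rightarrow> ((real ^ 'q) list \<Rightarrow> real ^ 'd) \<Rightarrow> bool" where
  "unique_mle S \<Theta> p P est \<longleftrightarrow>
     (\<forall>n. (\<lambda>z. est (map z [0..<n])) \<in> borel_measurable (PiM {..<n} (\<lambda>_. values_measure S))) \<and>
     (\<forall>\<^sub>F m in sequentially. \<forall>k\<ge>1. AE x in P. \<forall>\<theta>.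
        is_arg_max (\<lambda>\<theta>. loglik p \<theta> (subseq_obs x m k)) (\<lambda>\<theta>. \<theta> \<in> \<Theta>) \<theta>
          \<longleftrightarrow> \<theta> = est (subseq_obs x m k))"

definition mean_mle ::
  "((real ^ 'q) list \<Rightarrow> real ^ 'd) \<Rightarrow> nat \<Rightarrow> nat \<Rightarrow> (int \<Rightarrow> real ^ 'q) \<Rightarrow> real ^ 'd" where
  "mean_mle est K m x = (1 / real K) *\<^sub>R (\<Sum>k=1..K. est (subseq_obs x m k))"

definition scaled_second_moment ::
  "('q, 'd) ts_model \<Rightarrow> (real ^ 'd) set \<Rightarrow> (real ^ 'd \<Rightarrow> real)
    \<Rightarrow> ((real ^ 'q) list \<Rightarrow> real ^ 'd) \<Rightarrow> nat \<Rightarrow> (real ^ 'q) list \<Rightarrow> ennreal" where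
  "scaled_second_moment p \<Theta> \<pi>0 est K xs =
     (\<integral>\<^sup>+\<theta>. ennreal (real (K * length xs) * (norm (\<theta> - est xs))\<^sup>2) \<partial>posterior p \<Theta> \<pi>0 K xs)"

definition info_xi :: "real ^ 'd ^ 'd \<Rightarrow> real ^ 'd \<Rightarrow> real" where
  "info_xi I0 a = inverse (a \<bullet> (matrix_inv I0 *v a))"

end

theory Submission
  imports Defs "HOL-Real_Asymp.Real_Asymp"
begin

text \<open>
  Let \<open>r\<^sub>k\<close> be the quantile function of the law of \<open>\<surd>T (\<xi> - \<xi>\<^sub>k)\<close> under the posterior of the
  \<open>k\<close>th subsequence, \<open>\<xi>\<^sub>k\<close> being the estimate from that subsequence, and let \<open>q\<close> be the quantile
  function of the centred normal law with variance \<open>a \<bullet> I\<^sup>-\<^sup>1 a\<close>. The bias and the variance of the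
  aggregated posterior are read off the average of the \<open>r\<^sub>k\<close>, whose squared \<open>L\<^sup>2(0, 1)\<close> distance
  to \<open>q\<close> is at most the average of the squared distances of the \<open>r\<^sub>k\<close>. By stationarity it suffices
  that the squared distance of \<open>r\<^sub>1\<close> tends to \<open>0\<close> in mean. In probability this is a Bernstein-von
  Mises theorem with second moments: Laplace's method, with the peak controlled by the Hessian
  bounds and the tail by identifiability and the second moment of the prior, gives convergence of
  the distribution functions and of the second moments, hence of the quantile functions in \<open>L\<^sup>2\<close>.
  Uniform integrability turns this into convergence in mean. All of this is uniform in \<open>K\<close>, and
  the full posterior is the case \<open>K = 1\<close>.
\<close>

section \<open>Quadratic forms and partial derivatives\<close>

text \<open>Probability and analysis are kept apart. The Bernstein-von Mises step is a deterministic
  statement about lists of data: every sufficiently long list satisfying \<open>good\<close> has a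
  small \<open>quantile_error\<close>, for all \<open>K\<close> at once. Uniformity in
  \<open>K\<close> costs nothing because the peak sharpens at the rate sqrt (K n), which is at least
  sqrt n, and \<open>K\<close> cancels from the limiting quadratic form. Convergence in probability
  for a single block would not suffice: the number of blocks grows, so the sum of their errors has
  to be controlled through an expectation. The second obstacle is measurability. Suprema over the
  parameter and quantile errors are awkward as functions of the data, so bad events are enclosed in
  measurable sets of small probability, and expectations are taken of a measurable majorant of the
  error.\<close>

lemma symmetric_dot_commute:
  fixes A :: "real ^ 'd ^ 'd"
  assumes "transpose A = A"
  shows "x \<bullet> (A *v y) = (A *v x) \<bullet> y"
proof -
  have "x \<bullet> (A *v y) = (transpose A *v x) \<bullet> y"
    unfolding transpose_matrix_vector by (rule dot_lmul_matrix[symmetric])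
  then show ?thesis by (simp add: assms)
qed

lemma matrix_vector_mult_uminus_right: "A *v (- x) = - (A *v x)"
  for A :: "real ^ 'n ^ 'm"
  by (rule linear_neg[OF matrix_vector_mul_linear])

text \<open>A minimiser of the form on the unit sphere is an eigenvector; otherwise a small step
  against the residual of the eigenvalue equation would bring the form below its minimum. This links
  the hypothesis on Hessians, stated through eigenvalues, with the bounds on quadratic forms that
  the expansion uses.\<close>

lemma quadratic_form_min_eigenvalue:
  fixes A :: "real ^ 'd ^ 'd"
  assumes sym: "transpose A = A"
  obtains l where "is_eigenvalue A l" "\<And>v. l * (norm v)\<^sup>2 \<le> v \<bullet> (A *v v)"
proof -
  let ?f = "\<lambda>v. v \<bullet> (A *v v)"
  have "axis undefined 1 \<in> sphere (0 :: real ^ 'd) 1" by simp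
  then have "sphere (0 :: real ^ 'd) 1 \<noteq> {}" by blast
  moreover have "continuous_on (sphere 0 1) ?f"
    by (intro continuous_intros)
  ultimately obtain v0 where v0: "norm v0 = 1" "\<And>v. norm v = 1 \<Longrightarrow> ?f v0 \<le> ?f v"
    using continuous_attains_inf[of "sphere 0 1" ?f] by (auto simp: compact_sphere)
  let ?l = "?f v0"
  have low: "?l * (norm v)\<^sup>2 \<le> ?f v" for v
  proof (cases "v = 0")
    case False
    have "?l \<le> ?f (inverse (norm v) *\<^sub>R v)"
      using False by (intro v0(2)) simp
    also have "\<dots> = ?f v / (norm v)\<^sup>2"
      by (simp add: matrix_vector_mult_scaleR power2_eq_square divide_simps)
    finally show ?thesis using False by (simp add: divide_simps split: if_splits)
  qed simp
  \<comment> \<open>For the residual \<open>e\<close>, minimality tested at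
    \<open>v0 - s *\<^sub>R e\<close> reads 2 (e \<bullet> e) \<le> s k with a constant k, for every
    s > 0. The value s = (e \<bullet> e) / (\<bar>k\<bar> + 1) used below contradicts this unless e
    = 0.\<close>
  define e where "e = A *v v0 - ?l *\<^sub>R v0"
  have "2 * (e \<bullet> e) \<le> s * (?f e - ?l * (e \<bullet> e))" if "0 < s" for s
  proof -
    let ?w = "v0 - s *\<^sub>R e"
    have ee: "e \<bullet> (A *v v0) - ?l * (e \<bullet> v0) = e \<bullet> e"
      by (subst (3) e_def) (simp add: inner_diff_right)
    have w1: "?f ?w = ?l - 2 * s * (e \<bullet> (A *v v0)) + s\<^sup>2 * ?f e"
      using symmetric_dot_commute[OF sym, of v0 e]
      by (simp add: matrix_vector_mult_diff_distrib matrix_vector_mult_scaleR inner_diff_left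
          inner_diff_right power2_eq_square algebra_simps inner_commute)
    have w2: "(norm ?w)\<^sup>2 = 1 - 2 * s * (e \<bullet> v0) + s\<^sup>2 * (e \<bullet> e)"
      using v0(1) unfolding power2_norm_eq_inner by (simp add: inner_diff_left inner_diff_right
          power2_eq_square algebra_simps inner_commute norm_eq_1)
    have "0 \<le> - (2 * s * (e \<bullet> (A *v v0) - ?l * (e \<bullet> v0))) + s\<^sup>2 * (?f e - ?l * (e \<bullet> e))"
      using low[of ?w] unfolding w1 w2 by (simp add: algebra_simps)
    then have "0 \<le> - (2 * s * (e \<bullet> e)) + s\<^sup>2 * (?f e - ?l * (e \<bullet> e))"
      unfolding ee .
    then have "s * (2 * (e \<bullet> e)) \<le> s * (s * (?f e - ?l * (e \<bullet> e)))"
      by (simp add: power2_eq_square algebra_simps)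
    then show ?thesis using that by simp
  qed note bnd = this
  have "e \<bullet> e \<le> 0"
  proof (rule ccontr)
    assume "\<not> e \<bullet> e \<le> 0"
    then have pos: "0 < e \<bullet> e" by (rule not_le_imp_less)
    define k where "k = ?f e - ?l * (e \<bullet> e)"
    have "2 * (e \<bullet> e) \<le> (e \<bullet> e) / (\<bar>k\<bar> + 1) * k"
      using pos unfolding k_def by (intro bnd divide_pos_pos) (auto intro: add_nonneg_pos)
    also have "\<dots> \<le> (e \<bullet> e) / (\<bar>k\<bar> + 1) * \<bar>k\<bar>"
      using pos by (intro mult_left_mono) auto
    also have "\<dots> \<le> e \<bullet> e" using pos by (simp add: divide_simps)
    finally show False using pos by simp
  qed
  then have "e \<bullet> e = 0" by (intro antisym inner_ge_zero)
  then have "e = 0" by simp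
  then have "A *v v0 = ?l *\<^sub>R v0" by (simp add: e_def)
  moreover have "v0 \<noteq> 0" using v0(1) by auto
  ultimately have "is_eigenvalue A ?l" by (auto simp: is_eigenvalue_def)
  then show thesis using low that by blast
qed

lemma eigenvalue_lower_bound:
  fixes A :: "real ^ 'd ^ 'd"
  assumes "transpose A = A" and "\<And>l. is_eigenvalue A l \<Longrightarrow> c \<le> l"
  shows "c * (norm v)\<^sup>2 \<le> v \<bullet> (A *v v)"
proof -
  obtain l where l: "is_eigenvalue A l" "\<And>v. l * (norm v)\<^sup>2 \<le> v \<bullet> (A *v v)"
    using quadratic_form_min_eigenvalue[OF assms(1)] by blast
  have "c * (norm v)\<^sup>2 \<le> l * (norm v)\<^sup>2" using assms(2)[OF l(1)] by (intro mult_right_mono) auto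
  then show ?thesis using l(2)[of v] by linarith
qed

text \<open>Strict positivity away from 0 becomes a uniform constant because the smallest eigenvalue
  has an eigenvector, at which the form is positive. The constant makes the Gaussian kernel
  integrable.\<close>

lemma positive_definite_coercive:
  assumes "positive_definite A"
  obtains c where "0 < c" "\<And>v. c * (norm v)\<^sup>2 \<le> v \<bullet> (A *v v)"
proof -
  obtain l where l: "is_eigenvalue A l" "\<And>v. l * (norm v)\<^sup>2 \<le> v \<bullet> (A *v v)"
    using quadratic_form_min_eigenvalue[of A] assms by (auto simp: positive_definite_def)
  then obtain v where v: "v \<noteq> 0" "A *v v = l *\<^sub>R v" by (auto simp: is_eigenvalue_def)
  then have "0 < l * (v \<bullet> v)"
    using assms by (auto simp: positive_definite_def dest!: spec[of _ v])
  moreover have "0 < v \<bullet> v" using v(1) by simp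
  ultimately have "0 < l" by (rule zero_less_mult_pos2)
  then show thesis using l(2) that by blast
qed

lemma positive_definite_matrix_inv:
  fixes A :: "real ^ 'd ^ 'd"
  assumes "positive_definite A"
  shows "A *v (matrix_inv A *v a) = a"
proof -
  have "\<forall>x. A *v x = 0 \<longrightarrow> x = 0"
    using assms unfolding positive_definite_def by (metis inner_zero_right less_irrefl)
  then have "invertible A"
    by (simp add: invertible_left_inverse matrix_left_invertible_ker)
  then have "A ** matrix_inv A = mat 1"
    unfolding invertible_def matrix_inv_def by (metis (mono_tags, lifting) someI_ex)
  then show ?thesis by (simp add: matrix_vector_mul_assoc)
qed

text \<open>Around an interior point the set in \<open>at \<theta> within D\<close> is immaterial.
  The Hessian limit is stated within \<open>\<Theta>\<close>, smoothness and the Hessian bounds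
  within \<open>B\<close>; this makes them speak of the same derivatives.\<close>

lemma pd_within_local:
  assumes "open U" "\<theta> \<in> U" "U \<subseteq> D" "U \<subseteq> D'" "\<And>x. x \<in> U \<Longrightarrow> f x = g x"
  shows "pd_within D i f \<theta> = pd_within D' i g \<theta>"
proof -
  have at: "at \<theta> within D = at \<theta>" "at \<theta> within D' = at \<theta>"
    using assms by (auto intro!: at_within_interior interiorI[of U])
  have "(f has_derivative f') (at \<theta>) = (g has_derivative f') (at \<theta>)" for f'
    using has_derivative_transform_within_open[OF _ assms(1,2), of f f' UNIV g]
      has_derivative_transform_within_open[OF _ assms(1,2), of g f' UNIV f] assms(5) by auto
  then show ?thesis unfolding pd_within_def frechet_derivative_def at by simp
qed

lemma has_derivative_pd_within:
  fixes f :: "real ^ 'd \<Rightarrow> real"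
  assumes "f differentiable_on D" "open U" "\<theta> \<in> U" "U \<subseteq> D"
  shows "(f has_derivative (\<lambda>h. \<Sum>i\<in>UNIV. h $ i * pd_within D i f \<theta>)) (at \<theta>)"
proof -
  have at: "at \<theta> within D = at \<theta>"
    using assms by (auto intro!: at_within_interior interiorI[of U])
  let ?f' = "frechet_derivative f (at \<theta>)"
  have d: "(f has_derivative ?f') (at \<theta>)"
    using assms at by (metis differentiable_on_def frechet_derivative_works subsetD)
  have lin: "linear ?f'" using d by (rule has_derivative_linear)
  have "?f' h = (\<Sum>i\<in>UNIV. h $ i * pd_within D i f \<theta>)" for h
  proof -
    have "?f' h = ?f' (\<Sum>i\<in>UNIV. h $ i *s axis i 1)" by (simp add: basis_expansion)
    also have "\<dots> = (\<Sum>i\<in>UNIV. h $ i * ?f' (axis i 1))"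
      using lin by (simp add: linear_sum linear_cmul scalar_mult_eq_scaleR)
    finally show ?thesis by (simp add: pd_within_def at)
  qed
  then have "?f' = (\<lambda>h. \<Sum>i\<in>UNIV. h $ i * pd_within D i f \<theta>)" by (rule ext)
  then show ?thesis using d by simp
qed

text \<open>The converse direction: partial derivatives are read off a total derivative, so that
  sums of termwise derivatives can be recognised as the derivatives of the log-likelihood.\<close>

lemma pd_within_eqI:
  fixes f :: "real ^ 'd \<Rightarrow> real"
  assumes "(f has_derivative (\<lambda>h. \<Sum>i\<in>UNIV. h $ i * g i)) (at \<theta>)"
    and "open U" "\<theta> \<in> U" "U \<subseteq> D"
  shows "pd_within D i f \<theta> = g i"
proof -
  have at: "at \<theta> within D = at \<theta>"
    using assms by (auto intro!: at_within_interior interiorI[of U])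
  have "frechet_derivative f (at \<theta>) = (\<lambda>h. \<Sum>i\<in>UNIV. h $ i * g i)"
    using frechet_derivative_at[OF assms(1)] by simp
  then have "pd_within D i f \<theta> = (\<Sum>j\<in>UNIV. (axis i 1 :: real ^ 'd) $ j * g j)"
    by (simp add: pd_within_def at)
  also have "\<dots> = (\<Sum>j\<in>UNIV. if j = i then g j else 0)"
    by (intro sum.cong) (auto simp: axis_def)
  also have "\<dots> = g i" by simp
  finally show ?thesis .
qed

text \<open>One-dimensional Taylor expansion along the segment. The exact form with an intermediate
  point serves two purposes: coercivity of the Hessian throughout the neighbourhood bounds the peak,
  and its convergence near the true parameter gives the pointwise limit.\<close>

lemma Taylor_second_order:
  fixes f :: "real ^ 'd \<Rightarrow> real" and G :: "'d \<Rightarrow> real ^ 'd \<Rightarrow> real" and H :: "real ^ 'd \<Rightarrow> real ^ 'd ^ 'd"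
  assumes U: "convex U" "x \<in> U" "y \<in> U"
    and f: "\<And>z. z \<in> U \<Longrightarrow> (f has_derivative (\<lambda>h. \<Sum>j\<in>UNIV. h $ j * G j z)) (at z)"
    and G: "\<And>z j. z \<in> U \<Longrightarrow> (G j has_derivative (\<lambda>h. \<Sum>i\<in>UNIV. h $ i * H z $ i $ j)) (at z)"
  obtains z where "z \<in> closed_segment x y"
    "f y = f x + (\<Sum>j\<in>UNIV. (y - x) $ j * G j x) + ((y - x) \<bullet> (H z *v (y - x))) / 2"
proof -
  define v where "v = y - x"
  define \<gamma> where "\<gamma> s = x + s *\<^sub>R v" for s :: real
  have \<gamma>_seg: "\<gamma> s \<in> closed_segment x y" if "0 \<le> s" "s \<le> 1" for s
    using that unfolding \<gamma>_def v_def in_segment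
    by (intro exI[of _ s]) (simp add: algebra_simps)
  then have \<gamma>U: "\<gamma> s \<in> U" if "0 \<le> s" "s \<le> 1" for s
    using that closed_segment_subset[OF U(2,3,1)] by blast
  have \<gamma>': "(\<gamma> has_derivative (\<lambda>t. t *\<^sub>R v)) (at s)" for s
    unfolding \<gamma>_def by (auto intro!: derivative_eq_intros)
  have d0: "((\<lambda>s. f (\<gamma> s)) has_real_derivative (\<Sum>j\<in>UNIV. v $ j * G j (\<gamma> s))) (at s)"
    if "0 \<le> s" "s \<le> 1" for s
  proof -
    have "((\<lambda>s. f (\<gamma> s)) has_derivative (\<lambda>t. \<Sum>j\<in>UNIV. (t *\<^sub>R v) $ j * G j (\<gamma> s))) (at s)"
      by (rule has_derivative_compose[OF \<gamma>' f[OF \<gamma>U[OF that]]])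
    then show ?thesis
      by (rule has_derivative_imp_has_field_derivative) (simp add: sum_distrib_left sum_distrib_right mult_ac)
  qed
  have d1: "((\<lambda>s. \<Sum>j\<in>UNIV. v $ j * G j (\<gamma> s)) has_real_derivative v \<bullet> (H (\<gamma> s) *v v)) (at s)"
    if "0 \<le> s" "s \<le> 1" for s
  proof -
    have "((\<lambda>s. G j (\<gamma> s)) has_derivative (\<lambda>t. \<Sum>i\<in>UNIV. (t *\<^sub>R v) $ i * H (\<gamma> s) $ i $ j)) (at s)" for j
      by (rule has_derivative_compose[OF \<gamma>' G[OF \<gamma>U[OF that]]])
    then have "((\<lambda>s. G j (\<gamma> s)) has_real_derivative (\<Sum>i\<in>UNIV. v $ i * H (\<gamma> s) $ i $ j)) (at s)" for j
      by (rule has_derivative_imp_has_field_derivative) (simp add: sum_distrib_left sum_distrib_right mult_ac)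
    then have "((\<lambda>s. \<Sum>j\<in>UNIV. v $ j * G j (\<gamma> s)) has_real_derivative
        (\<Sum>j\<in>UNIV. v $ j * (\<Sum>i\<in>UNIV. v $ i * H (\<gamma> s) $ i $ j))) (at s)"
      by (intro DERIV_sum DERIV_cmult)
    also have "(\<Sum>j\<in>UNIV. v $ j * (\<Sum>i\<in>UNIV. v $ i * H (\<gamma> s) $ i $ j)) = v \<bullet> (H (\<gamma> s) *v v)"
      unfolding inner_vec_def matrix_vector_mult_def
      by (simp add: sum_distrib_left) (subst sum.swap, simp add: mult_ac)
    finally show ?thesis .
  qed
  define diff where "diff n = (if n = 0 then (\<lambda>s. f (\<gamma> s))
    else if n = 1 then (\<lambda>s. \<Sum>j\<in>UNIV. v $ j * G j (\<gamma> s)) else (\<lambda>s. v \<bullet> (H (\<gamma> s) *v v)))" for n :: nat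
  have "\<exists>t. 0 < t \<and> t < 1 \<and> f (\<gamma> 1) = (\<Sum>m<2. diff m 0 / fact m * (1 - 0) ^ m) + diff 2 t / fact 2 * (1 - 0)\<^sup>2"
  proof (rule Taylor_up[where b=1 and a=0])
    show "\<forall>m t. m < 2 \<and> 0 \<le> t \<and> t \<le> 1 \<longrightarrow> (diff m has_real_derivative diff (Suc m) t) (at t)"
      using d0 d1 by (auto simp: diff_def less_2_cases_iff)
  qed (auto simp: diff_def)
  then obtain t where t: "0 < t" "t < 1"
    "f (\<gamma> 1) = f (\<gamma> 0) + (\<Sum>j\<in>UNIV. v $ j * G j (\<gamma> 0)) + v \<bullet> (H (\<gamma> t) *v v) / 2"
    by (auto simp: diff_def numeral_2_eq_2)
  show thesis
  proof (rule that)
    show "\<gamma> t \<in> closed_segment x y" using t by (intro \<gamma>_seg) auto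
    show "f y = f x + (\<Sum>j\<in>UNIV. (y - x) $ j * G j x) + ((y - x) \<bullet> (H (\<gamma> t) *v (y - x))) / 2"
      using t(3) by (simp add: \<gamma>_def v_def)
  qed
qed

lemma gradient_bound_Lipschitz:
  fixes f :: "real ^ 'd \<Rightarrow> real" and G :: "'d \<Rightarrow> real ^ 'd \<Rightarrow> real"
  assumes U: "convex U" "x \<in> U" "y \<in> U"
    and f: "\<And>z. z \<in> U \<Longrightarrow> (f has_derivative (\<lambda>h. \<Sum>j\<in>UNIV. h $ j * G j z)) (at z)"
    and bnd: "\<And>z j. z \<in> U \<Longrightarrow> \<bar>G j z\<bar> \<le> E"
  shows "\<bar>f y - f x\<bar> \<le> real CARD('d) * E * norm (y - x)"
proof -
  have "norm (f y - f x) \<le> (real CARD('d) * E) * norm (y - x)"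
  proof (rule differentiable_bound[OF U(1) _ _ U(3,2)])
    fix z assume z: "z \<in> U"
    show "(f has_derivative (\<lambda>h. \<Sum>j\<in>UNIV. h $ j * G j z)) (at z within U)"
      using f[OF z] by (rule has_derivative_at_withinI)
    show "onorm (\<lambda>h. \<Sum>j\<in>UNIV. h $ j * G j z) \<le> real CARD('d) * E"
    proof (rule onorm_le)
      fix h :: "real ^ 'd"
      have "norm (\<Sum>j\<in>UNIV. h $ j * G j z) \<le> (\<Sum>j\<in>(UNIV::'d set). norm h * E)"
        using bnd[OF z] by (intro sum_norm_le) (auto simp: abs_mult component_le_norm_cart intro!: mult_mono)
      then show "norm (\<Sum>j\<in>UNIV. h $ j * G j z) \<le> real CARD('d) * E * norm h"
        by (simp add: mult_ac)
    qed
  qed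
  then show ?thesis by simp
qed

lemma quadratic_form_tendsto:
  fixes A :: "nat \<Rightarrow> real ^ 'd ^ 'd"
  assumes "\<And>i j. (\<lambda>n. A n $ i $ j) \<longlonglongrightarrow> B $ i $ j"
  shows "(\<lambda>n. h \<bullet> (A n *v h)) \<longlonglongrightarrow> h \<bullet> (B *v h)"
  unfolding inner_vec_def matrix_vector_mult_def
  by (simp, intro tendsto_intros assms)

section \<open>Gaussian integrals\<close>

lemma nn_integral_lborel_scale:
  fixes c :: "'a::euclidean_space"
  assumes y: "0 < y" and [measurable]: "f \<in> borel_measurable borel"
  shows "(\<integral>\<^sup>+h. f (c + (1 / y) *\<^sub>R h) \<partial>lborel) = ennreal (y ^ DIM('a)) * (\<integral>\<^sup>+x. f x \<partial>lborel)"
proof -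
  have "(\<integral>\<^sup>+x. f x \<partial>lborel) = (\<integral>\<^sup>+x. f x \<partial>density (distr lborel borel (\<lambda>x. c + (1 / y) *\<^sub>R x)) (\<lambda>_. ennreal (\<bar>1 / y\<bar> ^ DIM('a))))"
    using y by (subst lborel_affine[of "1 / y" c]) auto
  also have "\<dots> = ennreal ((1 / y) ^ DIM('a)) * (\<integral>\<^sup>+h. f (c + (1 / y) *\<^sub>R h) \<partial>lborel)"
    using y by (simp add: nn_integral_density nn_integral_distr nn_integral_cmult)
  finally have "ennreal (y ^ DIM('a)) * (\<integral>\<^sup>+x. f x \<partial>lborel)
      = (ennreal (y ^ DIM('a)) * ennreal ((1 / y) ^ DIM('a))) * (\<integral>\<^sup>+h. f (c + (1 / y) *\<^sub>R h) \<partial>lborel)"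
    by (simp add: mult.assoc)
  also have "ennreal (y ^ DIM('a)) * ennreal ((1 / y) ^ DIM('a)) = 1"
    using y by (simp add: ennreal_mult'[symmetric] power_one_over flip: ennreal_1)
  finally show ?thesis by simp
qed

lemma lborel_integral_translate:
  fixes f :: "'a::euclidean_space \<Rightarrow> real"
  assumes [measurable]: "f \<in> borel_measurable borel"
  shows "(\<integral>h. f (c + h) \<partial>lborel) = (\<integral>h. f h \<partial>lborel)"
    and "integrable lborel (\<lambda>h. f (c + h)) \<longleftrightarrow> integrable lborel f"
proof -
  show "(\<integral>h. f (c + h) \<partial>lborel) = (\<integral>h. f h \<partial>lborel)"
    by (subst (2) lborel_distr_plus[of c, symmetric]) (simp add: integral_distr)
  show "integrable lborel (\<lambda>h. f (c + h)) \<longleftrightarrow> integrable lborel f"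
    by (subst (2) lborel_distr_plus[of c, symmetric]) (simp add: integrable_distr_eq)
qed

lemma integrable_gaussian_1:
  assumes "0 < c"
  shows "integrable lborel (\<lambda>x::real. exp (- c * x\<^sup>2))"
proof -
  define sd where "sd = sqrt (1 / (2 * c))"
  have sd: "0 < sd" "2 * sd\<^sup>2 = 1 / c" using assms by (auto simp: sd_def)
  have "integrable lborel (\<lambda>x. sqrt (2 * pi * sd\<^sup>2) * normal_density 0 sd x)"
    using sd by (intro integrable_mult_right integrable_normal_density)
  moreover have "sqrt (2 * pi * sd\<^sup>2) * normal_density 0 sd x = exp (- c * x\<^sup>2)" for x
    using sd assms by (simp add: normal_density_def field_simps)
  ultimately show ?thesis by simp
qed

lemma integrable_gaussian:
  assumes "0 < c"
  shows "integrable lborel (\<lambda>h::'a::euclidean_space. exp (- c * (norm h)\<^sup>2))"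
proof (rule integrableI_nonneg)
  have "(\<integral>\<^sup>+h. ennreal (exp (- c * (norm h)\<^sup>2)) \<partial>(lborel :: 'a measure))
      = (\<integral>\<^sup>+h. (\<Prod>b\<in>Basis. ennreal (exp (- c * (h \<bullet> b)\<^sup>2))) \<partial>(lborel :: 'a measure))"
  proof (intro nn_integral_cong)
    fix h :: 'a
    have "exp (- c * (norm h)\<^sup>2) = (\<Prod>b\<in>Basis. exp (- c * (h \<bullet> b)\<^sup>2))"
      unfolding power2_norm_eq_inner euclidean_inner[of h h] exp_sum[symmetric, OF finite_Basis]
      by (simp add: sum_distrib_left power2_eq_square sum_negf)
    then show "ennreal (exp (- c * (norm h)\<^sup>2)) = (\<Prod>b\<in>Basis. ennreal (exp (- c * (h \<bullet> b)\<^sup>2)))"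
      by (simp add: prod_ennreal)
  qed
  also have "\<dots> = (\<Prod>b\<in>(Basis::'a set). \<integral>\<^sup>+x. ennreal (exp (- c * x\<^sup>2)) \<partial>lborel)"
    by (rule nn_integral_lborel_prod) auto
  also have "\<dots> < \<infinity>"
    using integrable_gaussian_1[OF assms]
    by (simp add: nn_integral_eq_integral prod_ennreal flip: prod_constant)
  finally show "(\<integral>\<^sup>+h. ennreal (exp (- c * (norm h)\<^sup>2)) \<partial>(lborel :: 'a measure)) < \<infinity>" .
qed auto

text \<open>The quadratic factor is paid for with half of the exponent, through c u / 2 \<le> exp (c
  u / 2).\<close>

lemma integrable_gaussian_second_moment:
  assumes "0 < c"
  shows "integrable lborel (\<lambda>h::'a::euclidean_space. (1 + (norm h)\<^sup>2) * exp (- c * (norm h)\<^sup>2))"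
proof (rule Bochner_Integration.integrable_bound)
  show "integrable lborel (\<lambda>h::'a. (1 + 2 / c) * exp (- (c / 2) * (norm h)\<^sup>2))"
    using assms by (intro integrable_mult_right integrable_gaussian) auto
  show "AE h in lborel. norm ((1 + (norm (h::'a))\<^sup>2) * exp (- c * (norm h)\<^sup>2))
      \<le> norm ((1 + 2 / c) * exp (- (c / 2) * (norm h)\<^sup>2))"
  proof (intro AE_I2)
    fix h :: 'a
    let ?u = "(norm h)\<^sup>2"
    have "1 + ?u \<le> (1 + 2 / c) * exp (c / 2 * ?u)"
    proof -
      have "c / 2 * ?u \<le> exp (c / 2 * ?u)" using exp_ge_add_one_self[of "c / 2 * ?u"] by linarith
      then have "?u \<le> 2 / c * exp (c / 2 * ?u)" using assms by (simp add: field_simps)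
      moreover have "1 \<le> exp (c / 2 * ?u)" using assms by simp
      ultimately show ?thesis unfolding distrib_right by linarith
    qed
    then have "(1 + ?u) * exp (- c * ?u) \<le> (1 + 2 / c) * exp (c / 2 * ?u) * exp (- c * ?u)"
      by (intro mult_right_mono) auto
    also have "\<dots> = (1 + 2 / c) * exp (- (c / 2) * ?u)"
      by (simp add: mult.assoc exp_add[symmetric] field_simps)
    finally show "norm ((1 + ?u) * exp (- c * ?u)) \<le> norm ((1 + 2 / c) * exp (- (c / 2) * ?u))"
      using assms by (simp add: abs_mult)
  qed
qed auto

lemma integrable_quadratic_growth:
  fixes g \<psi> :: "'a::euclidean_space \<Rightarrow> real"
  assumes g: "integrable lborel (\<lambda>h. (1 + (norm h)\<^sup>2) * g h)" "\<And>h. 0 \<le> g h"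
    and [measurable]: "g \<in> borel_measurable borel" "\<psi> \<in> borel_measurable borel"
    and \<psi>: "\<And>h. \<bar>\<psi> h\<bar> \<le> A * (1 + (norm h)\<^sup>2)"
  shows "integrable lborel (\<lambda>h. \<psi> h * g h)"
proof (rule Bochner_Integration.integrable_bound)
  show "integrable lborel (\<lambda>h. A * ((1 + (norm h)\<^sup>2) * g h))" using g by simp
  show "AE h in lborel. norm (\<psi> h * g h) \<le> norm (A * ((1 + (norm h)\<^sup>2) * g h))"
  proof (intro AE_I2)
    fix h
    have "norm (\<psi> h * g h) \<le> A * (1 + (norm h)\<^sup>2) * g h"
      using \<psi>[of h] g(2)[of h] by (simp add: abs_mult mult_right_mono)
    also have "\<dots> \<le> norm (A * ((1 + (norm h)\<^sup>2) * g h))" by (simp add: mult.assoc)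
    finally show "norm (\<psi> h * g h) \<le> norm (A * ((1 + (norm h)\<^sup>2) * g h))" .
  qed
qed measurable

text \<open>The unnormalised normal density with precision matrix \<open>A\<close>. Only quotients
  by its integral occur, so no determinant has to be computed.\<close>

definition gauss_kernel :: "real ^ 'd ^ 'd \<Rightarrow> real ^ 'd \<Rightarrow> real" where
  "gauss_kernel A h = exp (- (h \<bullet> (A *v h)) / 2)"

lemma gauss_kernel_pos: "0 < gauss_kernel A h"
  by (simp add: gauss_kernel_def)

lemma gauss_kernel_nonneg: "0 \<le> gauss_kernel A h"
  by (simp add: gauss_kernel_def)

lemma gauss_kernel_measurable [measurable]: "gauss_kernel A \<in> borel_measurable borel"
  unfolding gauss_kernel_def[abs_def]
  by (intro borel_measurable_continuous_onI continuous_intros) auto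

section \<open>Moments of the Gaussian kernel\<close>

context
  fixes A :: "real ^ 'd ^ 'd"
  assumes A: "positive_definite A"
begin

lemma integrable_gauss_kernel_growth: "integrable lborel (\<lambda>h. (1 + (norm h)\<^sup>2) * gauss_kernel A h)"
proof -
  obtain c where c: "0 < c" "\<And>v. c * (norm v)\<^sup>2 \<le> v \<bullet> (A *v v)"
    using positive_definite_coercive[OF A] by blast
  show ?thesis
  proof (rule Bochner_Integration.integrable_bound)
    show "integrable lborel (\<lambda>h::real ^ 'd. (1 + (norm h)\<^sup>2) * exp (- (c / 2) * (norm h)\<^sup>2))"
      using c by (intro integrable_gaussian_second_moment) auto
    show "AE h in lborel. norm ((1 + (norm h)\<^sup>2) * gauss_kernel A h)
        \<le> norm ((1 + (norm h)\<^sup>2) * exp (- (c / 2) * (norm h)\<^sup>2))"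
      using c(2) by (intro AE_I2) (auto simp: gauss_kernel_def abs_mult intro!: mult_left_mono)
  qed measurable
qed

lemma integrable_gauss_kernel:
  assumes "\<psi> \<in> borel_measurable borel" and "\<And>h. \<bar>\<psi> h\<bar> \<le> C * (1 + (norm h)\<^sup>2)"
  shows "integrable lborel (\<lambda>h. \<psi> h * gauss_kernel A h)"
  using assms gauss_kernel_nonneg
  by (intro integrable_quadratic_growth[OF integrable_gauss_kernel_growth]) auto

lemma integrable_gauss_kernel': "integrable lborel (gauss_kernel A)"
  using integrable_gauss_kernel[of "\<lambda>_. 1" 1] by simp

lemma gauss_kernel_integral_pos: "0 < (\<integral>h. gauss_kernel A h \<partial>lborel)"
proof -
  have "(\<integral>h. gauss_kernel A h \<partial>lborel) \<noteq> 0"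
  proof
    assume "(\<integral>h. gauss_kernel A h \<partial>lborel) = 0"
    then have "AE h in lborel. gauss_kernel A h = 0"
      using integral_nonneg_eq_0_iff_AE[OF integrable_gauss_kernel'] gauss_kernel_nonneg by auto
    then have "AE h in lborel :: (real ^ 'd) measure. False"
      by eventually_elim (use gauss_kernel_pos[of A] in \<open>auto simp: less_le\<close>)
    then have "emeasure lborel (UNIV :: (real ^ 'd) set) = 0"
      by (simp add: AE_iff_measurable[OF _ refl])
    then show False by simp
  qed
  moreover have "0 \<le> (\<integral>h. gauss_kernel A h \<partial>lborel)"
    using gauss_kernel_nonneg by (intro integral_nonneg_AE) auto
  ultimately show ?thesis by linarith
qed

text \<open>The kernel is even and the linear form odd; the substitution h \<mapsto> - h is
  \<open>lborel_affine\<close> with factor -1.\<close>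

lemma gauss_kernel_mean: "(\<integral>h. (a \<bullet> h) * gauss_kernel A h \<partial>lborel) = 0"
proof -
  have "(\<integral>h. (a \<bullet> h) * gauss_kernel A h \<partial>lborel)
      = (\<integral>h. (a \<bullet> h) * gauss_kernel A h \<partial>density (distr lborel borel (\<lambda>x. 0 + (-1) *\<^sub>R x)) (\<lambda>_. ennreal (\<bar>-1\<bar> ^ DIM(real ^ 'd))))"
    by (subst lborel_affine[of "-1" 0]) auto
  also have "\<dots> = (\<integral>h. (a \<bullet> (- h)) * gauss_kernel A (- h) \<partial>lborel)"
    by (simp add: density_1 integral_distr)
  also have "\<dots> = - (\<integral>h. (a \<bullet> h) * gauss_kernel A h \<partial>lborel)"
    by (simp add: gauss_kernel_def matrix_vector_mult_uminus_right)
  finally show ?thesis by simp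
qed

text \<open>Completing the square.\<close>

lemma gauss_kernel_mgf:
  fixes a :: "real ^ 'd" and t :: real
  defines "s \<equiv> a \<bullet> (matrix_inv A *v a)"
  shows "integrable lborel (\<lambda>h. exp (t * (a \<bullet> h)) * gauss_kernel A h)"
    and "(\<integral>h. exp (t * (a \<bullet> h)) * gauss_kernel A h \<partial>lborel)
      = exp (t\<^sup>2 * s / 2) * (\<integral>h. gauss_kernel A h \<partial>lborel)"
proof -
  define w where "w = matrix_inv A *v a"
  have Aw: "A *v w = a" using positive_definite_matrix_inv[OF A] by (simp add: w_def)
  have sym: "x \<bullet> (A *v y) = (A *v x) \<bullet> y" for x y
    using A symmetric_dot_commute by (auto simp: positive_definite_def)
  have eq: "exp (t * (a \<bullet> h)) * gauss_kernel A h = exp (t\<^sup>2 * s / 2) * gauss_kernel A (- (t *\<^sub>R w) + h)" for h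
  proof -
    have "(- (t *\<^sub>R w) + h) \<bullet> (A *v (- (t *\<^sub>R w) + h)) = h \<bullet> (A *v h) - 2 * t * (a \<bullet> h) + t\<^sup>2 * (w \<bullet> a)"
      using sym[of w h] Aw
      by (simp add: matrix_vector_right_distrib matrix_vector_mult_uminus_right matrix_vector_mult_scaleR
          inner_diff_left inner_add_left inner_add_right inner_diff_right power2_eq_square algebra_simps inner_commute)
    then have "gauss_kernel A (- (t *\<^sub>R w) + h) = exp (t * (a \<bullet> h) - t\<^sup>2 * s / 2 - (h \<bullet> (A *v h)) / 2)"
      by (simp add: gauss_kernel_def s_def w_def[symmetric] inner_commute field_simps)
    then show ?thesis by (simp add: gauss_kernel_def exp_add[symmetric] algebra_simps)
  qed
  show "integrable lborel (\<lambda>h. exp (t * (a \<bullet> h)) * gauss_kernel A h)"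
    unfolding eq using lborel_integral_translate(2)[of "gauss_kernel A" "- (t *\<^sub>R w)"] integrable_gauss_kernel'
    by simp
  show "(\<integral>h. exp (t * (a \<bullet> h)) * gauss_kernel A h \<partial>lborel)
      = exp (t\<^sup>2 * s / 2) * (\<integral>h. gauss_kernel A h \<partial>lborel)"
    unfolding eq using lborel_integral_translate(1)[of "gauss_kernel A" "- (t *\<^sub>R w)"] by simp
qed

text \<open>The factor exp \<bar>y\<bar> makes the bound valid for all y, as the dominated
  convergence in the next lemma requires.\<close>

lemma exp_second_order: "\<bar>exp y - 1 - y\<bar> \<le> y\<^sup>2 * exp \<bar>y\<bar>" for y :: real
proof -
  obtain t where t: "\<bar>t\<bar> \<le> \<bar>y\<bar>" "exp y = (\<Sum>m<2. y ^ m / fact m) + exp t / fact 2 * y\<^sup>2"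
    using Maclaurin_exp_le[of y 2] by auto
  then have e: "exp y - 1 - y = exp t / 2 * y\<^sup>2" by (simp add: numeral_2_eq_2)
  have "\<bar>exp y - 1 - y\<bar> = exp t / 2 * y\<^sup>2" unfolding e by (simp add: abs_mult)
  also have "\<dots> \<le> exp \<bar>y\<bar> * y\<^sup>2"
  proof (rule mult_right_mono)
    have "exp t \<le> exp \<bar>y\<bar>" using t(1) by simp
    then show "exp t / 2 \<le> exp \<bar>y\<bar>" using exp_gt_zero[of t] by linarith
  qed simp
  finally show ?thesis by (simp add: mult.commute)
qed

text \<open>The variance is read off the second difference at \<open>0\<close> of the moment generating function.\<close>

lemma gauss_kernel_second_moment:
  "(\<integral>h. (a \<bullet> h)\<^sup>2 * gauss_kernel A h \<partial>lborel)
    = (a \<bullet> (matrix_inv A *v a)) * (\<integral>h. gauss_kernel A h \<partial>lborel)"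
proof -
  define s where "s = a \<bullet> (matrix_inv A *v a)"
  define Z where "Z = (\<integral>h. gauss_kernel A h \<partial>lborel)"
  define t where "t n = inverse (real (Suc n))" for n
  have t: "0 < t n" "t n \<le> 1" "t \<longlonglongrightarrow> 0" for n
    unfolding t_def using LIMSEQ_inverse_real_of_nat by (auto simp: field_simps)
  define F where "F n h = (exp (t n * (a \<bullet> h)) + exp (- t n * (a \<bullet> h)) - 2) / (t n)\<^sup>2 * gauss_kernel A h" for n h
  obtain c where c: "0 < c" "\<And>v. c * (norm v)\<^sup>2 \<le> v \<bullet> (A *v v)"
    using positive_definite_coercive[OF A] by blast
  \<comment> \<open>The kernel decays at least like exp (- c/2 (norm h)^2). By the inequality
    between arithmetic and geometric mean, exp (norm a * norm h) costs at most half of that rate and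
    the constant factor exp (2 (norm a)^2 / c), which leaves the rate c/4. The remaining factor 2
    (norm a)^2 comes from the bound on the second difference.\<close>
  define C where "C = 2 * (norm a)\<^sup>2 * exp (2 * (norm a)\<^sup>2 / c)"
  have second_diff: "(\<lambda>n. (exp (t n * x) + exp (- t n * x) - 2) / (t n)\<^sup>2) \<longlonglongrightarrow> x\<^sup>2" for x :: real
  proof -
    have "((\<lambda>u. (exp (u * x) + exp (- u * x) - 2) / u\<^sup>2) \<longlongrightarrow> x * x) (at_right 0)"
      by real_asymp
    moreover have "filterlim t (at_right 0) sequentially"
      using t by (intro tendsto_imp_filterlim_at_right) auto
    ultimately show ?thesis unfolding power2_eq_square[of x] by (rule filterlim_compose)
  qed
  have "(\<lambda>n. \<integral>h. F n h \<partial>lborel) \<longlonglongrightarrow> (\<integral>h. (a \<bullet> h)\<^sup>2 * gauss_kernel A h \<partial>lborel)"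
  proof (rule integral_dominated_convergence[where w = "\<lambda>h. C * ((1 + (norm h)\<^sup>2) * exp (- (c / 4) * (norm h)\<^sup>2))"])
    show "integrable lborel (\<lambda>h::real ^ 'd. C * ((1 + (norm h)\<^sup>2) * exp (- (c / 4) * (norm h)\<^sup>2)))"
      using c by (intro integrable_mult_right integrable_gaussian_second_moment) auto
    show "AE h in lborel. (\<lambda>n. F n h) \<longlonglongrightarrow> (a \<bullet> h)\<^sup>2 * gauss_kernel A h"
      unfolding F_def by (intro AE_I2 tendsto_intros second_diff)
    fix n
    show "AE h in lborel. norm (F n h) \<le> C * ((1 + (norm h)\<^sup>2) * exp (- (c / 4) * (norm h)\<^sup>2))"
    proof (intro AE_I2)
      fix h :: "real ^ 'd"
      let ?x = "a \<bullet> h"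
      have ax: "\<bar>?x\<bar> \<le> norm a * norm h" by (rule Cauchy_Schwarz_ineq2)
      have "\<bar>exp (t n * ?x) + exp (- t n * ?x) - 2\<bar> \<le> 2 * ((t n * ?x)\<^sup>2 * exp \<bar>t n * ?x\<bar>)"
        using exp_second_order[of "t n * ?x"] exp_second_order[of "- t n * ?x"] by simp
      also have "\<dots> \<le> 2 * ((t n * ?x)\<^sup>2 * exp (norm a * norm h))"
      proof (intro mult_left_mono)
        have "\<bar>t n * ?x\<bar> \<le> \<bar>?x\<bar>"
          using t(1,2)[of n] by (simp add: abs_mult mult_left_le_one_le)
        then show "exp \<bar>t n * ?x\<bar> \<le> exp (norm a * norm h)" using ax by simp
      qed auto
      finally have "\<bar>exp (t n * ?x) + exp (- t n * ?x) - 2\<bar> / (t n)\<^sup>2 \<le> 2 * (?x\<^sup>2 * exp (norm a * norm h))"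
        using t(1)[of n] by (simp add: field_simps power_mult_distrib)
      also have "\<dots> \<le> 2 * (((norm a)\<^sup>2 * (1 + (norm h)\<^sup>2)) * exp (2 * (norm a)\<^sup>2 / c + c / 4 * (norm h)\<^sup>2))"
      proof (intro mult_left_mono mult_mono)
        have "?x\<^sup>2 \<le> (norm a * norm h)\<^sup>2" using ax by (metis abs_ge_zero power2_abs power_mono)
        also have "\<dots> \<le> (norm a)\<^sup>2 * (1 + (norm h)\<^sup>2)" by (simp add: power_mult_distrib mult_left_mono)
        finally show "?x\<^sup>2 \<le> (norm a)\<^sup>2 * (1 + (norm h)\<^sup>2)" .
        have "0 \<le> (2 * norm a - c / 2 * norm h)\<^sup>2 / (2 * c)" using c by simp
        also have "\<dots> = 2 * (norm a)\<^sup>2 / c + c / 8 * (norm h)\<^sup>2 - norm a * norm h"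
          using c(1) by (simp add: power2_eq_square field_simps)
        finally have "norm a * norm h \<le> 2 * (norm a)\<^sup>2 / c + c / 8 * (norm h)\<^sup>2" by simp
        also have "\<dots> \<le> 2 * (norm a)\<^sup>2 / c + c / 4 * (norm h)\<^sup>2"
          using c(1) by (intro add_left_mono mult_right_mono) auto
        finally show "exp (norm a * norm h) \<le> exp (2 * (norm a)\<^sup>2 / c + c / 4 * (norm h)\<^sup>2)" by simp
      qed auto
      finally have 1: "\<bar>exp (t n * ?x) + exp (- t n * ?x) - 2\<bar> / (t n)\<^sup>2
          \<le> C * ((1 + (norm h)\<^sup>2) * exp (c / 4 * (norm h)\<^sup>2))"
        by (simp add: C_def exp_add mult_ac)
      have "norm (F n h) = \<bar>exp (t n * ?x) + exp (- t n * ?x) - 2\<bar> / (t n)\<^sup>2 * gauss_kernel A h"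
        using gauss_kernel_pos[of A h] by (simp add: F_def abs_mult)
      also have "\<dots> \<le> C * ((1 + (norm h)\<^sup>2) * exp (c / 4 * (norm h)\<^sup>2)) * exp (- (c / 2) * (norm h)\<^sup>2)"
        using c(2)[of h] by (intro mult_mono 1) (auto simp: C_def gauss_kernel_def)
      also have "\<dots> = C * ((1 + (norm h)\<^sup>2) * exp (- (c / 4) * (norm h)\<^sup>2))"
        by (simp add: mult.assoc exp_add[symmetric])
      finally show "norm (F n h) \<le> C * ((1 + (norm h)\<^sup>2) * exp (- (c / 4) * (norm h)\<^sup>2))" .
    qed
  qed (auto simp: F_def)
  moreover have "(\<integral>h. F n h \<partial>lborel) = 2 * (exp ((t n)\<^sup>2 * s / 2) - 1) / (t n)\<^sup>2 * Z" for n
  proof -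
    have "F n h = (exp (t n * (a \<bullet> h)) * gauss_kernel A h + exp (- t n * (a \<bullet> h)) * gauss_kernel A h
        - 2 * gauss_kernel A h) / (t n)\<^sup>2" for h
      by (simp add: F_def algebra_simps)
    then have "(\<integral>h. F n h \<partial>lborel) = ((\<integral>h. exp (t n * (a \<bullet> h)) * gauss_kernel A h \<partial>lborel)
        + (\<integral>h. exp (- t n * (a \<bullet> h)) * gauss_kernel A h \<partial>lborel) - 2 * Z) / (t n)\<^sup>2"
      using gauss_kernel_mgf(1)[of "t n" a] gauss_kernel_mgf(1)[of "- t n" a] integrable_gauss_kernel'
      by (simp add: Z_def)
    then show ?thesis
      using gauss_kernel_mgf(2)[of "t n" a] gauss_kernel_mgf(2)[of "- t n" a]
      by (simp add: s_def Z_def[symmetric] algebra_simps)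
  qed
  moreover have "(\<lambda>n. 2 * (exp ((t n)\<^sup>2 * s / 2) - 1) / (t n)\<^sup>2 * Z) \<longlonglongrightarrow> s * Z"
  proof -
    have "((\<lambda>u. 2 * (exp (u\<^sup>2 * s / 2) - 1) / u\<^sup>2) \<longlongrightarrow> s) (at_right 0)"
      by real_asymp
    moreover have "filterlim t (at_right 0) sequentially"
      using t by (intro tendsto_imp_filterlim_at_right) auto
    ultimately have "(\<lambda>n. 2 * (exp ((t n)\<^sup>2 * s / 2) - 1) / (t n)\<^sup>2) \<longlonglongrightarrow> s" by (rule filterlim_compose)
    then show ?thesis by (intro tendsto_intros)
  qed
  ultimately show ?thesis
    using LIMSEQ_unique by (auto simp: s_def Z_def)
qed

end

section \<open>Laplace's method\<close>

text \<open>In the original coordinate x = c + h / y, the bound norm h \<le> y (norm x + R) and the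
  Jacobian together cost the polynomial factor y^(DIM + 2), which exp (- \<epsilon> y^2) beats. What
  remains is the second moment of \<open>\<pi>\<close>.\<close>

lemma scaled_tail_negligible:
  fixes \<pi> :: "'a::euclidean_space \<Rightarrow> real" and c :: "nat \<Rightarrow> 'a"
  assumes [measurable]: "\<pi> \<in> borel_measurable borel" and \<pi>_nonneg: "\<And>x. 0 \<le> \<pi> x"
    and mom: "integrable lborel (\<lambda>x. (1 + (norm x)\<^sup>2) * \<pi> x)"
    and c: "c \<longlonglongrightarrow> x0" and y: "filterlim y at_top sequentially" and \<epsilon>: "0 < \<epsilon>"
  shows "(\<lambda>j. \<integral>\<^sup>+h. ennreal ((1 + (norm h)\<^sup>2) * (exp (- \<epsilon> * (y j)\<^sup>2) * \<pi> (c j + (1 / y j) *\<^sub>R h))) \<partial>lborel) \<longlonglongrightarrow> 0"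
proof -
  let ?D = "DIM('a)"
  define M where "M = (\<integral>x. (1 + (norm x)\<^sup>2) * \<pi> x \<partial>lborel)"
  have M: "0 \<le> M" unfolding M_def using \<pi>_nonneg by (intro integral_nonneg_AE) auto
  have "bounded (range c)" using c by (rule convergent_imp_bounded)
  then obtain R where R: "\<And>j. norm (c j) \<le> R" by (auto simp: bounded_iff)
  \<comment> \<open>Absorbs (u + R)^2 \<le> 2 u^2 + 2 R^2 and the leading 1 into a multiple of 1 +
    u^2.\<close>
  define C where "C = 2 + 2 * R\<^sup>2"
  have bound: "(\<integral>\<^sup>+h. ennreal ((1 + (norm h)\<^sup>2) * (exp (- \<epsilon> * (y j)\<^sup>2) * \<pi> (c j + (1 / y j) *\<^sub>R h))) \<partial>lborel)
      \<le> ennreal (y j ^ (?D + 2) * exp (- \<epsilon> * (y j)\<^sup>2) * C * M)" if y1: "1 \<le> y j" for j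
  proof -
    have pw: "(1 + (norm h)\<^sup>2) * (exp (- \<epsilon> * (y j)\<^sup>2) * \<pi> (c j + (1 / y j) *\<^sub>R h))
        \<le> (y j)\<^sup>2 * exp (- \<epsilon> * (y j)\<^sup>2) * C
          * ((1 + (norm (c j + (1 / y j) *\<^sub>R h))\<^sup>2) * \<pi> (c j + (1 / y j) *\<^sub>R h))" for h
    proof -
      let ?x = "c j + (1 / y j) *\<^sub>R h"
      have "norm h = y j * norm (?x - c j)" using y1 by simp
      also have "\<dots> \<le> y j * (norm ?x + R)"
        using y1 R[of j] norm_triangle_ineq4[of ?x "c j"] by (intro mult_left_mono) auto
      finally have "(norm h)\<^sup>2 \<le> (y j * (norm ?x + R))\<^sup>2" by (intro power_mono) auto
      also have "\<dots> \<le> (y j)\<^sup>2 * (2 * (norm ?x)\<^sup>2 + 2 * R\<^sup>2)"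
        using sum_squares_bound[of "norm ?x" R]
        by (auto simp: power_mult_distrib power2_sum intro!: mult_left_mono)
      finally have "1 + (norm h)\<^sup>2 \<le> (y j)\<^sup>2 * 1 + (y j)\<^sup>2 * (2 * (norm ?x)\<^sup>2 + 2 * R\<^sup>2)"
        using y1 by (intro add_mono) auto
      also have "\<dots> = (y j)\<^sup>2 * (1 + (2 * (norm ?x)\<^sup>2 + 2 * R\<^sup>2))" by (simp add: algebra_simps)
      also have "\<dots> \<le> (y j)\<^sup>2 * (C * (1 + (norm ?x)\<^sup>2))"
        by (intro mult_left_mono) (auto simp: C_def algebra_simps)
      finally have "(1 + (norm h)\<^sup>2) * (exp (- \<epsilon> * (y j)\<^sup>2) * \<pi> ?x)
          \<le> (y j)\<^sup>2 * (C * (1 + (norm ?x)\<^sup>2)) * (exp (- \<epsilon> * (y j)\<^sup>2) * \<pi> ?x)"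
        using \<pi>_nonneg by (intro mult_right_mono) auto
      then show ?thesis by (simp add: mult_ac)
    qed
    have "(\<integral>\<^sup>+h. ennreal ((1 + (norm h)\<^sup>2) * (exp (- \<epsilon> * (y j)\<^sup>2) * \<pi> (c j + (1 / y j) *\<^sub>R h))) \<partial>lborel)
        \<le> (\<integral>\<^sup>+h. ennreal ((y j)\<^sup>2 * exp (- \<epsilon> * (y j)\<^sup>2) * C)
          * ennreal ((1 + (norm (c j + (1 / y j) *\<^sub>R h))\<^sup>2) * \<pi> (c j + (1 / y j) *\<^sub>R h)) \<partial>lborel)"
      using pw \<pi>_nonneg by (intro nn_integral_mono) (auto simp: ennreal_mult'[symmetric] C_def intro!: ennreal_leI)
    also have "\<dots> = ennreal ((y j)\<^sup>2 * exp (- \<epsilon> * (y j)\<^sup>2) * C)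
          * (ennreal (y j ^ ?D) * (\<integral>\<^sup>+x. ennreal ((1 + (norm x)\<^sup>2) * \<pi> x) \<partial>lborel))"
      using y1 nn_integral_lborel_scale[of "y j" "\<lambda>x. ennreal ((1 + (norm x)\<^sup>2) * \<pi> x)" "c j"]
      by (simp add: nn_integral_cmult)
    also have "\<dots> = ennreal ((y j)\<^sup>2 * exp (- \<epsilon> * (y j)\<^sup>2) * C) * (ennreal (y j ^ ?D) * ennreal M)"
      unfolding M_def using mom \<pi>_nonneg by (subst nn_integral_eq_integral) auto
    also have "\<dots> = ennreal (y j ^ (?D + 2) * exp (- \<epsilon> * (y j)\<^sup>2) * C * M)"
      using y1 M by (simp add: ennreal_mult'[symmetric] C_def power_add power2_eq_square mult_ac)
    finally show ?thesis .
  qed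
  have "(\<lambda>j. y j ^ (?D + 2) * exp (- \<epsilon> * (y j)\<^sup>2) * C * M) \<longlonglongrightarrow> 0 * C * M"
  proof (intro tendsto_mult tendsto_const)
    have "((\<lambda>u. u ^ (?D + 2) * exp (- \<epsilon> * u\<^sup>2)) \<longlongrightarrow> 0) at_top" using \<epsilon> by real_asymp
    then show "(\<lambda>j. y j ^ (?D + 2) * exp (- \<epsilon> * (y j)\<^sup>2)) \<longlonglongrightarrow> 0" using y by (rule filterlim_compose)
  qed
  then have "(\<lambda>j. ennreal (y j ^ (?D + 2) * exp (- \<epsilon> * (y j)\<^sup>2) * C * M)) \<longlonglongrightarrow> ennreal 0"
    by (intro tendsto_ennrealI) simp
  then have lim: "(\<lambda>j. ennreal (y j ^ (?D + 2) * exp (- \<epsilon> * (y j)\<^sup>2) * C * M)) \<longlonglongrightarrow> 0" by simp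
  have "\<forall>\<^sub>F j in sequentially. 1 \<le> y j" using y by (simp add: filterlim_at_top)
  then have ev: "\<forall>\<^sub>F j in sequentially. (\<integral>\<^sup>+h. ennreal ((1 + (norm h)\<^sup>2) * (exp (- \<epsilon> * (y j)\<^sup>2) * \<pi> (c j + (1 / y j) *\<^sub>R h))) \<partial>lborel)
      \<le> ennreal (y j ^ (?D + 2) * exp (- \<epsilon> * (y j)\<^sup>2) * C * M)"
    by (rule eventually_mono) (rule bound)
  show ?thesis by (rule tendsto_sandwich[OF _ ev tendsto_const lim]) simp
qed

text \<open>Laplace's method for the rescaled functions \<open>h \<mapsto> w\<^sub>j (c\<^sub>j + h / y\<^sub>j)\<close>: dominated
  convergence near the peak, and the integrable weight \<open>\<pi>\<close> away from it.\<close>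

locale laplace_peak =
  fixes w :: "nat \<Rightarrow> 'a::euclidean_space \<Rightarrow> real" and c :: "nat \<Rightarrow> 'a" and y :: "nat \<Rightarrow> real"
    and x0 :: 'a and g \<pi> :: "'a \<Rightarrow> real" and r C \<kappa> \<epsilon> :: real
  assumes w_meas [measurable]: "\<And>j. w j \<in> borel_measurable borel" and w_nonneg: "\<And>j x. 0 \<le> w j x"
    and \<pi>_meas [measurable]: "\<pi> \<in> borel_measurable borel" and \<pi>_nonneg: "\<And>x. 0 \<le> \<pi> x"
    and \<pi>_mom: "integrable lborel (\<lambda>x. (1 + (norm x)\<^sup>2) * \<pi> x)"
    and c: "c \<longlonglongrightarrow> x0" and y: "filterlim y at_top sequentially" and y_pos: "\<And>j. 0 < y j"
    and r: "0 < r" and \<kappa>: "0 < \<kappa>" and \<epsilon>: "0 < \<epsilon>" and C: "0 \<le> C"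
    and ptw: "\<And>h. (\<lambda>j. w j (c j + (1 / y j) *\<^sub>R h)) \<longlonglongrightarrow> g h"
    and peak: "\<And>j x. norm (x - x0) < r \<Longrightarrow> w j x \<le> C * exp (- \<kappa> * (y j * norm (x - c j))\<^sup>2)"
    and tail: "\<And>j x. r \<le> norm (x - x0) \<Longrightarrow> w j x \<le> exp (- \<epsilon> * (y j)\<^sup>2) * \<pi> x"
    and g_meas [measurable]: "g \<in> borel_measurable borel"
begin

abbreviation W :: "nat \<Rightarrow> 'a \<Rightarrow> real" where
  "W j h \<equiv> w j (c j + (1 / y j) *\<^sub>R h)"

abbreviation In :: "nat \<Rightarrow> 'a \<Rightarrow> real" where
  "In j h \<equiv> indicator (ball x0 r) (c j + (1 / y j) *\<^sub>R h)"

abbreviation T :: "nat \<Rightarrow> 'a \<Rightarrow> real" where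
  "T j h \<equiv> exp (- \<epsilon> * (y j)\<^sup>2) * \<pi> (c j + (1 / y j) *\<^sub>R h)"

lemma integrable_scaled:
  fixes f :: "'a \<Rightarrow> real"
  assumes f: "integrable lborel f"
  shows "integrable lborel (\<lambda>h. f (c j + (1 / y j) *\<^sub>R h))"
proof -
  have [measurable]: "f \<in> borel_measurable borel" using f by auto
  have "(\<integral>\<^sup>+h. ennreal (norm (f (c j + (1 / y j) *\<^sub>R h))) \<partial>lborel)
      = ennreal (y j ^ DIM('a)) * (\<integral>\<^sup>+x. ennreal (norm (f x)) \<partial>lborel)"
    using y_pos by (intro nn_integral_lborel_scale) auto
  also have "\<dots> < \<infinity>" using f by (auto simp: integrable_iff_bounded ennreal_mult_less_top)
  finally show ?thesis by (intro integrableI_bounded) auto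
qed

lemma W_bound: "W j h \<le> C * exp (- \<kappa> * (norm h)\<^sup>2) + T j h"
proof (cases "norm (c j + (1 / y j) *\<^sub>R h - x0) < r")
  case True
  have "W j h \<le> C * exp (- \<kappa> * (norm h)\<^sup>2)"
    using peak[OF True, of j] y_pos[of j] by simp
  moreover have "0 \<le> T j h" using \<pi>_nonneg by simp
  ultimately show ?thesis by linarith
next
  case False
  then have "W j h \<le> T j h" using tail by simp
  moreover have "0 \<le> C * exp (- \<kappa> * (norm h)\<^sup>2)" using C by simp
  ultimately show ?thesis by linarith
qed

lemma integrable_T_growth: "integrable lborel (\<lambda>h. (1 + (norm h)\<^sup>2) * T j h)"
proof -
  let ?R = "2 + 2 * (norm (c j))\<^sup>2 "
  \<comment> \<open>At x = c + h / y one has y * norm (x - c) = norm h, so \<open>?f\<close> is the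
    wanted integrand in the original coordinate, up to the exponential constant.\<close>
  let ?f = "\<lambda>x. (1 + (y j * norm (x - c j))\<^sup>2) * \<pi> x"
  have "integrable lborel (\<lambda>x. (1 + (y j)\<^sup>2) * ?R * ((1 + (norm x)\<^sup>2) * \<pi> x))"
    by (intro integrable_mult_right \<pi>_mom)
  then have "integrable lborel ?f"
  proof (rule Bochner_Integration.integrable_bound)
    show "AE x in lborel. norm (?f x) \<le> norm ((1 + (y j)\<^sup>2) * ?R * ((1 + (norm x)\<^sup>2) * \<pi> x))"
    proof (intro AE_I2)
      fix x
      have "(norm (x - c j))\<^sup>2 \<le> (norm x + norm (c j))\<^sup>2"
        by (intro power_mono norm_triangle_ineq4) auto
      also have "\<dots> \<le> 2 * (norm x)\<^sup>2 + 2 * (norm (c j))\<^sup>2"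
        using sum_squares_bound[of "norm x" "norm (c j)"] by (simp add: power2_sum)
      also have "\<dots> \<le> ?R * (1 + (norm x)\<^sup>2)" by (simp add: algebra_simps)
      finally have "1 + (y j * norm (x - c j))\<^sup>2 \<le> 1 * (?R * (1 + (norm x)\<^sup>2)) + (y j)\<^sup>2 * (?R * (1 + (norm x)\<^sup>2))"
        unfolding power_mult_distrib
        by (intro add_mono mult_left_mono) (auto simp: algebra_simps intro: add_nonneg_nonneg)
      then have "1 + (y j * norm (x - c j))\<^sup>2 \<le> (1 + (y j)\<^sup>2) * ?R * (1 + (norm x)\<^sup>2)"
        by (simp add: algebra_simps)
      then have "?f x \<le> (1 + (y j)\<^sup>2) * ?R * (1 + (norm x)\<^sup>2) * \<pi> x"
        using \<pi>_nonneg by (rule mult_right_mono)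
      moreover have "0 \<le> ?f x" using \<pi>_nonneg by simp
      ultimately show "norm (?f x) \<le> norm ((1 + (y j)\<^sup>2) * ?R * ((1 + (norm x)\<^sup>2) * \<pi> x))"
        by (simp add: mult.assoc)
    qed
  qed measurable
  then have "integrable lborel (\<lambda>h. exp (- \<epsilon> * (y j)\<^sup>2) * ?f (c j + (1 / y j) *\<^sub>R h))"
    by (intro integrable_mult_right integrable_scaled)
  then show ?thesis using y_pos[of j] by (simp add: mult_ac)
qed

lemma integrable_W_growth: "integrable lborel (\<lambda>h. (1 + (norm h)\<^sup>2) * W j h)"
proof (rule Bochner_Integration.integrable_bound)
  show "integrable lborel (\<lambda>h. C * ((1 + (norm h)\<^sup>2) * exp (- \<kappa> * (norm h)\<^sup>2)) + (1 + (norm h)\<^sup>2) * T j h)"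
    by (intro Bochner_Integration.integrable_add integrable_mult_right
        integrable_gaussian_second_moment integrable_T_growth \<kappa>)
  show "AE h in lborel. norm ((1 + (norm h)\<^sup>2) * W j h)
      \<le> norm (C * ((1 + (norm h)\<^sup>2) * exp (- \<kappa> * (norm h)\<^sup>2)) + (1 + (norm h)\<^sup>2) * T j h)"
  proof (intro AE_I2)
    fix h
    have "(1 + (norm h)\<^sup>2) * W j h \<le> (1 + (norm h)\<^sup>2) * (C * exp (- \<kappa> * (norm h)\<^sup>2) + T j h)"
      using W_bound by (intro mult_left_mono) auto
    also have "\<dots> = C * ((1 + (norm h)\<^sup>2) * exp (- \<kappa> * (norm h)\<^sup>2)) + (1 + (norm h)\<^sup>2) * T j h"
      by (simp add: algebra_simps)
    finally show "norm ((1 + (norm h)\<^sup>2) * W j h)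
      \<le> norm (C * ((1 + (norm h)\<^sup>2) * exp (- \<kappa> * (norm h)\<^sup>2)) + (1 + (norm h)\<^sup>2) * T j h)"
      using w_nonneg by simp
  qed
qed measurable

lemma laplace_limit:
  assumes [measurable]: "\<psi> \<in> borel_measurable borel"
    and \<psi>: "\<And>h. \<bar>\<psi> h\<bar> \<le> A * (1 + (norm h)\<^sup>2)"
  shows "(\<lambda>j. \<integral>h. \<psi> h * W j h \<partial>lborel) \<longlonglongrightarrow> (\<integral>h. \<psi> h * g h \<partial>lborel)"
proof -
  have [measurable]: "ball x0 r \<in> sets borel" by simp
  have A: "0 \<le> A" using order_trans[OF abs_ge_zero \<psi>[of 0]] by simp
  have int: "integrable lborel (\<lambda>h. \<psi> h * W j h)" for j
    using w_nonneg by (intro integrable_quadratic_growth[OF integrable_W_growth _ _ _ \<psi>]) auto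
  have int_in: "integrable lborel (\<lambda>h. \<psi> h * (W j h * In j h))" for j
  proof (rule Bochner_Integration.integrable_bound[OF int[of j]])
    show "(\<lambda>h. \<psi> h * (W j h * In j h)) \<in> borel_measurable lborel" by measurable
  qed (auto simp: abs_mult split: split_indicator)
  have in_lim: "(\<lambda>j. \<integral>h. \<psi> h * (W j h * In j h) \<partial>lborel) \<longlonglongrightarrow> (\<integral>h. \<psi> h * g h \<partial>lborel)"
  proof (rule integral_dominated_convergence[where w = "\<lambda>h. A * C * ((1 + (norm h)\<^sup>2) * exp (- \<kappa> * (norm h)\<^sup>2))"])
    show "integrable lborel (\<lambda>h::'a. A * C * ((1 + (norm h)\<^sup>2) * exp (- \<kappa> * (norm h)\<^sup>2)))"
      by (intro integrable_mult_right integrable_gaussian_second_moment \<kappa>)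
    show "AE h in lborel. (\<lambda>j. \<psi> h * (W j h * In j h)) \<longlonglongrightarrow> \<psi> h * g h"
    proof (intro AE_I2 tendsto_mult tendsto_const)
      fix h
      \<comment> \<open>For fixed \<open>h\<close> the rescaled point tends to \<open>x0\<close>, so
        the indicator is eventually 1 and leaves the limit unchanged.\<close>
      have "(\<lambda>j. 1 / y j) \<longlonglongrightarrow> 0" using y by (intro real_tendsto_divide_at_top[OF tendsto_const])
      then have "(\<lambda>j. c j + (1 / y j) *\<^sub>R h) \<longlonglongrightarrow> x0 + 0 *\<^sub>R h" by (intro tendsto_intros c)
      then have "\<forall>\<^sub>F j in sequentially. c j + (1 / y j) *\<^sub>R h \<in> ball x0 r"
        using r by (intro topological_tendstoD) auto
      then have "(\<lambda>j. W j h * In j h) \<longlonglongrightarrow> g h \<longleftrightarrow> (\<lambda>j. W j h) \<longlonglongrightarrow> g h"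
        by (intro filterlim_cong) (auto elim: eventually_mono)
      then show "(\<lambda>j. W j h * In j h) \<longlonglongrightarrow> g h" using ptw by simp
    qed
    fix j
    show "AE h in lborel. norm (\<psi> h * (W j h * In j h)) \<le> A * C * ((1 + (norm h)\<^sup>2) * exp (- \<kappa> * (norm h)\<^sup>2))"
    proof (intro AE_I2)
      fix h
      have "W j h * In j h \<le> C * exp (- \<kappa> * (norm h)\<^sup>2)"
        using peak[of "c j + (1 / y j) *\<^sub>R h" j] y_pos[of j] C
        by (auto simp: dist_norm norm_minus_commute split: split_indicator)
      moreover have "0 \<le> W j h * In j h" using w_nonneg by simp
      ultimately have "\<bar>\<psi> h\<bar> * \<bar>W j h * In j h\<bar> \<le> (A * (1 + (norm h)\<^sup>2)) * (C * exp (- \<kappa> * (norm h)\<^sup>2))"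
        using \<psi>[of h] A by (intro mult_mono) auto
      then show "norm (\<psi> h * (W j h * In j h)) \<le> A * C * ((1 + (norm h)\<^sup>2) * exp (- \<kappa> * (norm h)\<^sup>2))"
        by (simp add: abs_mult mult_ac)
    qed
  qed measurable
  have out_lim: "(\<lambda>j. (\<integral>h. \<psi> h * W j h \<partial>lborel) - (\<integral>h. \<psi> h * (W j h * In j h) \<partial>lborel)) \<longlonglongrightarrow> 0"
  proof (rule Lim_null_comparison)
    let ?t = "\<lambda>j. \<integral>h. (1 + (norm h)\<^sup>2) * T j h \<partial>lborel"
    show "\<forall>\<^sub>F j in sequentially. norm ((\<integral>h. \<psi> h * W j h \<partial>lborel) - (\<integral>h. \<psi> h * (W j h * In j h) \<partial>lborel)) \<le> A * ?t j"
    proof (intro always_eventually allI)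
      fix j
      have "norm ((\<integral>h. \<psi> h * W j h \<partial>lborel) - (\<integral>h. \<psi> h * (W j h * In j h) \<partial>lborel))
          = norm (\<integral>h. \<psi> h * W j h - \<psi> h * (W j h * In j h) \<partial>lborel)"
        using int int_in by simp
      also have "\<dots> \<le> (\<integral>h. A * ((1 + (norm h)\<^sup>2) * T j h) \<partial>lborel)"
      proof (rule order_trans[OF integral_norm_bound], rule integral_mono)
        show "integrable lborel (\<lambda>h. norm (\<psi> h * W j h - \<psi> h * (W j h * In j h)))"
          using int int_in by (intro integrable_norm Bochner_Integration.integrable_diff)
        show "integrable lborel (\<lambda>h. A * ((1 + (norm h)\<^sup>2) * T j h))" using integrable_T_growth by simp
        fix h
        have "\<bar>\<psi> h\<bar> * W j h \<le> A * (1 + (norm h)\<^sup>2) * T j h" if "c j + (1 / y j) *\<^sub>R h \<notin> ball x0 r"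
          using that tail[of "c j + (1 / y j) *\<^sub>R h" j] A \<psi>[of h] w_nonneg
          by (intro mult_mono) (auto simp: dist_norm norm_minus_commute)
        moreover have "0 \<le> A * (1 + (norm h)\<^sup>2) * T j h" using A \<pi>_nonneg by simp
        ultimately show "norm (\<psi> h * W j h - \<psi> h * (W j h * In j h)) \<le> A * ((1 + (norm h)\<^sup>2) * T j h)"
          using w_nonneg by (auto simp: abs_mult mult.assoc split: split_indicator)
      qed
      also have "\<dots> = A * ?t j" by simp
      finally show "norm ((\<integral>h. \<psi> h * W j h \<partial>lborel) - (\<integral>h. \<psi> h * (W j h * In j h) \<partial>lborel)) \<le> A * ?t j" .
    qed
    have "(\<lambda>j. ennreal (?t j)) \<longlonglongrightarrow> ennreal 0"
      using scaled_tail_negligible[OF \<pi>_meas \<pi>_nonneg \<pi>_mom c y \<epsilon>] \<pi>_nonneg integrable_T_growth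
      by (subst (asm) nn_integral_eq_integral) auto
    then have "?t \<longlonglongrightarrow> 0"
      using \<pi>_nonneg by (subst (asm) tendsto_ennreal_iff) (auto intro!: always_eventually integral_nonneg_AE)
    then show "(\<lambda>j. A * ?t j) \<longlonglongrightarrow> 0" by (rule tendsto_mult_right_zero)
  qed
  show ?thesis using tendsto_add[OF in_lim out_lim] by simp
qed

lemma integrable_W: "integrable lborel (W j)"
  using integrable_quadratic_growth[OF integrable_W_growth, of j "\<lambda>_. 1" 1] w_nonneg by simp

text \<open>Written with the same extended-real quotient as \<open>posterior\<close>, so that
  \<open>posterior_eq\<close> identifies the two directly.\<close>

definition post :: "nat \<Rightarrow> 'a measure" where
  "post j = density lborel (\<lambda>x. ennreal (w j x) / (\<integral>\<^sup>+x. ennreal (w j x) \<partial>lborel))"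

text \<open>Rescaling multiplies numerator and normalising constant by the same Jacobian, which
  cancels.\<close>

lemma nn_integral_post:
  assumes [measurable]: "\<psi> \<in> borel_measurable borel"
    and \<psi>: "\<And>h. 0 \<le> \<psi> h" "\<And>h. \<psi> h \<le> A * (1 + (norm h)\<^sup>2)"
    and pos: "0 < (\<integral>h. W j h \<partial>lborel)"
  shows "(\<integral>\<^sup>+x. ennreal (\<psi> (y j *\<^sub>R (x - c j))) \<partial>post j)
    = ennreal ((\<integral>h. \<psi> h * W j h \<partial>lborel) / (\<integral>h. W j h \<partial>lborel))"
proof -
  let ?J = "ennreal (y j ^ DIM('a))"
  define I where "I = (\<integral>\<^sup>+x. ennreal (\<psi> (y j *\<^sub>R (x - c j)) * w j x) \<partial>lborel)"
  define Z where "Z = (\<integral>\<^sup>+x. ennreal (w j x) \<partial>lborel)"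
  have y0: "0 < y j" "y j \<noteq> 0" using y_pos[of j] by auto
  have J: "?J \<noteq> 0" "?J \<noteq> \<infinity>" using y0 by auto
  have "?J * I = (\<integral>\<^sup>+h. ennreal (\<psi> h * W j h) \<partial>lborel)"
    unfolding I_def using y0 by (subst nn_integral_lborel_scale[symmetric, of _ _ "c j"]) auto
  also have "\<dots> = ennreal (\<integral>h. \<psi> h * W j h \<partial>lborel)"
    using \<psi> w_nonneg
    by (intro nn_integral_eq_integral integrable_quadratic_growth[OF integrable_W_growth, where A = A]) auto
  finally have I: "?J * I = ennreal (\<integral>h. \<psi> h * W j h \<partial>lborel)" .
  have "?J * Z = (\<integral>\<^sup>+h. ennreal (W j h) \<partial>lborel)"
    unfolding Z_def using y0 by (subst nn_integral_lborel_scale[symmetric, of _ _ "c j"]) auto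
  also have "\<dots> = ennreal (\<integral>h. W j h \<partial>lborel)"
    using w_nonneg by (intro nn_integral_eq_integral integrable_W) auto
  finally have Z: "?J * Z = ennreal (\<integral>h. W j h \<partial>lborel)" .
  have "(\<integral>\<^sup>+x. ennreal (\<psi> (y j *\<^sub>R (x - c j))) \<partial>post j)
      = (\<integral>\<^sup>+x. ennreal (\<psi> (y j *\<^sub>R (x - c j)) * w j x) / Z \<partial>lborel)"
  proof -
    have "ennreal (w j x) / Z * ennreal (\<psi> (y j *\<^sub>R (x - c j))) = ennreal (\<psi> (y j *\<^sub>R (x - c j)) * w j x) / Z" for x
      unfolding ennreal_mult[OF \<psi>(1) w_nonneg] by (metis ennreal_times_divide mult.commute)
    then show ?thesis
      unfolding post_def by (subst nn_integral_density) (auto simp: Z_def[symmetric])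
  qed
  also have "\<dots> = I / Z" unfolding I_def by (intro nn_integral_divide) auto
  also have "\<dots> = (?J * I) / (?J * Z)"
    using divide_mult_eq[OF J, of I Z] by (simp add: mult.commute)
  also have "\<dots> = ennreal ((\<integral>h. \<psi> h * W j h \<partial>lborel) / (\<integral>h. W j h \<partial>lborel))"
    unfolding I Z using pos \<psi>(1) w_nonneg by (intro divide_ennreal integral_nonneg_AE) auto
  finally show ?thesis .
qed

lemma nn_integral_post_tendsto:
  assumes [measurable]: "\<psi> \<in> borel_measurable borel"
    and \<psi>: "\<And>h. 0 \<le> \<psi> h" "\<And>h. \<psi> h \<le> A * (1 + (norm h)\<^sup>2)"
    and pos: "0 < (\<integral>h. g h \<partial>lborel)"
  shows "(\<lambda>j. \<integral>\<^sup>+x. ennreal (\<psi> (y j *\<^sub>R (x - c j))) \<partial>post j)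
    \<longlonglongrightarrow> ennreal ((\<integral>h. \<psi> h * g h \<partial>lborel) / (\<integral>h. g h \<partial>lborel))"
    and "\<forall>\<^sub>F j in sequentially. 0 < (\<integral>h. W j h \<partial>lborel)"
proof -
  have lim: "(\<lambda>j. \<integral>h. W j h \<partial>lborel) \<longlonglongrightarrow> (\<integral>h. g h \<partial>lborel)"
    using laplace_limit[of "\<lambda>_. 1" 1] by simp
  show ev: "\<forall>\<^sub>F j in sequentially. 0 < (\<integral>h. W j h \<partial>lborel)"
    using lim pos by (rule order_tendstoD(1))
  have "(\<lambda>j. ennreal ((\<integral>h. \<psi> h * W j h \<partial>lborel) / (\<integral>h. W j h \<partial>lborel)))
      \<longlonglongrightarrow> ennreal ((\<integral>h. \<psi> h * g h \<partial>lborel) / (\<integral>h. g h \<partial>lborel))"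
    using \<psi> pos by (intro tendsto_ennrealI tendsto_divide lim laplace_limit[where A = A]) auto
  moreover have "\<forall>\<^sub>F j in sequentially. ennreal ((\<integral>h. \<psi> h * W j h \<partial>lborel) / (\<integral>h. W j h \<partial>lborel))
      = (\<integral>\<^sup>+x. ennreal (\<psi> (y j *\<^sub>R (x - c j))) \<partial>post j)"
    using ev by eventually_elim (rule nn_integral_post[OF assms(1) \<psi>, symmetric])
  ultimately show "(\<lambda>j. \<integral>\<^sup>+x. ennreal (\<psi> (y j *\<^sub>R (x - c j))) \<partial>post j)
    \<longlonglongrightarrow> ennreal ((\<integral>h. \<psi> h * g h \<partial>lborel) / (\<integral>h. g h \<partial>lborel))"
    by (rule Lim_transform_eventually)
qed

end

section \<open>Quantile functions\<close>

abbreviation unif01 :: "real measure" where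
  "unif01 \<equiv> restrict_space lborel {0<..<1}"

lemma prob_space_unif01: "prob_space unif01"
  by (auto simp add: emeasure_restrict_space space_restrict_space intro!: prob_spaceI)

text \<open>The Galois connection between quantile and distribution function; strict inequalities
  come from its negation. The pointwise facts about quantiles below rest on it.\<close>

lemma quantile_le_iff:
  assumes "real_distribution M" "0 < u" "u < 1"
  shows "quantile M u \<le> x \<longleftrightarrow> u \<le> measure M {..x}"
proof -
  interpret cdf_distribution M using assms(1) by (simp add: cdf_distribution_def)
  show ?thesis
    using pseudoinverse[of u x] assms by (simp add: quantile_def cdf_def)
qed

lemma quantile_eqI:
  assumes "\<And>x. u \<le> measure M {..x} \<longleftrightarrow> q \<le> x"
  shows "quantile M u = q"
  by (simp add: quantile_def assms flip: atLeast_def)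

lemma measurable_mono_unif01:
  fixes q :: "real \<Rightarrow> real"
  assumes "mono_on {0<..<1} q"
  shows "q \<in> borel_measurable unif01"
proof -
  have "q \<in> borel_measurable (restrict_space borel {0<..<1})"
    by (intro borel_measurable_mono_on_fnc assms)
  then show ?thesis by (simp add: measurable_def space_restrict_space sets_restrict_space)
qed

lemma mono_quantile:
  assumes "real_distribution M"
  shows "mono_on {0<..<1} (quantile M)"
proof -
  interpret cdf_distribution M using assms(1) by (simp add: cdf_distribution_def)
  show ?thesis using mono_I by (simp add: quantile_def[abs_def] cdf_def)
qed

lemmas measurable_quantile = measurable_mono_unif01[OF mono_quantile]

lemma distr_quantile:
  assumes "real_distribution M"
  shows "distr unif01 borel (quantile M) = M"
proof -
  interpret cdf_distribution M using assms(1) by (simp add: cdf_distribution_def)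
  show ?thesis using distr_I_eq_M by (simp add: quantile_def[abs_def] cdf_def)
qed

text \<open>Monotonicity and left continuity both pass to averages, and by
  \<open>law_with_quantile_eq\<close> they suffice for being a quantile function. This is how the
  average over blocks is seen to define a law.\<close>

lemma quantile_tendsto_at_left:
  assumes M: "real_distribution M" and u: "0 < u" "u < 1"
  shows "(quantile M \<longlongrightarrow> quantile M u) (at_left u)"
proof (rule order_tendstoI)
  fix x assume x: "x < quantile M u"
  then have "measure M {..x} < u"
    using quantile_le_iff[OF M u, of x] by auto
  then have "\<forall>\<^sub>F v in at_left u. max 0 (measure M {..x}) < v"
    using u by (intro eventually_at_leftI[of "max 0 (measure M {..x})"]) auto
  moreover have "\<forall>\<^sub>F v in at_left u. v < u"
    by (simp add: eventually_at_filter)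
  ultimately show "\<forall>\<^sub>F v in at_left u. x < quantile M v"
  proof eventually_elim
    case (elim v)
    then have v: "0 < v" "v < 1" "\<not> v \<le> measure M {..x}"
      using u measure_nonneg[of M "{..x}"] by linarith+
    then show ?case using quantile_le_iff[OF M v(1,2), of x] by simp
  qed
next
  fix x assume x: "quantile M u < x"
  have "\<forall>\<^sub>F v in at_left u. 0 < v"
    using u by (intro eventually_at_leftI[of 0]) auto
  moreover have "\<forall>\<^sub>F v in at_left u. v < u"
    by (simp add: eventually_at_filter)
  ultimately show "\<forall>\<^sub>F v in at_left u. quantile M v < x"
  proof eventually_elim
    case (elim v)
    then have "quantile M v \<le> quantile M u"
      using mono_onD[OF mono_quantile[OF M], of v u] u by auto
    then show ?case using x by simp
  qed
qed

context
  fixes q :: "real \<Rightarrow> real"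
  assumes mono_q: "mono_on {0<..<1} q"
begin

lemma real_distribution_distr_unif01: "real_distribution (distr unif01 borel q)"
proof -
  interpret prob_space unif01 by (rule prob_space_unif01)
  show ?thesis using measurable_mono_unif01[OF mono_q] by (rule real_distribution_distr)
qed

text \<open>The critical case is x < q u: left continuity yields v < u with x < q v already, so the
  set where q \<le> x lies in (0, v] and has measure less than u.\<close>

lemma quantile_distr_unif01:
  assumes lc: "(q \<longlongrightarrow> q u) (at_left u)" and u: "0 < u" "u < 1"
  shows "quantile (distr unif01 borel q) u = q u"
proof (rule quantile_eqI)
  fix x
  let ?A = "{v\<in>{0<..<1}. q v \<le> x}"
  have A: "?A \<in> sets unif01"
    using measurable_sets[OF measurable_mono_unif01[OF mono_q], of "{..x}"]
    by (auto simp: space_restrict_space vimage_def Int_def conj_commute)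
  then have Ab: "?A \<in> sets lborel" by (subst (asm) sets_restrict_space_iff) auto
  have eq: "measure (distr unif01 borel q) {..x} = measure lborel ?A"
  proof -
    have "measure (distr unif01 borel q) {..x} = measure unif01 ?A"
      using measurable_mono_unif01[OF mono_q]
      by (subst measure_distr)
         (auto simp: space_restrict_space intro!: arg_cong[where f="measure unif01"])
    then show ?thesis by (subst (asm) measure_restrict_space) auto
  qed
  have fin: "emeasure lborel ?A < \<infinity>"
    by (rule le_less_trans[OF emeasure_mono[of _ "{0<..<1}"]]) auto
  show "u \<le> measure (distr unif01 borel q) {..x} \<longleftrightarrow> q u \<le> x"
  proof
    assume "q u \<le> x"
    then have "{0<..u} \<subseteq> ?A"
      using u mono_onD[OF mono_q, of _ u] by force
    then have "measure lborel {0<..u} \<le> measure lborel ?A"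
      using fin Ab by (intro measure_mono_fmeasurable) (auto simp: fmeasurable_def)
    then show "u \<le> measure (distr unif01 borel q) {..x}" using u by (simp add: eq)
  next
    assume le: "u \<le> measure (distr unif01 borel q) {..x}"
    show "q u \<le> x"
    proof (rule ccontr)
      assume "\<not> q u \<le> x"
      then have "\<forall>\<^sub>F v in at_left u. x < q v"
        using lc by (auto simp: order_tendsto_iff)
      moreover have "\<forall>\<^sub>F v in at_left u. v \<in> {0<..<u}"
        using u by (intro eventually_at_leftI[of 0]) auto
      ultimately have "\<forall>\<^sub>F v in at_left u. x < q v \<and> v \<in> {0<..<u}"
        by (rule eventually_conj)
      then obtain v where v: "x < q v" "0 < v" "v < u"
        using eventually_happens'[OF trivial_limit_at_left_real] by auto
      then have "?A \<subseteq> {0<..v}"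
        using u mono_onD[OF mono_q, of v] by force
      then have "measure lborel ?A \<le> measure lborel {0<..v}"
        using Ab v by (intro measure_mono_fmeasurable) (auto simp: fmeasurable_def)
      then show False using le v by (simp add: eq)
    qed
  qed
qed

text \<open>Resolves the definite description: the image of the uniform law has the right quantiles,
  and it is the only candidate because every law is the image of the uniform law under its own
  quantile function.\<close>

lemma law_with_quantile_eq:
  assumes lc: "\<And>u. 0 < u \<Longrightarrow> u < 1 \<Longrightarrow> (q \<longlongrightarrow> q u) (at_left u)"
  shows "law_with_quantile q = distr unif01 borel q"
  unfolding law_with_quantile_def
proof (rule the_equality)
  show "real_distribution (distr unif01 borel q) \<and>
      (\<forall>u\<in>{0<..<1}. quantile (distr unif01 borel q) u = q u)"
    using real_distribution_distr_unif01 quantile_distr_unif01 lc by auto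
next
  fix Q assume Q: "real_distribution Q \<and> (\<forall>u\<in>{0<..<1}. quantile Q u = q u)"
  have "Q = distr unif01 borel (quantile Q)" using Q distr_quantile by simp
  also have "\<dots> = distr unif01 borel q"
    using Q by (intro distr_cong) (auto simp: space_restrict_space)
  finally show "Q = distr unif01 borel q" .
qed

end

section \<open>Convergence of quantile functions\<close>

lemma quantile_affine:
  assumes M: "real_distribution M" and s: "0 < s" and u: "0 < u" "u < 1"
  shows "quantile (distr M borel (\<lambda>x. s * (x - c))) u = s * (quantile M u - c)"
proof (rule quantile_eqI)
  fix x
  interpret real_distribution M by fact
  have "(\<lambda>x. s * (x - c)) -` {..x} \<inter> space M = {..x / s + c}"
    using s by (auto simp: field_simps)
  then have "measure (distr M borel (\<lambda>x. s * (x - c))) {..x} = measure M {..x / s + c}"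
    by (subst measure_distr) auto
  then show "u \<le> measure (distr M borel (\<lambda>x. s * (x - c))) {..x} \<longleftrightarrow> s * (quantile M u - c) \<le> x"
    using s by (simp add: quantile_le_iff[OF M u, symmetric] field_simps)
qed

lemma quantile_tendsto:
  assumes \<mu>: "\<And>n. real_distribution (\<mu> n)" and M: "real_distribution M"
    and conv: "\<And>x. (\<lambda>n. measure (\<mu> n) {..x}) \<longlonglongrightarrow> measure M {..x}"
    and u: "0 < u" "u < 1" and cont: "isCont (quantile M) u"
  shows "(\<lambda>n. quantile (\<mu> n) u) \<longlonglongrightarrow> quantile M u"
proof (rule order_tendstoI)
  fix x assume "x < quantile M u"
  then have "measure M {..x} < u"
    using quantile_le_iff[OF M u, of x] by auto
  from order_tendstoD(2)[OF conv this]
  show "\<forall>\<^sub>F n in sequentially. x < quantile (\<mu> n) u"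
    by eventually_elim (use quantile_le_iff[OF \<mu> u] in \<open>auto simp: not_le[symmetric]\<close>)
next
  fix x assume x: "quantile M u < x"
  \<comment> \<open>The inequality u \<le> F(y) would not survive a limit. Continuity of the
    quantile function at \<open>u\<close> supplies a level v > u whose quantile is still below y,
    hence u < v \<le> F(y), and this strict inequality is inherited by the approximating
    laws.\<close>
  then obtain y where y: "quantile M u < y" "y < x" using dense by blast
  have "(quantile M \<longlongrightarrow> quantile M u) (at_right u)"
    using cont by (auto intro: tendsto_within_subset simp: continuous_at)
  then have "\<forall>\<^sub>F v in at_right u. quantile M v < y"
    using y(1) by (auto simp: order_tendsto_iff)
  moreover have "\<forall>\<^sub>F v in at_right u. v \<in> {u<..<1}"
    using u by (intro eventually_at_rightI[of _ 1]) auto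
  ultimately have "\<forall>\<^sub>F v in at_right u. quantile M v < y \<and> v \<in> {u<..<1}"
    by (rule eventually_conj)
  then obtain v where v: "quantile M v < y" "u < v" "v < 1"
    using eventually_happens'[OF trivial_limit_at_right_real] by auto
  then have "v \<le> measure M {..y}"
    using quantile_le_iff[OF M, of v y] u by auto
  then have "u < measure M {..y}" using v by simp
  from order_tendstoD(1)[OF conv this]
  show "\<forall>\<^sub>F n in sequentially. quantile (\<mu> n) u < x"
  proof eventually_elim
    case (elim n)
    then have "quantile (\<mu> n) u \<le> y" using quantile_le_iff[OF \<mu> u] by auto
    then show ?case using y by simp
  qed
qed

lemma AE_isCont_quantile:
  assumes "real_distribution M"
  shows "AE u in unif01. isCont (quantile M) u"
proof -
  let ?D = "{u\<in>{0<..<1}. \<not> isCont (quantile M) u}"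
  have "countable ?D"
    using mono_on_ctble_discont[OF mono_quantile[OF assms]]
    by (simp add: at_within_open[of _ "{0 <..< 1}"] cong: conj_cong)
  then have "emeasure unif01 ?D = 0"
    using emeasure_lborel_countable[of ?D] by (subst emeasure_restrict_space) auto
  moreover have "?D \<in> sets unif01"
    using sets.countable[OF _ \<open>countable ?D\<close>, of borel] by (auto simp: sets_restrict_space_iff)
  ultimately show ?thesis
    by (intro AE_I[of _ _ ?D]) (auto simp: space_restrict_space)
qed

lemma nn_integral_quantile:
  assumes M: "real_distribution M" and [measurable]: "f \<in> borel_measurable borel"
  shows "(\<integral>\<^sup>+u. f (quantile M u) \<partial>unif01) = (\<integral>\<^sup>+x. f x \<partial>M)"
  using nn_integral_distr[OF measurable_quantile[OF M], of f]
  by (subst (2) distr_quantile[OF M, symmetric]) simp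

text \<open>The parallelogram law turns Fatou's lemma for \<open>(q\<^sub>n + q)\<^sup>2\<close> into an
  upper bound for the limit superior of the integrals of \<open>(q\<^sub>n - q)\<^sup>2\<close>.\<close>

lemma quantile_L2_tendsto:
  assumes \<mu>: "\<And>n. real_distribution (\<mu> n)" and M: "real_distribution M"
    and conv: "\<And>x. (\<lambda>n. measure (\<mu> n) {..x}) \<longlonglongrightarrow> measure M {..x}"
    and mom: "(\<lambda>n. \<integral>\<^sup>+x. ennreal (x\<^sup>2) \<partial>\<mu> n) \<longlonglongrightarrow> ennreal s"
    and s: "(\<integral>\<^sup>+x. ennreal (x\<^sup>2) \<partial>M) = ennreal s" "0 \<le> s"
  shows "(\<lambda>n. \<integral>\<^sup>+u. ennreal ((quantile (\<mu> n) u - quantile M u)\<^sup>2) \<partial>unif01) \<longlonglongrightarrow> 0"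
proof -
  note [measurable] = measurable_quantile[OF \<mu>] measurable_quantile[OF M]
  let ?q = "\<lambda>n. quantile (\<mu> n)" and ?r = "quantile M"
  define A where "A n = (\<integral>\<^sup>+u. ennreal ((?q n u + ?r u)\<^sup>2) \<partial>unif01)" for n
  define B where "B n = (\<integral>\<^sup>+u. ennreal ((?q n u - ?r u)\<^sup>2) \<partial>unif01)" for n
  define C where "C n = (\<integral>\<^sup>+x. ennreal (x\<^sup>2) \<partial>\<mu> n)" for n
  have AB: "A n + B n = 2 * C n + 2 * ennreal s" for n
  proof -
    have "A n + B n = (\<integral>\<^sup>+u. ennreal ((?q n u + ?r u)\<^sup>2) + ennreal ((?q n u - ?r u)\<^sup>2) \<partial>unif01)"
      unfolding A_def B_def by (subst nn_integral_add) auto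
    also have "\<dots> = (\<integral>\<^sup>+u. 2 * ennreal ((?q n u)\<^sup>2) + 2 * ennreal ((?r u)\<^sup>2) \<partial>unif01)"
    proof (intro nn_integral_cong)
      fix u
      have "ennreal ((?q n u + ?r u)\<^sup>2) + ennreal ((?q n u - ?r u)\<^sup>2)
          = ennreal ((?q n u + ?r u)\<^sup>2 + (?q n u - ?r u)\<^sup>2)" by simp
      also have "(?q n u + ?r u)\<^sup>2 + (?q n u - ?r u)\<^sup>2 = 2 * (?q n u)\<^sup>2 + 2 * (?r u)\<^sup>2"
        by (simp add: power2_sum power2_diff)
      finally show "ennreal ((?q n u + ?r u)\<^sup>2) + ennreal ((?q n u - ?r u)\<^sup>2)
          = 2 * ennreal ((?q n u)\<^sup>2) + 2 * ennreal ((?r u)\<^sup>2)" by (simp add: ennreal_mult')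
    qed
    also have "\<dots> = 2 * (\<integral>\<^sup>+u. ennreal ((?q n u)\<^sup>2) \<partial>unif01) + 2 * (\<integral>\<^sup>+u. ennreal ((?r u)\<^sup>2) \<partial>unif01)"
      by (subst nn_integral_add) (auto simp: nn_integral_cmult)
    also have "\<dots> = 2 * C n + 2 * ennreal s"
      using nn_integral_quantile[OF \<mu>, of "\<lambda>x. ennreal (x\<^sup>2)" n]
        nn_integral_quantile[OF M, of "\<lambda>x. ennreal (x\<^sup>2)"] by (simp add: C_def s)
    finally show ?thesis .
  qed
  have ptw: "AE u in unif01. (\<lambda>n. ennreal ((?q n u + ?r u)\<^sup>2)) \<longlonglongrightarrow> ennreal ((2 * ?r u)\<^sup>2)"
    using AE_isCont_quantile[OF M] AE_space
  proof eventually_elim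
    case (elim u)
    then have "(\<lambda>n. ?q n u) \<longlonglongrightarrow> ?r u"
      by (intro quantile_tendsto \<mu> M conv) (auto simp: space_restrict_space)
    then have "(\<lambda>n. (?q n u + ?r u)\<^sup>2) \<longlonglongrightarrow> (?r u + ?r u)\<^sup>2" by (intro tendsto_intros)
    then show ?case unfolding mult_2 by (rule tendsto_ennrealI)
  qed
  have "4 * ennreal s = (\<integral>\<^sup>+u. 4 * ennreal ((?r u)\<^sup>2) \<partial>unif01)"
    using nn_integral_quantile[OF M, of "\<lambda>x. ennreal (x\<^sup>2)"] by (simp add: nn_integral_cmult s)
  also have "\<dots> = (\<integral>\<^sup>+u. ennreal ((2 * ?r u)\<^sup>2) \<partial>unif01)"
    by (intro nn_integral_cong)
       (simp add: ennreal_mult'[symmetric] power2_eq_square flip: ennreal_numeral)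
  also have "\<dots> = (\<integral>\<^sup>+u. liminf (\<lambda>n. ennreal ((?q n u + ?r u)\<^sup>2)) \<partial>unif01)"
  proof (rule nn_integral_cong_AE)
    show "AE u in unif01. ennreal ((2 * ?r u)\<^sup>2) = liminf (\<lambda>n. ennreal ((?q n u + ?r u)\<^sup>2))"
      using ptw by eventually_elim (rule lim_imp_Liminf[OF trivial_limit_sequentially, symmetric])
  qed
  also have "\<dots> \<le> liminf A"
    unfolding A_def by (intro nn_integral_liminf) auto
  finally have lim: "4 * ennreal s \<le> liminf A" .
  have "B \<longlonglongrightarrow> 0"
  proof (rule order_tendstoI)
    fix e :: ennreal assume "0 < e"
    then obtain d' where d': "0 < d'" "d' < e" using dense by blast
    then obtain d where d: "d' = ennreal d" "0 < d"
      by (cases d') auto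
    \<comment> \<open>The case s = 0 is separate because \<open>ennreal\<close> sends negative
      numbers to 0, so that 4 s - d / 2 and 4 s would have the same image.\<close>
    have low: "\<forall>\<^sub>F n in sequentially. ennreal (4 * s) \<le> A n + ennreal (d / 2)"
    proof (cases "s = 0")
      case False
      then have "ennreal (4 * s - d / 2) < ennreal (4 * s)"
        using d s by (intro ennreal_lessI) auto
      also have "\<dots> \<le> liminf A"
        using lim s by (simp add: ennreal_mult')
      finally have "\<forall>\<^sub>F n in sequentially. ennreal (4 * s - d / 2) < A n"
        by (rule less_LiminfD)
      then show ?thesis
      proof eventually_elim
        case (elim n)
        have "ennreal (4 * s) \<le> ennreal (4 * s - d / 2) + ennreal (d / 2)"
          using d by (cases "0 \<le> 4 * s - d / 2") (auto simp: ennreal_neg ennreal_plus[symmetric] simp del: ennreal_plus)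
        also have "\<dots> \<le> A n + ennreal (d / 2)" using elim by (intro add_mono) auto
        finally show ?case .
      qed
    qed simp
    have "(\<lambda>n. 2 * C n + 2 * ennreal s) \<longlonglongrightarrow> 2 * ennreal s + 2 * ennreal s"
      using mom by (intro tendsto_add tendsto_const ennreal_tendsto_cmult) (auto simp: C_def)
    moreover have "2 * ennreal s + 2 * ennreal s < ennreal (4 * s + d / 2)"
    proof -
      have "2 * ennreal s + 2 * ennreal s = ennreal (4 * s)"
        using s by (simp add: ennreal_mult' distrib_right[symmetric])
      then show ?thesis using d s by (simp add: ennreal_less_iff)
    qed
    ultimately have "\<forall>\<^sub>F n in sequentially. 2 * C n + 2 * ennreal s < ennreal (4 * s + d / 2)"
      by (rule order_tendstoD(2))
    with low show "\<forall>\<^sub>F n in sequentially. B n < e"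
    proof eventually_elim
      case (elim n)
      \<comment> \<open>Truncated subtraction is avoided by bounding 4 s + B n and cancelling the
        finite summand 4 s at the end.\<close>
      have "ennreal (4 * s) + B n \<le> A n + ennreal (d / 2) + B n"
        using elim by (intro add_mono) auto
      also have "\<dots> = (2 * C n + 2 * ennreal s) + ennreal (d / 2)"
        unfolding AB[symmetric] by (simp only: ac_simps)
      also have "\<dots> < ennreal (4 * s + d / 2) + ennreal (d / 2)"
        using elim by (simp add: ennreal_add_left_cancel_less add.commute)
      also have "\<dots> = ennreal (4 * s) + ennreal d"
        using d s by (subst (1 2) ennreal_plus[symmetric]) auto
      finally have "B n < ennreal d" by (simp add: ennreal_add_left_cancel_less)
      then show ?case using d d' by simp
    qed
  qed (simp add: not_less)
  then show ?thesis unfolding B_def .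
qed

section \<open>The model near the true parameter\<close>

text \<open>The value \<infinity> has to be excluded since \<infinity> + (- \<infinity>) is
  \<infinity> in \<open>ereal\<close>.\<close>

lemma sum_ereal_MInf:
  assumes "finite A" "i \<in> A" "f i = - \<infinity>" "\<And>j. j \<in> A \<Longrightarrow> f j \<noteq> (\<infinity>::ereal)"
  shows "sum f A = - \<infinity>"
proof -
  have "sum f (A - {i}) \<noteq> \<infinity>" using assms by (auto simp: sum_Pinfty)
  then show ?thesis using assms by (subst sum.remove[of A i]) auto
qed

text \<open>Product and extended-real sum degenerate together. Hence a maximiser of
  \<open>loglik\<close> also maximises \<open>lik\<close>, parameters that give the data density
  zero included.\<close>

lemma lik_eq_0_or_loglik:
  assumes "\<And>t. t < length xs \<Longrightarrow> 0 \<le> p \<theta> (take t xs) (xs ! t)"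
  shows "0 < lik p \<theta> xs \<and> loglik p \<theta> xs = ereal (ln (lik p \<theta> xs)) \<or>
    lik p \<theta> xs = 0 \<and> loglik p \<theta> xs = - \<infinity>"
proof (cases "\<forall>t<length xs. 0 < p \<theta> (take t xs) (xs ! t)")
  case True
  then have "0 < lik p \<theta> xs" unfolding lik_def by (intro prod_pos) auto
  moreover have "loglik p \<theta> xs = (\<Sum>t<length xs. ereal (ln (p \<theta> (take t xs) (xs ! t))))"
    unfolding loglik_def eln_def using True by (intro sum.cong) auto
  moreover have "ln (lik p \<theta> xs) = (\<Sum>t<length xs. ln (p \<theta> (take t xs) (xs ! t)))"
    unfolding lik_def using True by (intro ln_prod) auto
  ultimately show ?thesis by (simp add: sum_ereal)
next
  case False
  then obtain t where t: "t < length xs" "p \<theta> (take t xs) (xs ! t) = 0"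
    using assms by (auto simp: not_less intro: antisym)
  then have "lik p \<theta> xs = 0" unfolding lik_def by (intro prod_zero) auto
  moreover have "loglik p \<theta> xs = - \<infinity>"
    unfolding loglik_def using t by (intro sum_ereal_MInf[of _ t]) (auto simp: eln_def)
  ultimately show ?thesis by simp
qed

lemma ereal_divide_le_minus:
  assumes "0 < n" "(u - ereal v) / ereal n \<le> - ereal \<epsilon>"
  shows "u \<le> ereal (v - n * \<epsilon>)"
  using assms by (cases u) (auto simp: field_simps)

text \<open>Collects what can be said about fixed lists of data, without their law. The radius
  \<open>r0\<close> is chosen so that the open ball lies in \<open>\<Theta>\<close> and in
  \<open>B\<close>, which makes derivatives there ordinary ones, and so that the prior on it is
  positive and at most twice its value at \<open>\<theta>0\<close>.\<close>

locale local_model =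
  fixes S :: "(real ^ 'q) set" and \<Theta> :: "(real ^ 'd) set" and p :: "('q, 'd) ts_model"
    and \<theta>0 :: "real ^ 'd" and \<delta>0 r0 :: real and env :: "(real ^ 'q) list \<Rightarrow> real"
    and \<pi>0 :: "real ^ 'd \<Rightarrow> real" and I0 :: "real ^ 'd ^ 'd"
    and est :: "(real ^ 'q) list \<Rightarrow> real ^ 'd"
  fixes B defines "B \<equiv> {\<theta>\<in>\<Theta>. norm (\<theta> - \<theta>0) \<le> \<delta>0}"
  assumes model: "density_model S \<Theta> p"
    and r0: "0 < r0" "r0 \<le> \<delta>0" "ball \<theta>0 r0 \<subseteq> \<Theta>"
    and smooth: "\<And>h y. set h \<subseteq> S \<Longrightarrow> y \<in> S \<Longrightarrow>
      (\<forall>\<theta>\<in>B. 0 < p \<theta> h y) \<and> three_times_differentiable_on (\<lambda>\<theta>. ln (p \<theta> h y)) B"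
    and envelope: "\<And>h y \<theta> i j k. set h \<subseteq> S \<Longrightarrow> y \<in> S \<Longrightarrow> \<theta> \<in> B \<Longrightarrow>
      \<bar>pd_within B i (pd_within B j (pd_within B k (\<lambda>\<theta>. ln (p \<theta> h y)))) \<theta>\<bar> \<le> env (h @ [y])"
    and information: "positive_definite I0"
    and hessian_bounds: "\<exists>c C. 0 < c \<and> (\<forall>\<^sub>F n in sequentially. \<forall>xs \<theta>.
      length xs = n \<and> set xs \<subseteq> S \<and> \<theta> \<in> B \<longrightarrow>
        positive_definite
          (- (1 / real n) *\<^sub>R hess_within B (\<lambda>\<theta>. real_of_ereal (loglik p \<theta> xs)) \<theta>) \<and>
        (\<forall>l. is_eigenvalue
            (- (1 / real n) *\<^sub>R hess_within B (\<lambda>\<theta>. real_of_ereal (loglik p \<theta> xs)) \<theta>) l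
          \<longrightarrow> c \<le> l \<and> l \<le> C))"
    and prior_nonneg: "\<And>\<theta>. \<theta> \<in> \<Theta> \<Longrightarrow> 0 \<le> \<pi>0 \<theta>"
    and prior_measurable: "\<pi>0 \<in> borel_measurable (restrict_space borel \<Theta>)"
    and prior_prob: "(\<integral>\<^sup>+\<theta>\<in>\<Theta>. ennreal (\<pi>0 \<theta>) \<partial>lborel) = 1"
    and prior_second_moment: "(\<integral>\<^sup>+\<theta>\<in>\<Theta>. ennreal ((norm \<theta>)\<^sup>2 * \<pi>0 \<theta>) \<partial>lborel) < \<infinity>"
    and prior_local: "\<And>\<theta>. \<theta> \<in> ball \<theta>0 r0 \<Longrightarrow> 0 < \<pi>0 \<theta> \<and> \<pi>0 \<theta> \<le> 2 * \<pi>0 \<theta>0"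
    and prior_continuous: "continuous (at \<theta>0) \<pi>0"
begin

abbreviation U :: "(real ^ 'd) set" where "U \<equiv> ball \<theta>0 r0"

lemma U_subset_B: "U \<subseteq> B"
  using r0 by (auto simp: B_def dist_norm norm_minus_commute)

lemma B_subset: "B \<subseteq> \<Theta>"
  by (auto simp: B_def)

lemma \<theta>0_in_U: "\<theta>0 \<in> U"
  using r0 by simp

text \<open>Real-valued stand-ins, summed term by term, for the extended-real log-likelihood and its
  first two derivatives; \<open>loglik_local\<close> and \<open>hess_within_local\<close> state the
  agreement near \<open>\<theta>0\<close>.\<close>

definition LL :: "(real ^ 'q) list \<Rightarrow> real ^ 'd \<Rightarrow> real" where
  "LL xs \<theta> = (\<Sum>t<length xs. ln (p \<theta> (take t xs) (xs ! t)))"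

definition G :: "(real ^ 'q) list \<Rightarrow> 'd \<Rightarrow> real ^ 'd \<Rightarrow> real" where
  "G xs j \<theta> = (\<Sum>t<length xs. pd_within B j (\<lambda>\<theta>. ln (p \<theta> (take t xs) (xs ! t))) \<theta>)"

definition H :: "(real ^ 'q) list \<Rightarrow> real ^ 'd \<Rightarrow> real ^ 'd ^ 'd" where
  "H xs \<theta> = (\<chi> i j. \<Sum>t<length xs. pd_within B i (pd_within B j (\<lambda>\<theta>. ln (p \<theta> (take t xs) (xs ! t)))) \<theta>)"

definition env_sum :: "(real ^ 'q) list \<Rightarrow> real" where
  "env_sum xs = (\<Sum>t<length xs. env (take (Suc t) xs))"

lemma p_nonneg: "\<theta> \<in> \<Theta> \<Longrightarrow> set h \<subseteq> S \<Longrightarrow> y \<in> S \<Longrightarrow> 0 \<le> p \<theta> h y"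
  using model by (auto simp: density_model_def)

section \<open>Local expansion of the log-likelihood\<close>

context
  fixes xs assumes xs: "set xs \<subseteq> S"
begin

lemma hist: "t < length xs \<Longrightarrow> set (take t xs) \<subseteq> S" "t < length xs \<Longrightarrow> xs ! t \<in> S"
  using xs set_take_subset[of t xs] nth_mem[of t xs] by auto

lemma lik_cases:
  assumes "\<theta> \<in> \<Theta>"
  shows "0 < lik p \<theta> xs \<and> loglik p \<theta> xs = ereal (ln (lik p \<theta> xs)) \<or>
    lik p \<theta> xs = 0 \<and> loglik p \<theta> xs = - \<infinity>"
  using assms hist p_nonneg by (intro lik_eq_0_or_loglik) auto

lemma lik_nonneg: "\<theta> \<in> \<Theta> \<Longrightarrow> 0 \<le> lik p \<theta> xs"
  using lik_cases by force

lemma lik_local: "\<theta> \<in> B \<Longrightarrow> lik p \<theta> xs = exp (LL xs \<theta>)"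
  using smooth hist by (auto simp: lik_def LL_def exp_sum intro!: prod.cong)

lemma loglik_local:
  assumes "\<theta> \<in> B"
  shows "loglik p \<theta> xs = ereal (LL xs \<theta>)"
  using lik_cases[of \<theta>] lik_local[OF assms] assms B_subset by auto

lemma diff_facts:
  assumes "t < length xs"
  shows "(\<lambda>\<theta>. ln (p \<theta> (take t xs) (xs ! t))) differentiable_on B"
    and "pd_within B j (\<lambda>\<theta>. ln (p \<theta> (take t xs) (xs ! t))) differentiable_on B"
    and "pd_within B i (pd_within B j (\<lambda>\<theta>. ln (p \<theta> (take t xs) (xs ! t)))) differentiable_on B"
  using smooth[OF hist[OF assms]] by (auto simp: three_times_differentiable_on_def)

lemma LL_deriv:
  assumes "\<theta> \<in> U"
  shows "(LL xs has_derivative (\<lambda>h. \<Sum>j\<in>UNIV. h $ j * G xs j \<theta>)) (at \<theta>)"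
proof -
  have "(LL xs has_derivative (\<lambda>h. \<Sum>t<length xs. \<Sum>j\<in>UNIV. h $ j *
      pd_within B j (\<lambda>\<theta>. ln (p \<theta> (take t xs) (xs ! t))) \<theta>)) (at \<theta>)"
    unfolding LL_def[abs_def] using assms diff_facts(1) U_subset_B
    by (intro has_derivative_sum has_derivative_pd_within[OF _ open_ball]) auto
  then show ?thesis unfolding G_def sum_distrib_left by (subst sum.swap)
qed

lemma G_deriv:
  assumes "\<theta> \<in> U"
  shows "(G xs j has_derivative (\<lambda>h. \<Sum>i\<in>UNIV. h $ i * H xs \<theta> $ i $ j)) (at \<theta>)"
proof -
  have "(G xs j has_derivative (\<lambda>h. \<Sum>t<length xs. \<Sum>i\<in>UNIV. h $ i *
      pd_within B i (pd_within B j (\<lambda>\<theta>. ln (p \<theta> (take t xs) (xs ! t)))) \<theta>)) (at \<theta>)"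
    unfolding G_def[abs_def] using assms diff_facts(2) U_subset_B
    by (intro has_derivative_sum has_derivative_pd_within[OF _ open_ball]) auto
  then show ?thesis unfolding H_def by (simp add: sum_distrib_left) (subst sum.swap)
qed

lemma H_deriv:
  assumes "\<theta> \<in> U"
  shows "((\<lambda>\<theta>. H xs \<theta> $ i $ j) has_derivative (\<lambda>h. \<Sum>k\<in>UNIV. h $ k *
    (\<Sum>t<length xs. pd_within B k (pd_within B i (pd_within B j (\<lambda>\<theta>. ln (p \<theta> (take t xs) (xs ! t))))) \<theta>))) (at \<theta>)"
proof -
  have "((\<lambda>\<theta>. H xs \<theta> $ i $ j) has_derivative (\<lambda>h. \<Sum>t<length xs. \<Sum>k\<in>UNIV. h $ k *
      pd_within B k (pd_within B i (pd_within B j (\<lambda>\<theta>. ln (p \<theta> (take t xs) (xs ! t))))) \<theta>)) (at \<theta>)"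
    unfolding H_def using assms diff_facts(3) U_subset_B
    by (simp, intro has_derivative_sum has_derivative_pd_within[OF _ open_ball]) auto
  then show ?thesis unfolding sum_distrib_left by (subst sum.swap)
qed

text \<open>The envelope of the third derivatives bounds the gradient of each Hessian entry. After
  division by the length the Lipschitz constant is bounded wherever \<open>env_sum\<close> is at
  most a multiple of the length.\<close>

lemma H_Lipschitz:
  assumes "\<theta> \<in> U" "\<theta>' \<in> U"
  shows "\<bar>H xs \<theta>' $ i $ j - H xs \<theta> $ i $ j\<bar> \<le> real CARD('d) * env_sum xs * norm (\<theta>' - \<theta>)"
proof (rule gradient_bound_Lipschitz[OF convex_ball assms H_deriv])
  fix z k assume z: "z \<in> U"
  have "\<bar>pd_within B k (pd_within B i (pd_within B j (\<lambda>\<theta>. ln (p \<theta> (take t xs) (xs ! t))))) z\<bar>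
      \<le> env (take (Suc t) xs)" if "t < length xs" for t
    using envelope[OF hist[OF that], of z k i j] z U_subset_B that by (auto simp: take_Suc_conv_app_nth)
  then show "\<bar>\<Sum>t<length xs. pd_within B k (pd_within B i (pd_within B j (\<lambda>\<theta>. ln (p \<theta> (take t xs) (xs ! t))))) z\<bar>
      \<le> env_sum xs"
    unfolding env_sum_def by (intro order_trans[OF sum_abs sum_mono]) auto
qed

lemma hess_within_local:
  assumes \<theta>: "\<theta> \<in> U" and D: "U \<subseteq> D"
  shows "hess_within D (\<lambda>\<theta>. real_of_ereal (loglik p \<theta> xs)) \<theta> = H xs \<theta>"
proof -
  \<comment> \<open>Agreement on the whole open set, not only at \<open>\<theta>\<close>, because
    the result is differentiated once more.\<close>
  have 1: "pd_within D j (\<lambda>\<theta>. real_of_ereal (loglik p \<theta> xs)) z = G xs j z" if z: "z \<in> U" for j z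
  proof -
    have "pd_within D j (\<lambda>\<theta>. real_of_ereal (loglik p \<theta> xs)) z = pd_within D j (LL xs) z"
      using loglik_local U_subset_B by (intro pd_within_local[OF open_ball z D D]) auto
    also have "\<dots> = G xs j z" by (rule pd_within_eqI[OF LL_deriv[OF z] open_ball z D])
    finally show ?thesis .
  qed
  have "pd_within D i (pd_within D j (\<lambda>\<theta>. real_of_ereal (loglik p \<theta> xs))) \<theta> = H xs \<theta> $ i $ j" for i j
  proof -
    have "pd_within D i (pd_within D j (\<lambda>\<theta>. real_of_ereal (loglik p \<theta> xs))) \<theta> = pd_within D i (G xs j) \<theta>"
      using 1 by (intro pd_within_local[OF open_ball \<theta> D D]) auto
    also have "\<dots> = H xs \<theta> $ i $ j" by (rule pd_within_eqI[OF G_deriv[OF \<theta>] open_ball \<theta> D])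
    finally show ?thesis .
  qed
  then show ?thesis by (simp add: hess_within_def vec_eq_iff)
qed

lemma score_zero_at_mle:
  assumes \<theta>: "\<theta> \<in> U" and max: "\<And>\<theta>'. \<theta>' \<in> \<Theta> \<Longrightarrow> loglik p \<theta>' xs \<le> loglik p \<theta> xs"
  shows "G xs j \<theta> = 0"
proof -
  have "\<forall>z\<in>U. LL xs z \<le> LL xs \<theta>"
    using max loglik_local \<theta> U_subset_B B_subset by (metis ereal_less_eq(3) subsetD)
  then have "(\<lambda>h. \<Sum>j\<in>UNIV. h $ j * G xs j \<theta>) = (\<lambda>h. 0)"
    using differential_zero_maxmin[OF \<theta> open_ball LL_deriv[OF \<theta>]] by blast
  from fun_cong[OF this, of "axis j 1"] have "(\<Sum>i\<in>UNIV. if i = j then G xs i \<theta> else 0) = 0"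
    by (simp add: axis_def if_distrib[of "\<lambda>x. x * _"] cong: if_cong)
  then show ?thesis by simp
qed

lemma LL_expansion_at_mle:
  assumes \<theta>: "\<theta> \<in> U" and max: "\<And>\<theta>'. \<theta>' \<in> \<Theta> \<Longrightarrow> loglik p \<theta>' xs \<le> loglik p \<theta> xs"
    and \<theta>': "\<theta>' \<in> U"
  obtains z where "z \<in> closed_segment \<theta> \<theta>'" "z \<in> U"
    "LL xs \<theta>' - LL xs \<theta> = ((\<theta>' - \<theta>) \<bullet> (H xs z *v (\<theta>' - \<theta>))) / 2"
proof -
  obtain z where z: "z \<in> closed_segment \<theta> \<theta>'"
    "LL xs \<theta>' = LL xs \<theta> + (\<Sum>j\<in>UNIV. (\<theta>' - \<theta>) $ j * G xs j \<theta>) + ((\<theta>' - \<theta>) \<bullet> (H xs z *v (\<theta>' - \<theta>))) / 2"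
    using Taylor_second_order[OF convex_ball \<theta> \<theta>' LL_deriv G_deriv] by blast
  show thesis
    using z score_zero_at_mle[OF \<theta> max] closed_segment_subset[OF \<theta> \<theta>' convex_ball]
    by (intro that[of z]) auto
qed

end

lemma H_coercive:
  obtains c n0 where "0 < c" "0 < n0"
    "\<And>xs \<theta> v. set xs \<subseteq> S \<Longrightarrow> n0 \<le> length xs \<Longrightarrow> \<theta> \<in> U \<Longrightarrow>
      v \<bullet> (H xs \<theta> *v v) \<le> - (c * real (length xs) * (norm v)\<^sup>2)"
proof -
  obtain c C n0 where c: "0 < c" and hb: "\<And>n xs \<theta>. n0 \<le> n \<Longrightarrow> length xs = n \<Longrightarrow> set xs \<subseteq> S \<Longrightarrow> \<theta> \<in> B \<Longrightarrow>
        positive_definite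
          (- (1 / real n) *\<^sub>R hess_within B (\<lambda>\<theta>. real_of_ereal (loglik p \<theta> xs)) \<theta>) \<and>
        (\<forall>l. is_eigenvalue
            (- (1 / real n) *\<^sub>R hess_within B (\<lambda>\<theta>. real_of_ereal (loglik p \<theta> xs)) \<theta>) l
          \<longrightarrow> c \<le> l \<and> l \<le> C)"
    using hessian_bounds unfolding eventually_sequentially by metis
  show thesis
  \<comment> \<open>\<open>Suc n0\<close> makes the length positive, so that the scaling by its
    inverse can be undone.\<close>
  proof (rule that[of c "Suc n0"])
    fix xs \<theta> and v :: "real ^ 'd"
    assume xs: "set xs \<subseteq> S" "Suc n0 \<le> length xs" and \<theta>: "\<theta> \<in> U"
    let ?A = "- (1 / real (length xs)) *\<^sub>R H xs \<theta>"
    have len: "0 < real (length xs)" using xs(2) by (cases xs) auto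
    have pd: "positive_definite ?A" and ev: "\<And>l. is_eigenvalue ?A l \<Longrightarrow> c \<le> l"
      using hb[of "length xs" xs \<theta>] xs \<theta> U_subset_B hess_within_local[OF xs(1) \<theta> U_subset_B] by auto
    have "c * (norm v)\<^sup>2 \<le> v \<bullet> (?A *v v)"
      using pd ev by (intro eigenvalue_lower_bound) (auto simp: positive_definite_def)
    also have "v \<bullet> (?A *v v) = - (v \<bullet> (H xs \<theta> *v v)) / real (length xs)"
      by (simp only: scaleR_matrix_vector_assoc[symmetric] inner_scaleR_right) simp
    finally show "v \<bullet> (H xs \<theta> *v v) \<le> - (c * real (length xs) * (norm v)\<^sup>2)"
      using len by (simp add: field_simps)
  qed (use c in auto)
qed

end

section \<open>Posteriors as measures\<close>

text \<open>For positive definite \<open>A\<close>, the centred normal law with variance a \<bullet>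
  A^-1 a. As an image of the kernel it can be compared with the output of Laplace's method before
  any density on the line is known.\<close>

definition gauss_proj :: "real ^ 'd ^ 'd \<Rightarrow> real ^ 'd \<Rightarrow> real measure" where
  "gauss_proj A a = distr
     (density lborel (\<lambda>h. ennreal (gauss_kernel A h / (\<integral>h. gauss_kernel A h \<partial>lborel)))) borel (\<lambda>h. a \<bullet> h)"

lemma growth_inner:
  assumes "\<And>x. \<bar>f x\<bar> \<le> C * (1 + x\<^sup>2)"
  shows "\<bar>f (a \<bullet> h)\<bar> \<le> C * (1 + (norm a)\<^sup>2) * (1 + (norm h)\<^sup>2)"
proof -
  have C: "0 \<le> C" using order_trans[OF abs_ge_zero assms[of 0]] by simp
  have "(a \<bullet> h)\<^sup>2 \<le> (norm a * norm h)\<^sup>2"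
    using Cauchy_Schwarz_ineq2[of a h] by (metis abs_ge_zero power2_abs power_mono)
  then have "1 + (a \<bullet> h)\<^sup>2 \<le> (1 + (norm a)\<^sup>2) * (1 + (norm h)\<^sup>2)"
    by (simp add: power_mult_distrib algebra_simps add_increasing)
  then have "C * (1 + (a \<bullet> h)\<^sup>2) \<le> C * ((1 + (norm a)\<^sup>2) * (1 + (norm h)\<^sup>2))"
    using C by (rule mult_left_mono)
  then show ?thesis using assms[of "a \<bullet> h"] by (simp add: mult.assoc)
qed

context
  fixes A :: "real ^ 'd ^ 'd" and a :: "real ^ 'd"
  assumes A: "positive_definite A"
begin

lemma nn_integral_gauss_proj:
  assumes [measurable]: "f \<in> borel_measurable borel"
    and f: "\<And>x. 0 \<le> f x" "\<And>x. \<bar>f x\<bar> \<le> C * (1 + x\<^sup>2)"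
  shows "(\<integral>\<^sup>+x. ennreal (f x) \<partial>gauss_proj A a)
    = ennreal ((\<integral>h. f (a \<bullet> h) * gauss_kernel A h \<partial>lborel) / (\<integral>h. gauss_kernel A h \<partial>lborel))"
proof -
  let ?Z = "\<integral>h. gauss_kernel A h \<partial>lborel"
  have Z: "0 < ?Z" by (rule gauss_kernel_integral_pos[OF A])
  have "(\<integral>\<^sup>+x. ennreal (f x) \<partial>gauss_proj A a)
      = (\<integral>\<^sup>+h. ennreal (f (a \<bullet> h) * gauss_kernel A h / ?Z) \<partial>lborel)"
    unfolding gauss_proj_def using Z f(1)
    by (auto simp: nn_integral_distr nn_integral_density ennreal_mult'[symmetric] gauss_kernel_nonneg
        mult.commute intro!: nn_integral_cong)
  also have "\<dots> = ennreal (\<integral>h. f (a \<bullet> h) * gauss_kernel A h / ?Z \<partial>lborel)"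
    using Z f growth_inner[OF f(2), of a]
    by (intro nn_integral_eq_integral integrable_divide integrable_gauss_kernel[OF A])
       (auto simp: gauss_kernel_nonneg)
  finally show ?thesis by simp
qed

lemma real_distribution_gauss_proj: "real_distribution (gauss_proj A a)"
proof -
  have "emeasure (gauss_proj A a) (space (gauss_proj A a)) = (\<integral>\<^sup>+x. ennreal 1 \<partial>gauss_proj A a)"
    by simp
  also have "\<dots> = 1"
    using gauss_kernel_integral_pos[OF A] by (subst nn_integral_gauss_proj[where C = 1]) auto
  finally have "prob_space (gauss_proj A a)" by (rule prob_spaceI)
  then show ?thesis
    by (auto simp: real_distribution_def real_distribution_axioms_def gauss_proj_def)
qed

lemma gauss_proj_second_moment:
  "(\<integral>\<^sup>+x. ennreal (x\<^sup>2) \<partial>gauss_proj A a) = ennreal (a \<bullet> (matrix_inv A *v a))"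
  using gauss_kernel_integral_pos[OF A] gauss_kernel_second_moment[OF A, of a]
  by (subst nn_integral_gauss_proj[where C = 1]) auto

lemma gauss_proj_variance_nonneg: "0 \<le> a \<bullet> (matrix_inv A *v a)"
proof -
  have "0 \<le> (\<integral>h. (a \<bullet> h)\<^sup>2 * gauss_kernel A h \<partial>lborel)"
    by (intro integral_nonneg_AE) (auto simp: gauss_kernel_nonneg)
  then show ?thesis
    using gauss_kernel_integral_pos[OF A]
    by (simp add: gauss_kernel_second_moment[OF A, of a] zero_le_mult_iff)
qed

lemma gauss_proj_mean: "(\<integral>x. x \<partial>gauss_proj A a) = 0"
proof -
  let ?Z = "\<integral>h. gauss_kernel A h \<partial>lborel"
  have "(\<integral>x. x \<partial>gauss_proj A a) = (\<integral>h. gauss_kernel A h / ?Z * (a \<bullet> h) \<partial>lborel)"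
    unfolding gauss_proj_def using gauss_kernel_integral_pos[OF A]
    by (subst integral_distr) (auto simp: integral_density gauss_kernel_nonneg)
  also have "\<dots> = (\<integral>h. (a \<bullet> h) * gauss_kernel A h / ?Z \<partial>lborel)"
    by (simp add: mult.commute)
  also have "\<dots> = 0" using gauss_kernel_mean[OF A, of a] by simp
  finally show ?thesis .
qed

end

section \<open>The posterior for one stretch of data\<close>

context local_model
begin

text \<open>A section of the joint measurability in \<open>density_model\<close>, at the point
  \<open>?z\<close> of the product space that encodes the history and the current value.\<close>

lemma p_measurable:
  assumes xs: "set h \<subseteq> S" "x \<in> S"
  shows "(\<lambda>\<theta>. p \<theta> h x) \<in> borel_measurable (restrict_space borel \<Theta>)"
proof -
  let ?z = "\<lambda>i\<in>{..length h}. (h @ [x]) ! i"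
  have "(\<lambda>(\<theta>, z). p \<theta> (map z [0..<length h]) (z (length h)))
      \<in> borel_measurable (restrict_space borel \<Theta> \<Otimes>\<^sub>M PiM {..length h} (\<lambda>_. values_measure S))"
    using model by (simp add: density_model_def)
  moreover have "?z \<in> space (PiM {..length h} (\<lambda>_. values_measure S))"
    using xs nth_mem[of _ h]
    by (auto simp: space_PiM values_measure_def space_restrict_space nth_append subset_iff)
  then have "(\<lambda>\<theta>. (\<theta>, ?z)) \<in> restrict_space borel \<Theta> \<rightarrow>\<^sub>M
      restrict_space borel \<Theta> \<Otimes>\<^sub>M PiM {..length h} (\<lambda>_. values_measure S)"
    by (intro measurable_Pair measurable_const) auto
  ultimately have "(\<lambda>\<theta>. (\<lambda>(\<theta>, z). p \<theta> (map z [0..<length h]) (z (length h))) (\<theta>, ?z))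
      \<in> borel_measurable (restrict_space borel \<Theta>)"
    by (rule measurable_compose[rotated])
  moreover have "map ?z [0..<length h] = h" "?z (length h) = x"
    by (auto simp: nth_append intro!: nth_equalityI)
  ultimately show ?thesis by simp
qed

lemma \<Theta>_borel [measurable]: "\<Theta> \<in> sets borel"
  using model by (simp add: density_model_def)

lemma lik_measurable:
  assumes "set xs \<subseteq> S"
  shows "(\<lambda>\<theta>. lik p \<theta> xs) \<in> borel_measurable (restrict_space borel \<Theta>)"
  unfolding lik_def using hist[OF assms] by (intro borel_measurable_prod p_measurable) auto

lemma borel_measurable_extend_0:
  assumes "f \<in> borel_measurable (restrict_space borel \<Theta>)"
  shows "(\<lambda>\<theta>. if \<theta> \<in> \<Theta> then f \<theta> else (0 :: real)) \<in> borel_measurable borel"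
  using assms by (subst (asm) measurable_restrict_space_iff[where c = 0]) auto

text \<open>\<open>\<pi>0\<close> is unspecified outside \<open>\<Theta>\<close>; the extension by 0
  is a Borel function on the whole space, as \<open>laplace_peak\<close> requires of its
  weight.\<close>

definition prior :: "real ^ 'd \<Rightarrow> real" where
  "prior \<theta> = (if \<theta> \<in> \<Theta> then \<pi>0 \<theta> else 0)"

lemma prior_borel [measurable]: "prior \<in> borel_measurable borel"
  unfolding prior_def[abs_def] by (rule borel_measurable_extend_0[OF prior_measurable])

lemma prior_ge_0: "0 \<le> prior \<theta>"
  using prior_nonneg by (simp add: prior_def)

lemma nn_integral_prior: "(\<integral>\<^sup>+\<theta>. ennreal (prior \<theta>) \<partial>lborel) = 1"
proof -
  have "(\<integral>\<^sup>+\<theta>. ennreal (prior \<theta>) \<partial>lborel) = (\<integral>\<^sup>+\<theta>\<in>\<Theta>. ennreal (\<pi>0 \<theta>) \<partial>lborel)"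
    by (intro nn_integral_cong) (simp add: prior_def split: split_indicator)
  then show ?thesis using prior_prob by simp
qed

lemma prior_moment: "integrable lborel (\<lambda>\<theta>. (1 + (norm \<theta>)\<^sup>2) * prior \<theta>)"
proof (rule integrableI_nonneg)
  have "(\<integral>\<^sup>+\<theta>. ennreal ((1 + (norm \<theta>)\<^sup>2) * prior \<theta>) \<partial>lborel)
      = (\<integral>\<^sup>+\<theta>. ennreal (prior \<theta>) + ennreal ((norm \<theta>)\<^sup>2 * prior \<theta>) \<partial>lborel)"
    using prior_ge_0 by (intro nn_integral_cong) (simp add: distrib_right)
  also have "\<dots> = 1 + (\<integral>\<^sup>+\<theta>. ennreal ((norm \<theta>)\<^sup>2 * prior \<theta>) \<partial>lborel)"
    by (subst nn_integral_add) (auto simp: nn_integral_prior)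
  also have "(\<integral>\<^sup>+\<theta>. ennreal ((norm \<theta>)\<^sup>2 * prior \<theta>) \<partial>lborel) = (\<integral>\<^sup>+\<theta>\<in>\<Theta>. ennreal ((norm \<theta>)\<^sup>2 * \<pi>0 \<theta>) \<partial>lborel)"
    by (intro nn_integral_cong) (simp add: prior_def split: split_indicator)
  finally show "(\<integral>\<^sup>+\<theta>. ennreal ((1 + (norm \<theta>)\<^sup>2) * prior \<theta>) \<partial>lborel) < \<infinity>"
    using prior_second_moment by simp
qed (use prior_ge_0 in auto)

definition is_mle :: "(real ^ 'q) list \<Rightarrow> bool" where
  "is_mle xs \<longleftrightarrow> set xs \<subseteq> S \<and> est xs \<in> \<Theta> \<and> (\<forall>\<theta>\<in>\<Theta>. loglik p \<theta> xs \<le> loglik p (est xs) xs)"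

lemma mle_lik:
  assumes "is_mle xs"
  shows "0 < lik p (est xs) xs" and "\<And>\<theta>. \<theta> \<in> \<Theta> \<Longrightarrow> lik p \<theta> xs \<le> lik p (est xs) xs"
proof -
  have xs: "set xs \<subseteq> S" and est: "est xs \<in> \<Theta>" "\<And>\<theta>. \<theta> \<in> \<Theta> \<Longrightarrow> loglik p \<theta> xs \<le> loglik p (est xs) xs"
    using assms by (auto simp: is_mle_def)
  have \<theta>0: "\<theta>0 \<in> B" using \<theta>0_in_U U_subset_B by blast
  have "ereal (LL xs \<theta>0) \<le> loglik p (est xs) xs"
    using est(2)[of \<theta>0] \<theta>0 B_subset loglik_local[OF xs \<theta>0] by auto
  then show pos: "0 < lik p (est xs) xs" using lik_cases[OF xs est(1)] by auto
  fix \<theta> assume \<theta>: "\<theta> \<in> \<Theta>"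
  show "lik p \<theta> xs \<le> lik p (est xs) xs"
    using lik_cases[OF xs \<theta>] lik_cases[OF xs est(1)] est(2)[OF \<theta>] pos by auto
qed

text \<open>The posterior weight divided by its likelihood factor at the estimate. The division
  cancels in the posterior, keeps the weight below the prior and gives it a limit at the
  peak.\<close>

definition wt :: "nat \<Rightarrow> (real ^ 'q) list \<Rightarrow> real ^ 'd \<Rightarrow> real" where
  "wt K xs \<theta> = (if \<theta> \<in> \<Theta> then (lik p \<theta> xs / lik p (est xs) xs) ^ K * \<pi>0 \<theta> else 0)"

lemma wt_measurable:
  assumes "set xs \<subseteq> S"
  shows "wt K xs \<in> borel_measurable borel"
  unfolding wt_def[abs_def]
  by (intro borel_measurable_extend_0 borel_measurable_times borel_measurable_power
      borel_measurable_divide lik_measurable[OF assms] prior_measurable borel_measurable_const)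

lemma wt_nonneg: "is_mle xs \<Longrightarrow> 0 \<le> wt K xs \<theta>"
  using prior_nonneg lik_nonneg[of xs] by (auto simp: wt_def is_mle_def)

lemma posterior_weight_eq:
  assumes "is_mle xs"
  shows "posterior_weight p \<Theta> \<pi>0 K xs \<theta> = ennreal (lik p (est xs) xs ^ K) * ennreal (wt K xs \<theta>)"
proof -
  have "lik p \<theta> xs ^ K * \<pi>0 \<theta> = lik p (est xs) xs ^ K * wt K xs \<theta>" if "\<theta> \<in> \<Theta>"
    using that mle_lik(1)[OF assms] by (simp add: wt_def power_divide)
  moreover have "wt K xs \<theta> = 0" if "\<theta> \<notin> \<Theta>" using that by (simp add: wt_def)
  ultimately show ?thesis
    using wt_nonneg[OF assms] mle_lik(1)[OF assms]
    by (auto simp: posterior_weight_def ennreal_mult'[symmetric] split: split_indicator)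
qed

lemma posterior_eq:
  assumes "is_mle xs"
  shows "posterior p \<Theta> \<pi>0 K xs =
    density lborel (\<lambda>\<theta>. ennreal (wt K xs \<theta>) / (\<integral>\<^sup>+\<theta>. ennreal (wt K xs \<theta>) \<partial>lborel))"
proof -
  let ?l = "ennreal (lik p (est xs) xs ^ K)"
  have [measurable]: "wt K xs \<in> borel_measurable borel"
    using assms by (intro wt_measurable) (simp add: is_mle_def)
  have l: "?l \<noteq> 0" "?l \<noteq> \<infinity>" using mle_lik(1)[OF assms] by auto
  have "?l * u / (?l * v) = u / v" for u v
    using divide_mult_eq[OF l, of u v] by (simp only: mult.commute)
  moreover have "(\<integral>\<^sup>+\<theta>. ?l * ennreal (wt K xs \<theta>) \<partial>lborel) = ?l * (\<integral>\<^sup>+\<theta>. ennreal (wt K xs \<theta>) \<partial>lborel)"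
    by (rule nn_integral_cmult) auto
  ultimately show ?thesis
    unfolding posterior_def posterior_weight_eq[OF assms] by simp
qed

lemma wt_le_prior:
  assumes "is_mle xs"
  shows "wt K xs \<theta> \<le> prior \<theta>"
proof (cases "\<theta> \<in> \<Theta>")
  case True
  have "lik p \<theta> xs / lik p (est xs) xs \<le> 1"
    using mle_lik[OF assms] True by simp
  moreover have "0 \<le> lik p \<theta> xs / lik p (est xs) xs"
    using mle_lik(1)[OF assms] lik_nonneg[OF _ True] assms by (auto simp: is_mle_def)
  ultimately have "(lik p \<theta> xs / lik p (est xs) xs) ^ K \<le> 1" by (intro power_le_one)
  then show ?thesis
    using True prior_nonneg[OF True] by (simp add: wt_def prior_def mult_left_le_one_le lik_nonneg)
      (metis mult_right_mono mult_1)
qed (simp add: wt_def prior_def)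

text \<open>The prior dominates the weight, and the weight is positive on the open ball
  \<open>U\<close>, which is not a null set. Together these make the quotient defining the posterior
  a probability density.\<close>

lemma nn_integral_wt:
  assumes "is_mle xs"
  shows "0 < (\<integral>\<^sup>+\<theta>. ennreal (wt K xs \<theta>) \<partial>lborel)" "(\<integral>\<^sup>+\<theta>. ennreal (wt K xs \<theta>) \<partial>lborel) < \<infinity>"
proof -
  have xs: "set xs \<subseteq> S" using assms by (simp add: is_mle_def)
  have [measurable]: "wt K xs \<in> borel_measurable borel" by (rule wt_measurable[OF xs])
  have "(\<integral>\<^sup>+\<theta>. ennreal (wt K xs \<theta>) \<partial>lborel) \<le> (\<integral>\<^sup>+\<theta>. ennreal (prior \<theta>) \<partial>lborel)"
    using wt_le_prior[OF assms] by (intro nn_integral_mono ennreal_leI)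
  also have "\<dots> < \<infinity>" by (simp add: nn_integral_prior)
  finally show "(\<integral>\<^sup>+\<theta>. ennreal (wt K xs \<theta>) \<partial>lborel) < \<infinity>" .
  have "(\<integral>\<^sup>+\<theta>. ennreal (wt K xs \<theta>) \<partial>lborel) \<noteq> 0"
  proof
    assume "(\<integral>\<^sup>+\<theta>. ennreal (wt K xs \<theta>) \<partial>lborel) = 0"
    then have "AE \<theta> in lborel. wt K xs \<theta> \<le> 0"
      by (subst (asm) nn_integral_0_iff_AE) (auto simp: ennreal_eq_0_iff)
    moreover have "0 < wt K xs \<theta>" if "\<theta> \<in> U" for \<theta>
      using that prior_local[OF that] lik_local[OF xs, of \<theta>] U_subset_B r0 mle_lik(1)[OF assms]
      by (auto simp: wt_def)
    ultimately have "AE \<theta> in lborel. \<theta> \<notin> U" by (auto elim!: eventually_mono simp: not_le[symmetric])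
    then have "U \<in> null_sets lborel" by (simp add: AE_iff_null_sets)
    then have "negligible U" by (simp add: negligible_iff_null_sets null_sets_completionI)
    then show False using open_not_negligible[of U] r0 by auto
  qed
  then show "0 < (\<integral>\<^sup>+\<theta>. ennreal (wt K xs \<theta>) \<partial>lborel)" by (simp add: zero_less_iff_neq_zero)
qed

lemma prob_space_posterior:
  assumes "is_mle xs"
  shows "prob_space (posterior p \<Theta> \<pi>0 K xs)"
proof (rule prob_spaceI)
  have [measurable]: "wt K xs \<in> borel_measurable borel"
    using assms by (intro wt_measurable) (simp add: is_mle_def)
  let ?Z = "\<integral>\<^sup>+\<theta>. ennreal (wt K xs \<theta>) \<partial>lborel"
  have "emeasure (posterior p \<Theta> \<pi>0 K xs) (space (posterior p \<Theta> \<pi>0 K xs)) = ?Z / ?Z"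
    unfolding posterior_eq[OF assms] by (simp add: emeasure_density nn_integral_divide)
  also have "\<dots> = 1" using nn_integral_wt[OF assms, of K] by (simp add: zero_less_iff_neq_zero)
  finally show "emeasure (posterior p \<Theta> \<pi>0 K xs) (space (posterior p \<Theta> \<pi>0 K xs)) = 1" .
qed

lemma sets_posterior [simp, measurable_cong]: "sets (posterior p \<Theta> \<pi>0 K xs) = sets borel"
  by (simp add: posterior_def)

lemma real_distribution_xi_law:
  assumes "is_mle xs"
  shows "real_distribution (xi_law a b (posterior p \<Theta> \<pi>0 K xs))"
proof -
  interpret prob_space "posterior p \<Theta> \<pi>0 K xs" by (rule prob_space_posterior[OF assms])
  show ?thesis unfolding xi_law_def by (intro real_distribution_distr) simp
qed

text \<open>What the deterministic argument asks of the data. Only \<open>\<eta>\<close> shrinks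
  along a sequence; the gap \<open>\<epsilon>\<close> and the envelope bound \<open>M\<close> stay
  fixed, and the gap is required outside the fixed radius \<open>r0\<close>. No clause mentions
  \<open>K\<close>.\<close>

definition good :: "real \<Rightarrow> real \<Rightarrow> real \<Rightarrow> (real ^ 'q) list \<Rightarrow> bool" where
  "good \<eta> \<epsilon> M xs \<longleftrightarrow> is_mle xs \<and> norm (est xs - \<theta>0) \<le> \<eta> \<and>
     (\<forall>\<theta>\<in>\<Theta>. r0 \<le> norm (\<theta> - \<theta>0) \<longrightarrow> loglik p \<theta> xs \<le> ereal (LL xs \<theta>0 - real (length xs) * \<epsilon>)) \<and>
     env_sum xs \<le> M * real (length xs) \<and>
     norm (- (1 / real (length xs)) *\<^sub>R H xs \<theta>0 - I0) \<le> \<eta>"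

text \<open>For data with a maximum likelihood estimate this is the squared Wasserstein-2 distance
  on the line between the rescaled posterior of \<xi>, centred at its estimate, and the limiting
  normal law.\<close>

definition quantile_error :: "real ^ 'd \<Rightarrow> real \<Rightarrow> nat \<Rightarrow> (real ^ 'q) list \<Rightarrow> ennreal" where
  "quantile_error a b K xs = (\<integral>\<^sup>+u. ennreal ((sqrt (real (K * length xs)) *
     (quantile (xi_law a b (posterior p \<Theta> \<pi>0 K xs)) u - (a \<bullet> est xs + b)) - quantile (gauss_proj I0 a) u)\<^sup>2) \<partial>unif01)"

end

section \<open>Bernstein-von Mises in quantile form\<close>

context local_model
begin

context
  fixes c :: real and n0 :: nat
  assumes c: "0 < c" and n0: "0 < n0"
    and coercive: "\<And>xs \<theta> v. set xs \<subseteq> S \<Longrightarrow> n0 \<le> length xs \<Longrightarrow> \<theta> \<in> U \<Longrightarrow>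
      v \<bullet> (H xs \<theta> *v v) \<le> - (c * real (length xs) * (norm v)\<^sup>2)"
begin

lemma lik_ratio_local:
  assumes "set xs \<subseteq> S" "est xs \<in> U" "\<theta> \<in> U"
  shows "(lik p \<theta> xs / lik p (est xs) xs) ^ K = exp (real K * (LL xs \<theta> - LL xs (est xs)))"
proof -
  have "lik p \<theta> xs / lik p (est xs) xs = exp (LL xs \<theta> - LL xs (est xs))"
  proof -
    have "\<theta> \<in> B" "est xs \<in> B" using assms U_subset_B by blast+
    then show ?thesis by (simp add: lik_local[OF assms(1)] exp_diff)
  qed
  then show ?thesis by (simp add: exp_of_nat_mult)
qed

text \<open>At the maximiser the linear term vanishes, so coercivity of the Hessian gives a Gaussian
  bound: c / 2 carries the 1/2 of the Taylor remainder, the power \<open>K\<close> turns n into K n,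
  and 2 * \<open>\<pi>0 \<theta>0\<close> bounds the prior on \<open>U\<close>.\<close>

lemma wt_peak:
  assumes mle: "is_mle xs" and len: "n0 \<le> length xs" and est: "est xs \<in> U" and \<theta>: "\<theta> \<in> U"
  shows "wt K xs \<theta> \<le> 2 * \<pi>0 \<theta>0 * exp (- (c / 2) * (sqrt (real (K * length xs)) * norm (\<theta> - est xs))\<^sup>2)"
proof -
  have xs: "set xs \<subseteq> S" using mle by (simp add: is_mle_def)
  obtain z where z: "z \<in> U" "LL xs \<theta> - LL xs (est xs) = ((\<theta> - est xs) \<bullet> (H xs z *v (\<theta> - est xs))) / 2"
    using LL_expansion_at_mle[OF xs est _ \<theta>] mle unfolding is_mle_def by metis
  have "real K * (LL xs \<theta> - LL xs (est xs)) \<le> real K * (- (c * real (length xs) * (norm (\<theta> - est xs))\<^sup>2) / 2)"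
    using coercive[OF xs len z(1), of "\<theta> - est xs"] unfolding z(2) by (intro mult_left_mono) auto
  also have "\<dots> = - (c / 2) * (sqrt (real (K * length xs)) * norm (\<theta> - est xs))\<^sup>2"
    by (simp add: power_mult_distrib)
  finally have "wt K xs \<theta> \<le> exp (- (c / 2) * (sqrt (real (K * length xs)) * norm (\<theta> - est xs))\<^sup>2) * (2 * \<pi>0 \<theta>0)"
    using \<theta> r0 prior_local[OF \<theta>] unfolding wt_def lik_ratio_local[OF xs est \<theta>]
    by (auto intro!: mult_mono)
  then show ?thesis by (simp add: mult.commute)
qed

text \<open>The comparison passes through \<open>\<theta>0\<close>: the maximised likelihood is at
  least the one at \<open>\<theta>0\<close>, which exceeds the one far away by exp (n \<epsilon>).
  The power \<open>K\<close> makes this exp (K n \<epsilon>), on the same scale as the peak.\<close>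

lemma wt_tail:
  assumes g: "good \<eta> \<epsilon> M xs" and \<theta>: "r0 \<le> norm (\<theta> - \<theta>0)"
  shows "wt K xs \<theta> \<le> exp (- \<epsilon> * (sqrt (real (K * length xs)))\<^sup>2) * prior \<theta>"
proof (cases "\<theta> \<in> \<Theta>")
  case True
  have mle: "is_mle xs" and xs: "set xs \<subseteq> S" using g by (auto simp: good_def is_mle_def)
  have \<theta>0: "\<theta>0 \<in> B" "\<theta>0 \<in> \<Theta>" using \<theta>0_in_U U_subset_B B_subset by blast+
  have tail: "loglik p \<theta> xs \<le> ereal (LL xs \<theta>0 - real (length xs) * \<epsilon>)"
    using g \<theta> True by (auto simp: good_def)
  have "lik p \<theta> xs \<le> exp (LL xs \<theta>0 - real (length xs) * \<epsilon>)"
  proof (cases "lik p \<theta> xs = 0")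
    case False
    then have "ln (lik p \<theta> xs) \<le> LL xs \<theta>0 - real (length xs) * \<epsilon>" "0 < lik p \<theta> xs"
      using lik_cases[OF xs True] tail by auto
    then show ?thesis by (metis exp_le_cancel_iff exp_ln)
  qed simp
  also have "\<dots> = exp (- (real (length xs) * \<epsilon>)) * lik p \<theta>0 xs"
    using lik_local[OF xs \<theta>0(1)] by (simp add: exp_diff exp_minus divide_inverse)
  also have "\<dots> \<le> exp (- (real (length xs) * \<epsilon>)) * lik p (est xs) xs"
    using mle_lik(2)[OF mle \<theta>0(2)] by (intro mult_left_mono) auto
  finally have "lik p \<theta> xs / lik p (est xs) xs \<le> exp (- (real (length xs) * \<epsilon>))"
    using mle_lik(1)[OF mle] by (simp add: field_simps)
  moreover have "0 \<le> lik p \<theta> xs / lik p (est xs) xs"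
    using mle_lik(1)[OF mle] lik_nonneg[OF xs True] by simp
  ultimately have "(lik p \<theta> xs / lik p (est xs) xs) ^ K \<le> exp (- (real (length xs) * \<epsilon>)) ^ K"
    by (intro power_mono)
  also have "\<dots> = exp (- \<epsilon> * (sqrt (real (K * length xs)))\<^sup>2)"
    by (simp add: exp_of_nat_mult[symmetric] mult_ac)
  finally show ?thesis using True prior_nonneg[OF True] by (simp add: wt_def prior_def mult_right_mono)
qed (simp add: wt_def prior_def)

text \<open>The error splits into the move from \<open>z j\<close> to \<open>\<theta>0\<close>,
  covered by the Lipschitz bound, and the error at \<open>\<theta>0\<close>, covered by
  \<open>\<eta> j\<close>.\<close>

lemma hessian_scaled_tendsto:
  assumes xs: "\<And>j. set (xs j) \<subseteq> S" "\<And>j. n0 \<le> length (xs j)"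
    and env: "\<And>j. env_sum (xs j) \<le> M * real (length (xs j))"
    and H0: "\<And>j. norm (- (1 / real (length (xs j))) *\<^sub>R H (xs j) \<theta>0 - I0) \<le> \<eta> j" "\<eta> \<longlonglongrightarrow> 0"
    and z: "\<And>j. z j \<in> U" "z \<longlonglongrightarrow> \<theta>0"
  shows "(\<lambda>j. ((1 / real (length (xs j))) *\<^sub>R H (xs j) (z j)) $ i $ k) \<longlonglongrightarrow> (- I0) $ i $ k"
proof -
  have len: "0 < real (length (xs j))" for j using xs(2)[of j] n0 by linarith
  let ?n = "\<lambda>j. real (length (xs j))"
  have "\<bar>((1 / ?n j) *\<^sub>R H (xs j) (z j)) $ i $ k - (- I0) $ i $ k\<bar>
      \<le> real CARD('d) * M * norm (z j - \<theta>0) + \<eta> j" for j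
  proof -
    have "\<bar>H (xs j) (z j) $ i $ k - H (xs j) \<theta>0 $ i $ k\<bar> \<le> real CARD('d) * (M * ?n j) * norm (z j - \<theta>0)"
      using env[of j] by (intro order_trans[OF H_Lipschitz[OF xs(1) \<theta>0_in_U z(1)]] mult_right_mono mult_left_mono) auto
    then have "\<bar>H (xs j) (z j) $ i $ k - H (xs j) \<theta>0 $ i $ k\<bar> / ?n j \<le> real CARD('d) * M * norm (z j - \<theta>0)"
      using len[of j] by (simp add: field_simps)
    then have 1: "\<bar>((1 / ?n j) *\<^sub>R H (xs j) (z j)) $ i $ k - ((1 / ?n j) *\<^sub>R H (xs j) \<theta>0) $ i $ k\<bar>
        \<le> real CARD('d) * M * norm (z j - \<theta>0)"
      using len[of j] by (simp add: diff_divide_distrib[symmetric])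
    have "\<bar>(- (1 / ?n j) *\<^sub>R H (xs j) \<theta>0 - I0) $ i $ k\<bar> \<le> norm (- (1 / ?n j) *\<^sub>R H (xs j) \<theta>0 - I0)"
      by (rule order_trans[OF component_le_norm_cart Finite_Cartesian_Product.norm_nth_le])
    then have 2: "\<bar>((1 / ?n j) *\<^sub>R H (xs j) \<theta>0) $ i $ k + I0 $ i $ k\<bar> \<le> \<eta> j"
      using H0(1)[of j] by simp
    show ?thesis using 1 2 by simp
  qed
  then have bnd: "norm (((1 / ?n j) *\<^sub>R H (xs j) (z j)) $ i $ k - (- I0) $ i $ k)
      \<le> real CARD('d) * M * norm (z j - \<theta>0) + \<eta> j" for j
    unfolding real_norm_def .
  have lim: "(\<lambda>j. real CARD('d) * M * norm (z j - \<theta>0) + \<eta> j) \<longlonglongrightarrow> 0"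
  proof -
    have "(\<lambda>j. real CARD('d) * M * norm (z j - \<theta>0) + \<eta> j) \<longlonglongrightarrow> real CARD('d) * M * norm (\<theta>0 - \<theta>0) + 0"
      by (intro tendsto_intros z H0)
    then show ?thesis by simp
  qed
  have "(\<lambda>j. ((1 / ?n j) *\<^sub>R H (xs j) (z j)) $ i $ k - (- I0) $ i $ k) \<longlonglongrightarrow> 0"
    by (intro Lim_null_comparison[OF always_eventually lim] allI bnd)
  then show ?thesis by (simp only: Lim_null[symmetric])
qed

section \<open>Limits along a sequence of good data\<close>

context
  fixes xs :: "nat \<Rightarrow> (real ^ 'q) list" and K :: "nat \<Rightarrow> nat" and \<eta> :: "nat \<Rightarrow> real" and \<epsilon> M :: real
  assumes good: "\<And>j. good (\<eta> j) \<epsilon> M (xs j)" and len: "\<And>j. n0 \<le> length (xs j)"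
    and est_U: "\<And>j. est (xs j) \<in> U" and K: "\<And>j. 1 \<le> K j"
    and len_lim: "filterlim (\<lambda>j. length (xs j)) at_top sequentially"
    and \<eta>_lim: "\<eta> \<longlonglongrightarrow> 0" and \<epsilon>: "0 < \<epsilon>"
begin

abbreviation yy :: "nat \<Rightarrow> real" where
  "yy j \<equiv> sqrt (real (K j * length (xs j)))"

lemma mle_xs: "is_mle (xs j)" and set_xs: "set (xs j) \<subseteq> S"
  using good[of j] by (auto simp: good_def is_mle_def)

lemma est_lim: "(\<lambda>j. est (xs j)) \<longlonglongrightarrow> \<theta>0"
proof -
  have "(\<lambda>j. est (xs j) - \<theta>0) \<longlonglongrightarrow> 0"
    using good by (intro Lim_null_comparison[OF always_eventually \<eta>_lim]) (auto simp: good_def)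
  then show ?thesis by (simp only: Lim_null[symmetric])
qed

lemma yy_lim: "filterlim yy at_top sequentially"
proof -
  have lim: "filterlim (\<lambda>j. sqrt (real (length (xs j)))) at_top sequentially"
    by (intro filterlim_compose[OF sqrt_at_top] filterlim_compose[OF filterlim_real_sequentially] len_lim)
  have "sqrt (real (length (xs j))) \<le> yy j" for j
    using K[of j] by (intro real_sqrt_le_mono of_nat_mono) simp
  then show ?thesis by (intro filterlim_at_top_mono[OF lim always_eventually] allI)
qed

lemma yy_pos: "0 < yy j"
proof -
  have "0 < K j" "0 < length (xs j)" using K[of j] len[of j] n0 by linarith+
  then show ?thesis by simp
qed

lemma wt_pointwise:
  "(\<lambda>j. wt (K j) (xs j) (est (xs j) + (1 / yy j) *\<^sub>R h)) \<longlonglongrightarrow> \<pi>0 \<theta>0 * gauss_kernel I0 h"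
proof -
  let ?\<theta> = "\<lambda>j. est (xs j) + (1 / yy j) *\<^sub>R h"
  have "(\<lambda>j. 1 / yy j) \<longlonglongrightarrow> 0" by (intro real_tendsto_divide_at_top[OF tendsto_const] yy_lim)
  then have "?\<theta> \<longlonglongrightarrow> \<theta>0 + 0 *\<^sub>R h" by (intro tendsto_intros est_lim)
  then have \<theta>_lim: "?\<theta> \<longlonglongrightarrow> \<theta>0" by simp
  then have ev: "\<forall>\<^sub>F j in sequentially. ?\<theta> j \<in> U"
    using r0 by (intro topological_tendstoD) auto
  \<comment> \<open>The rescaled point is outside \<open>U\<close> for only finitely many j. The
    default value \<open>\<theta>0\<close> there keeps \<open>z j\<close> in \<open>U\<close> for
    every j, as \<open>hessian_scaled_tendsto\<close> asks.\<close>
  have "\<exists>z. z \<in> U \<and> (?\<theta> j \<in> U \<longrightarrow> norm (z - \<theta>0) \<le> norm (est (xs j) - \<theta>0) + norm (?\<theta> j - \<theta>0) \<and>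
      LL (xs j) (?\<theta> j) - LL (xs j) (est (xs j)) = ((?\<theta> j - est (xs j)) \<bullet> (H (xs j) z *v (?\<theta> j - est (xs j)))) / 2)
    \<and> (?\<theta> j \<notin> U \<longrightarrow> z = \<theta>0)" for j
  proof (cases "?\<theta> j \<in> U")
    case True
    obtain z where z: "z \<in> closed_segment (est (xs j)) (?\<theta> j)" "z \<in> U"
      "LL (xs j) (?\<theta> j) - LL (xs j) (est (xs j)) = ((?\<theta> j - est (xs j)) \<bullet> (H (xs j) z *v (?\<theta> j - est (xs j)))) / 2"
      using LL_expansion_at_mle[OF set_xs est_U _ True] mle_xs[of j] unfolding is_mle_def by metis
    have "\<exists>u. 0 \<le> u \<and> u \<le> 1 \<and> z = (1 - u) *\<^sub>R est (xs j) + u *\<^sub>R ?\<theta> j"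
      using z(1) by (auto simp: in_segment)
    then obtain u where u: "0 \<le> u" "u \<le> 1" "z = (1 - u) *\<^sub>R est (xs j) + u *\<^sub>R ?\<theta> j" by blast
    then have "z - \<theta>0 = (1 - u) *\<^sub>R (est (xs j) - \<theta>0) + u *\<^sub>R (?\<theta> j - \<theta>0)"
      by (simp add: algebra_simps)
    then have "norm (z - \<theta>0) \<le> norm ((1 - u) *\<^sub>R (est (xs j) - \<theta>0)) + norm (u *\<^sub>R (?\<theta> j - \<theta>0))"
      by (simp only: norm_triangle_ineq)
    also have "\<dots> \<le> norm (est (xs j) - \<theta>0) + norm (?\<theta> j - \<theta>0)"
      unfolding norm_scaleR using u by (intro add_mono mult_left_le_one_le) auto
    finally show ?thesis using z True by blast
  qed (use \<theta>0_in_U in auto)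
  then obtain z where z: "\<And>j. z j \<in> U" "\<And>j. ?\<theta> j \<notin> U \<Longrightarrow> z j = \<theta>0"
    "\<And>j. ?\<theta> j \<in> U \<Longrightarrow> norm (z j - \<theta>0) \<le> norm (est (xs j) - \<theta>0) + norm (?\<theta> j - \<theta>0)"
    "\<And>j. ?\<theta> j \<in> U \<Longrightarrow> LL (xs j) (?\<theta> j) - LL (xs j) (est (xs j))
      = ((?\<theta> j - est (xs j)) \<bullet> (H (xs j) (z j) *v (?\<theta> j - est (xs j)))) / 2"
    by metis
  have "(\<lambda>j. norm (est (xs j) - \<theta>0) + norm (?\<theta> j - \<theta>0)) \<longlonglongrightarrow> norm (\<theta>0 - \<theta>0) + norm (\<theta>0 - \<theta>0)"
    by (intro tendsto_intros est_lim \<theta>_lim)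
  then have dist_lim: "(\<lambda>j. norm (est (xs j) - \<theta>0) + norm (?\<theta> j - \<theta>0)) \<longlonglongrightarrow> 0" by simp
  have "norm (z j - \<theta>0) \<le> norm (est (xs j) - \<theta>0) + norm (?\<theta> j - \<theta>0)" for j
    using z(2,3)[of j] by (cases "?\<theta> j \<in> U") auto
  then have "(\<lambda>j. z j - \<theta>0) \<longlonglongrightarrow> 0"
    by (intro Lim_null_comparison[OF always_eventually dist_lim] allI)
  then have z_lim: "z \<longlonglongrightarrow> \<theta>0" by (simp only: Lim_null[symmetric])
  have "(\<lambda>j. ((1 / real (length (xs j))) *\<^sub>R H (xs j) (z j)) $ i $ k) \<longlonglongrightarrow> (- I0) $ i $ k" for i k
    using good by (intro hessian_scaled_tendsto[OF set_xs len _ _ \<eta>_lim z(1) z_lim, where M = M])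
      (auto simp: good_def)
  then have quad: "(\<lambda>j. h \<bullet> (((1 / real (length (xs j))) *\<^sub>R H (xs j) (z j)) *v h)) \<longlonglongrightarrow> h \<bullet> ((- I0) *v h)"
    by (rule quadratic_form_tendsto)
  have "(\<lambda>j. \<pi>0 (?\<theta> j)) \<longlonglongrightarrow> \<pi>0 \<theta>0"
    by (rule isCont_tendsto_compose[OF prior_continuous \<theta>_lim])
  with quad have lim: "(\<lambda>j. exp (h \<bullet> (((1 / real (length (xs j))) *\<^sub>R H (xs j) (z j)) *v h) / 2) * \<pi>0 (?\<theta> j))
      \<longlonglongrightarrow> exp (h \<bullet> ((- I0) *v h) / 2) * \<pi>0 \<theta>0"
    by (intro tendsto_mult tendsto_exp tendsto_divide tendsto_const) auto
  have "(- I0) *v h = - (I0 *v h)"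
    using scaleR_matrix_vector_assoc[of "-1" I0 h] unfolding scaleR_minus1_left by (rule sym)
  then have "exp (h \<bullet> ((- I0) *v h) / 2) * \<pi>0 \<theta>0 = \<pi>0 \<theta>0 * gauss_kernel I0 h"
    by (simp only: gauss_kernel_def mult.commute inner_minus_right)
  with lim have "(\<lambda>j. exp (h \<bullet> (((1 / real (length (xs j))) *\<^sub>R H (xs j) (z j)) *v h) / 2) * \<pi>0 (?\<theta> j))
      \<longlonglongrightarrow> \<pi>0 \<theta>0 * gauss_kernel I0 h"
    by (simp only:)
  moreover have "\<forall>\<^sub>F j in sequentially.
      exp (h \<bullet> (((1 / real (length (xs j))) *\<^sub>R H (xs j) (z j)) *v h) / 2) * \<pi>0 (?\<theta> j) = wt (K j) (xs j) (?\<theta> j)"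
    using ev
  proof eventually_elim
    case (elim j)
    have pos: "0 < real (K j)" "0 < real (length (xs j))" using K[of j] len[of j] n0 by auto
    \<comment> \<open>Here \<open>K\<close> cancels: the likelihood is raised to the power K, while
      the squared displacement carries 1 / (K n). The remaining 1 / n is the normalisation under
      which the Hessian converges.\<close>
    have "real (K j) * (LL (xs j) (?\<theta> j) - LL (xs j) (est (xs j)))
        = real (K j) * ((1 / yy j)\<^sup>2 * (h \<bullet> (H (xs j) (z j) *v h)) / 2)"
      unfolding z(4)[OF elim] by (simp add: matrix_vector_mult_scaleR power2_eq_square)
    also have "\<dots> = (h \<bullet> (H (xs j) (z j) *v h)) / real (length (xs j)) / 2"
      using pos by (simp add: power_divide)
    also have "\<dots> = h \<bullet> (((1 / real (length (xs j))) *\<^sub>R H (xs j) (z j)) *v h) / 2"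
      by (simp only: scaleR_matrix_vector_assoc[symmetric] inner_scaleR_right) simp
    finally show ?case
      using elim r0 unfolding wt_def lik_ratio_local[OF set_xs est_U elim] by auto
  qed
  ultimately show ?thesis by (rule Lim_transform_eventually)
qed

lemma laplace: "laplace_peak (\<lambda>j. wt (K j) (xs j)) (\<lambda>j. est (xs j)) yy \<theta>0
    (\<lambda>h. \<pi>0 \<theta>0 * gauss_kernel I0 h) prior r0 (2 * \<pi>0 \<theta>0) (c / 2) \<epsilon>"
proof
  fix j \<theta>
  show "norm (\<theta> - \<theta>0) < r0 \<Longrightarrow> wt (K j) (xs j) \<theta> \<le> 2 * \<pi>0 \<theta>0 * exp (- (c / 2) * (yy j * norm (\<theta> - est (xs j)))\<^sup>2)"
    by (rule wt_peak[OF mle_xs len est_U]) (simp add: dist_norm norm_minus_commute)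
  show "r0 \<le> norm (\<theta> - \<theta>0) \<Longrightarrow> wt (K j) (xs j) \<theta> \<le> exp (- \<epsilon> * (yy j)\<^sup>2) * prior \<theta>"
    by (rule wt_tail[OF good])
  show "0 \<le> 2 * \<pi>0 \<theta>0" using prior_local[OF \<theta>0_in_U] by simp
qed (use wt_measurable[OF set_xs] wt_nonneg[OF mle_xs] prior_ge_0 prior_moment est_lim yy_lim yy_pos
      r0 c \<epsilon> wt_pointwise in auto)

lemma quantile_error_tendsto: "(\<lambda>j. quantile_error a b (K j) (xs j)) \<longlonglongrightarrow> 0"
proof -
  interpret L: laplace_peak "\<lambda>j. wt (K j) (xs j)" "\<lambda>j. est (xs j)" yy \<theta>0
    "\<lambda>h. \<pi>0 \<theta>0 * gauss_kernel I0 h" prior r0 "2 * \<pi>0 \<theta>0" "c / 2" \<epsilon>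
    by (rule laplace)
  let ?post = "\<lambda>j. posterior p \<Theta> \<pi>0 (K j) (xs j)"
  let ?Z = "\<integral>h. gauss_kernel I0 h \<partial>lborel"
  have post: "?post j = L.post j" for j
    unfolding L.post_def by (rule posterior_eq[OF mle_xs])
  define \<mu> where "\<mu> j = distr (xi_law a b (?post j)) borel (\<lambda>x. yy j * (x - (a \<bullet> est (xs j) + b)))" for j
  have \<pi>pos: "0 < \<pi>0 \<theta>0" using prior_local[OF \<theta>0_in_U] by simp
  have Zpos: "0 < ?Z" by (rule gauss_kernel_integral_pos[OF information])
  have \<mu>_dist: "real_distribution (\<mu> j)" for j
  proof -
    interpret real_distribution "xi_law a b (?post j)" by (rule real_distribution_xi_law[OF mle_xs])
    show ?thesis unfolding \<mu>_def by (rule real_distribution_distr) simp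
  qed
  \<comment> \<open>Stated for all measurable functions of quadratic growth, so that indicators of
    half-lines and the square are both covered. Distribution functions thus converge at every point,
    without a detour through weak convergence.\<close>
  have lim: "(\<lambda>j. \<integral>\<^sup>+x. ennreal (f x) \<partial>\<mu> j) \<longlonglongrightarrow> (\<integral>\<^sup>+x. ennreal (f x) \<partial>gauss_proj I0 a)"
    if [measurable]: "f \<in> borel_measurable borel" and f: "\<And>x. 0 \<le> f x" "\<And>x. \<bar>f x\<bar> \<le> C * (1 + x\<^sup>2)" for f C
  proof -
    have eq: "yy j * (a \<bullet> \<theta> + b - (a \<bullet> est (xs j) + b)) = a \<bullet> (yy j *\<^sub>R (\<theta> - est (xs j)))" for j \<theta>
      by (simp add: inner_diff_right)
    have "(\<integral>\<^sup>+x. ennreal (f x) \<partial>\<mu> j)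
        = (\<integral>\<^sup>+\<theta>. ennreal (f (yy j * (a \<bullet> \<theta> + b - (a \<bullet> est (xs j) + b)))) \<partial>?post j)" for j
      unfolding \<mu>_def xi_law_def by (simp add: nn_integral_distr)
    then have "(\<integral>\<^sup>+x. ennreal (f x) \<partial>\<mu> j)
        = (\<integral>\<^sup>+\<theta>. ennreal (f (a \<bullet> (yy j *\<^sub>R (\<theta> - est (xs j))))) \<partial>L.post j)" for j
      unfolding eq post .
    moreover have "(\<lambda>j. \<integral>\<^sup>+\<theta>. ennreal (f (a \<bullet> (yy j *\<^sub>R (\<theta> - est (xs j))))) \<partial>L.post j)
        \<longlonglongrightarrow> ennreal ((\<integral>h. f (a \<bullet> h) * (\<pi>0 \<theta>0 * gauss_kernel I0 h) \<partial>lborel) / (\<integral>h. \<pi>0 \<theta>0 * gauss_kernel I0 h \<partial>lborel))"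
      using f growth_inner[OF f(2), of a] \<pi>pos Zpos
      by (intro L.nn_integral_post_tendsto(1)[where \<psi> = "\<lambda>h. f (a \<bullet> h)" and A = "C * (1 + (norm a)\<^sup>2)"]) auto
    moreover have "(\<integral>h. f (a \<bullet> h) * (\<pi>0 \<theta>0 * gauss_kernel I0 h) \<partial>lborel) / (\<integral>h. \<pi>0 \<theta>0 * gauss_kernel I0 h \<partial>lborel)
        = (\<integral>h. f (a \<bullet> h) * gauss_kernel I0 h \<partial>lborel) / ?Z"
      using \<pi>pos by (simp add: mult.left_commute)
    ultimately show ?thesis
      using nn_integral_gauss_proj[OF information that] by simp
  qed
  have "(\<lambda>j. \<integral>\<^sup>+u. ennreal ((quantile (\<mu> j) u - quantile (gauss_proj I0 a) u)\<^sup>2) \<partial>unif01) \<longlonglongrightarrow> 0"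
  proof (rule quantile_L2_tendsto[OF \<mu>_dist real_distribution_gauss_proj[OF information]])
    show "(\<integral>\<^sup>+x. ennreal (x\<^sup>2) \<partial>gauss_proj I0 a) = ennreal (a \<bullet> (matrix_inv I0 *v a))"
      by (rule gauss_proj_second_moment[OF information])
    then show "(\<lambda>j. \<integral>\<^sup>+x. ennreal (x\<^sup>2) \<partial>\<mu> j) \<longlonglongrightarrow> ennreal (a \<bullet> (matrix_inv I0 *v a))"
      using lim[of "\<lambda>x. x\<^sup>2" 1] by simp
    show "0 \<le> a \<bullet> (matrix_inv I0 *v a)" by (rule gauss_proj_variance_nonneg[OF information])
    fix x
    have em: "(\<integral>\<^sup>+x'. ennreal (indicator {..x} x') \<partial>M) = ennreal (measure M {..x})" if "real_distribution M" for M
    proof -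
      interpret real_distribution M by fact
      show ?thesis by (simp add: ennreal_indicator emeasure_eq_measure)
    qed
    have "(\<lambda>j. ennreal (measure (\<mu> j) {..x})) \<longlonglongrightarrow> ennreal (measure (gauss_proj I0 a) {..x})"
      unfolding em[OF \<mu>_dist, symmetric] em[OF real_distribution_gauss_proj[OF information], symmetric]
    proof (rule lim)
      show "\<bar>indicator {..x} x'\<bar> \<le> 1 * (1 + x'\<^sup>2)" for x' :: real
        by (simp split: split_indicator)
    qed auto
    then show "(\<lambda>j. measure (\<mu> j) {..x}) \<longlonglongrightarrow> measure (gauss_proj I0 a) {..x}"
      by (subst (asm) tendsto_ennreal_iff) auto
  qed
  moreover have "(\<integral>\<^sup>+u. ennreal ((quantile (\<mu> j) u - quantile (gauss_proj I0 a) u)\<^sup>2) \<partial>unif01)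
      = quantile_error a b (K j) (xs j)" for j
    unfolding quantile_error_def \<mu>_def
  proof (intro nn_integral_cong)
    fix u assume "u \<in> space unif01"
    then have "0 < u" "u < 1" by (auto simp: space_restrict_space)
    from quantile_affine[OF real_distribution_xi_law[OF mle_xs] yy_pos this]
    show "ennreal ((quantile (distr (xi_law a b (?post j)) borel (\<lambda>x. yy j * (x - (a \<bullet> est (xs j) + b)))) u - quantile (gauss_proj I0 a) u)\<^sup>2)
      = ennreal ((yy j * (quantile (xi_law a b (?post j)) u - (a \<bullet> est (xs j) + b)) - quantile (gauss_proj I0 a) u)\<^sup>2)"
      by (simp only:)
  qed
  ultimately show ?thesis by simp
qed

end

end

text \<open>If every radius \<eta>_j and length threshold n0 + j failed, the counterexamples would
  form a sequence contradicting \<open>quantile_error_tendsto\<close>. The powers K_j are arbitrary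
  in that lemma, which yields the uniformity in \<open>K\<close>.\<close>

lemma quantile_error_uniform:
  assumes \<epsilon>: "0 < \<epsilon>" and e: "0 < e"
  obtains \<eta> N where "0 < \<eta>"
    "\<And>K xs. 1 \<le> K \<Longrightarrow> N \<le> length xs \<Longrightarrow> good \<eta> \<epsilon> M xs \<Longrightarrow> quantile_error a b K xs \<le> ennreal e"
proof -
  obtain c n0 where c: "0 < c" "0 < n0"
    "\<And>xs \<theta> v. set xs \<subseteq> S \<Longrightarrow> n0 \<le> length xs \<Longrightarrow> \<theta> \<in> U \<Longrightarrow>
      v \<bullet> (H xs \<theta> *v v) \<le> - (c * real (length xs) * (norm v)\<^sup>2)"
    using H_coercive by metis
  \<comment> \<open>Stays below \<open>r0\<close>, so that the estimates lie in \<open>U\<close>,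
    and tends to 0.\<close>
  define \<eta> where "\<eta> j = r0 / 2 * inverse (real (Suc j))" for j
  have \<eta>: "0 < \<eta> j" "\<eta> j < r0" for j
  proof -
    show "0 < \<eta> j" using r0 by (simp add: \<eta>_def)
    have "\<eta> j \<le> r0 / 2 * 1" unfolding \<eta>_def using r0 by (intro mult_left_mono) (auto simp: field_simps)
    then show "\<eta> j < r0" using r0 by simp
  qed
  have "\<eta> \<longlonglongrightarrow> r0 / 2 * 0" unfolding \<eta>_def by (intro tendsto_intros LIMSEQ_inverse_real_of_nat)
  then have \<eta>_lim: "\<eta> \<longlonglongrightarrow> 0" by simp
  have "\<exists>j. \<forall>K xs. 1 \<le> K \<longrightarrow> n0 + j \<le> length xs \<longrightarrow> good (\<eta> j) \<epsilon> M xs \<longrightarrow> quantile_error a b K xs \<le> ennreal e"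
  proof (rule ccontr)
    assume "\<not> ?thesis"
    then obtain K xs where bad: "\<And>j. 1 \<le> K j" "\<And>j. n0 + j \<le> length (xs j)" "\<And>j. good (\<eta> j) \<epsilon> M (xs j)"
      "\<And>j. ennreal e < quantile_error a b (K j) (xs j)"
      by (auto simp: not_le) metis
    have "(\<lambda>j. quantile_error a b (K j) (xs j)) \<longlonglongrightarrow> 0"
    proof (rule quantile_error_tendsto[OF c bad(3) _ _ bad(1) _ \<eta>_lim \<epsilon>])
      fix j
      show "n0 \<le> length (xs j)" using bad(2)[of j] by simp
      have "norm (est (xs j) - \<theta>0) < r0" using bad(3)[of j] \<eta>(2)[of j] by (auto simp: good_def)
      then show "est (xs j) \<in> U" by (simp add: dist_norm norm_minus_commute)
    next
      show "filterlim (\<lambda>j. length (xs j)) at_top sequentially"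
        by (rule filterlim_at_top_mono[OF filterlim_ident always_eventually])
           (use bad(2) in \<open>auto intro: le_trans[OF le_add2]\<close>)
    qed
    then have "\<forall>\<^sub>F j in sequentially. quantile_error a b (K j) (xs j) < ennreal e"
      using e by (intro order_tendstoD(2)) auto
    then have "\<exists>j. quantile_error a b (K j) (xs j) < ennreal e"
      by (rule eventually_happens'[OF trivial_limit_sequentially])
    then show False using bad(4) by (auto dest: less_asym)
  qed
  then show thesis using \<eta>(1) that by blast
qed

end

section \<open>Mean and variance of the aggregated law\<close>

text \<open>Both conclusions about the aggregated law are statements about its quantile function
  \<open>r\<close> on \<open>(0, 1)\<close>, compared in \<open>L\<^sup>2\<close> with the quantile function \<open>q\<close> of the limit law.\<close>

lemma (in prob_space) mean_variance_L2_perturbation: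
  fixes q r :: "'a \<Rightarrow> real"
  assumes [measurable]: "q \<in> borel_measurable M" "r \<in> borel_measurable M"
    and q: "integrable M (\<lambda>u. (q u)\<^sup>2)" "(\<integral>u. q u \<partial>M) = 0" "(\<integral>u. (q u)\<^sup>2 \<partial>M) = s"
    and d: "(\<integral>\<^sup>+u. ennreal ((r u - q u)\<^sup>2) \<partial>M) \<le> ennreal d" "0 \<le> d"
    and l: "0 < l"
  shows "integrable M r" "(\<integral>u. r u \<partial>M)\<^sup>2 \<le> d"
    "\<bar>(\<integral>u. (r u - (\<integral>u. r u \<partial>M))\<^sup>2 \<partial>M) - s\<bar> \<le> l * s + d / l + d"
proof -
  define e where "e u = r u - q u" for u
  have [measurable]: "e \<in> borel_measurable M" unfolding e_def[abs_def] by simp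
  have e2: "integrable M (\<lambda>u. (e u)\<^sup>2)"
    using d by (intro integrableI_bounded) (auto simp: e_def less_top[symmetric] top_unique)
  have e2_le: "(\<integral>u. (e u)\<^sup>2 \<partial>M) \<le> d"
    using d e2 by (subst (asm) nn_integral_eq_integral[OF e2[unfolded e_def]]) (auto simp: e_def)
  have int_e: "integrable M e" and int_q: "integrable M q"
    using e2 q(1) by (auto intro!: square_integrable_imp_integrable)
  have r: "r = (\<lambda>u. q u + e u)" by (auto simp: e_def)
  show "integrable M r" unfolding r using int_e int_q by simp
  have mean: "(\<integral>u. r u \<partial>M) = (\<integral>u. e u \<partial>M)" unfolding r using int_e int_q q(2) by simp
  have var_e: "(\<integral>u. (e u - (\<integral>u. e u \<partial>M))\<^sup>2 \<partial>M) = (\<integral>u. (e u)\<^sup>2 \<partial>M) - (\<integral>u. e u \<partial>M)\<^sup>2"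
    by (rule variance_eq[OF int_e e2])
  have var_e_nonneg: "0 \<le> (\<integral>u. (e u - (\<integral>u. e u \<partial>M))\<^sup>2 \<partial>M)"
    by (intro integral_nonneg_AE) auto
  then have "(\<integral>u. e u \<partial>M)\<^sup>2 \<le> (\<integral>u. (e u)\<^sup>2 \<partial>M)" using var_e by simp
  then show "(\<integral>u. r u \<partial>M)\<^sup>2 \<le> d" using e2_le mean by simp
  \<comment> \<open>Young's inequality with a free parameter \<open>l\<close>. The cross term is at
    most l s + d / l, which becomes small once \<open>l\<close> is fixed before
    \<open>d\<close>.\<close>
  have pw: "\<bar>2 * (q u * e u)\<bar> \<le> l * (q u)\<^sup>2 + (e u)\<^sup>2 / l" for u
  proof -
    have "0 \<le> (l * \<bar>q u\<bar> - \<bar>e u\<bar>)\<^sup>2 / l" using l by simp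
    also have "\<dots> = l * (q u)\<^sup>2 + (e u)\<^sup>2 / l - \<bar>2 * (q u * e u)\<bar>"
      using l by (simp add: power2_diff power_mult_distrib abs_mult add_divide_distrib diff_divide_distrib power2_eq_square[of l])
    finally show ?thesis by simp
  qed
  have int_bound: "integrable M (\<lambda>u. l * (q u)\<^sup>2 + (e u)\<^sup>2 / l)" using q(1) e2 by simp
  have int_qe: "integrable M (\<lambda>u. 2 * (q u * e u))"
    by (rule Bochner_Integration.integrable_bound[OF int_bound]) (use pw l in \<open>auto intro: order_trans\<close>)
  have cross: "\<bar>\<integral>u. 2 * (q u * e u) \<partial>M\<bar> \<le> l * s + d / l"
  proof -
    have "\<bar>\<integral>u. 2 * (q u * e u) \<partial>M\<bar> \<le> (\<integral>u. \<bar>2 * (q u * e u)\<bar> \<partial>M)"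
      by (rule integral_abs_bound)
    also have "\<dots> \<le> (\<integral>u. l * (q u)\<^sup>2 + (e u)\<^sup>2 / l \<partial>M)"
      using int_qe int_bound pw by (intro integral_mono) auto
    also have "\<dots> = l * s + (\<integral>u. (e u)\<^sup>2 \<partial>M) / l" using q e2 by simp
    also have "\<dots> \<le> l * s + d / l" using e2_le l by (intro add_left_mono divide_right_mono) auto
    finally show ?thesis .
  qed
  have r2: "(\<lambda>u. (r u)\<^sup>2) = (\<lambda>u. (q u)\<^sup>2 + 2 * (q u * e u) + (e u)\<^sup>2)"
    unfolding r by (auto simp: power2_sum)
  have int_r2: "integrable M (\<lambda>u. (r u)\<^sup>2)" unfolding r2 using q(1) int_qe e2 by simp
  have "(\<integral>u. (r u - (\<integral>u. r u \<partial>M))\<^sup>2 \<partial>M) = (\<integral>u. (r u)\<^sup>2 \<partial>M) - (\<integral>u. r u \<partial>M)\<^sup>2"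
    by (rule variance_eq[OF \<open>integrable M r\<close> int_r2])
  also have "(\<integral>u. (r u)\<^sup>2 \<partial>M) = s + (\<integral>u. 2 * (q u * e u) \<partial>M) + (\<integral>u. (e u)\<^sup>2 \<partial>M)"
    unfolding r2 using q int_qe e2 by simp
  finally have "(\<integral>u. (r u - (\<integral>u. r u \<partial>M))\<^sup>2 \<partial>M) - s
      = (\<integral>u. 2 * (q u * e u) \<partial>M) + (\<integral>u. (e u - (\<integral>u. e u \<partial>M))\<^sup>2 \<partial>M)"
    using var_e mean by simp
  moreover have "(\<integral>u. (e u - (\<integral>u. e u \<partial>M))\<^sup>2 \<partial>M) \<le> d"
    using var_e e2_le zero_le_power2[of "\<integral>u. e u \<partial>M"] by linarith
  ultimately show "\<bar>(\<integral>u. (r u - (\<integral>u. r u \<partial>M))\<^sup>2 \<partial>M) - s\<bar> \<le> l * s + d / l + d"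
    using cross var_e_nonneg by linarith
qed

lemma quantile_gauss_proj_moments:
  fixes A :: "real ^ 'd ^ 'd" and a :: "real ^ 'd"
  assumes A: "positive_definite A"
  defines "q \<equiv> quantile (gauss_proj A a)"
  shows "integrable unif01 (\<lambda>u. (q u)\<^sup>2)" "(\<integral>u. q u \<partial>unif01) = 0"
    "(\<integral>u. (q u)\<^sup>2 \<partial>unif01) = a \<bullet> (matrix_inv A *v a)"
proof -
  note dist = real_distribution_gauss_proj[OF A, of a]
  have [measurable]: "q \<in> borel_measurable unif01" unfolding q_def by (rule measurable_quantile[OF dist])
  have nn: "(\<integral>\<^sup>+u. ennreal ((q u)\<^sup>2) \<partial>unif01) = ennreal (a \<bullet> (matrix_inv A *v a))"
    unfolding q_def using nn_integral_quantile[OF dist, of "\<lambda>x. ennreal (x\<^sup>2)"]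
      gauss_proj_second_moment[OF A] by simp
  then show "integrable unif01 (\<lambda>u. (q u)\<^sup>2)"
    by (intro integrableI_bounded) auto
  show "(\<integral>u. (q u)\<^sup>2 \<partial>unif01) = a \<bullet> (matrix_inv A *v a)"
    using nn gauss_proj_variance_nonneg[OF A, of a] by (intro integral_eq_nn_integral[THEN trans]) auto
  have "(\<integral>u. q u \<partial>unif01) = (\<integral>x. x \<partial>distr unif01 borel q)"
    by (subst integral_distr) auto
  then show "(\<integral>u. q u \<partial>unif01) = 0"
    unfolding q_def distr_quantile[OF dist] by (simp add: gauss_proj_mean[OF A])
qed

section \<open>From block errors to the aggregated law\<close>

context local_model
begin

text \<open>Carries uniform integrability over from the scaled second moment to the quantile error,
  through (v - w)^2 \<le> 2 v^2 + 2 w^2 and the Cauchy-Schwarz inequality for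
  \<open>a\<close>.\<close>

lemma quantile_error_le_second_moment:
  assumes mle: "is_mle xs"
  shows "quantile_error a b K xs \<le> ennreal (2 * (norm a)\<^sup>2) * scaled_second_moment p \<Theta> \<pi>0 est K xs
    + ennreal (2 * (a \<bullet> (matrix_inv I0 *v a)))"
proof -
  let ?y = "sqrt (real (K * length xs))" and ?x = "a \<bullet> est xs + b"
  let ?M = "xi_law a b (posterior p \<Theta> \<pi>0 K xs)" and ?q = "quantile (gauss_proj I0 a)"
  note dist = real_distribution_xi_law[OF mle, of a b K]
  note [measurable] = measurable_quantile[OF dist] measurable_quantile[OF real_distribution_gauss_proj[OF information, of a]]
  have "quantile_error a b K xs \<le> (\<integral>\<^sup>+u. ennreal (2 * (?y * (quantile ?M u - ?x))\<^sup>2) + ennreal (2 * (?q u)\<^sup>2) \<partial>unif01)"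
    unfolding quantile_error_def
  proof (intro nn_integral_mono)
    fix u
    have "(v - w)\<^sup>2 \<le> 2 * v\<^sup>2 + 2 * w\<^sup>2" for v w :: real
      using sum_squares_bound[of v "- w"] by (simp add: power2_diff)
    from ennreal_leI[OF this, of "?y * (quantile ?M u - ?x)" "?q u"]
    show "ennreal ((?y * (quantile ?M u - ?x) - ?q u)\<^sup>2) \<le> ennreal (2 * (?y * (quantile ?M u - ?x))\<^sup>2) + ennreal (2 * (?q u)\<^sup>2)"
      by (subst (asm) ennreal_plus) simp_all
  qed
  also have "\<dots> = (\<integral>\<^sup>+u. ennreal (2 * (?y * (quantile ?M u - ?x))\<^sup>2) \<partial>unif01) + (\<integral>\<^sup>+u. ennreal (2 * (?q u)\<^sup>2) \<partial>unif01)"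
    by (intro nn_integral_add) auto
  also have "(\<integral>\<^sup>+u. ennreal (2 * (?q u)\<^sup>2) \<partial>unif01) = ennreal (2 * (a \<bullet> (matrix_inv I0 *v a)))"
    using nn_integral_quantile[OF real_distribution_gauss_proj[OF information, of a], of "\<lambda>x. ennreal (x\<^sup>2)"]
      gauss_proj_second_moment[OF information, of a] by (simp add: ennreal_mult' nn_integral_cmult)
  also have "(\<integral>\<^sup>+u. ennreal (2 * (?y * (quantile ?M u - ?x))\<^sup>2) \<partial>unif01) = (\<integral>\<^sup>+x. ennreal (2 * (?y * (x - ?x))\<^sup>2) \<partial>?M)"
    by (rule nn_integral_quantile[OF dist]) simp
  also have "\<dots> = (\<integral>\<^sup>+\<theta>. ennreal (2 * (?y * (a \<bullet> \<theta> + b - ?x))\<^sup>2) \<partial>posterior p \<Theta> \<pi>0 K xs)"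
    unfolding xi_law_def by (subst nn_integral_distr) auto
  also have "\<dots> \<le> (\<integral>\<^sup>+\<theta>. ennreal (2 * (norm a)\<^sup>2) * ennreal (real (K * length xs) * (norm (\<theta> - est xs))\<^sup>2) \<partial>posterior p \<Theta> \<pi>0 K xs)"
  proof (intro nn_integral_mono)
    fix \<theta>
    have "\<bar>a \<bullet> (\<theta> - est xs)\<bar> \<le> norm a * norm (\<theta> - est xs)" by (rule Cauchy_Schwarz_ineq2)
    then have "(a \<bullet> (\<theta> - est xs))\<^sup>2 \<le> (norm a * norm (\<theta> - est xs))\<^sup>2"
      by (metis abs_ge_zero power2_abs power_mono)
    then have "2 * (real (K * length xs) * (a \<bullet> (\<theta> - est xs))\<^sup>2)
        \<le> 2 * (real (K * length xs) * (norm a * norm (\<theta> - est xs))\<^sup>2)"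
      by (intro mult_left_mono) auto
    moreover have "2 * (?y * (a \<bullet> \<theta> + b - ?x))\<^sup>2 = 2 * (real (K * length xs) * (a \<bullet> (\<theta> - est xs))\<^sup>2)"
      by (simp add: power_mult_distrib inner_diff_right)
    moreover have "2 * (real (K * length xs) * (norm a * norm (\<theta> - est xs))\<^sup>2)
        = 2 * (norm a)\<^sup>2 * (real (K * length xs) * (norm (\<theta> - est xs))\<^sup>2)"
      by (simp add: power_mult_distrib)
    ultimately have "2 * (?y * (a \<bullet> \<theta> + b - ?x))\<^sup>2 \<le> 2 * (norm a)\<^sup>2 * (real (K * length xs) * (norm (\<theta> - est xs))\<^sup>2)"
      by (simp only:)
    then show "ennreal (2 * (?y * (a \<bullet> \<theta> + b - ?x))\<^sup>2)
        \<le> ennreal (2 * (norm a)\<^sup>2) * ennreal (real (K * length xs) * (norm (\<theta> - est xs))\<^sup>2)"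
      by (subst ennreal_mult'[symmetric]) (auto intro: ennreal_leI)
  qed
  also have "\<dots> = ennreal (2 * (norm a)\<^sup>2) * scaled_second_moment p \<Theta> \<pi>0 est K xs"
    unfolding scaled_second_moment_def by (rule nn_integral_cmult) simp
  finally show ?thesis by (simp add: add_right_mono)
qed

text \<open>Averaging quantile functions also averages their centres, and all blocks share the scale
  sqrt (K n). Recentred at the mean of the estimates and rescaled, the aggregated quantile function
  therefore differs from the limit by exactly the average of the block differences.\<close>

lemma aggregated_law_mean_var:
  fixes xs :: "nat \<Rightarrow> (real ^ 'q) list" and a :: "real ^ 'd" and b :: real
  assumes mle: "\<And>k. k \<in> {1..K} \<Longrightarrow> is_mle (xs k)" and len: "\<And>k. k \<in> {1..K} \<Longrightarrow> length (xs k) = n"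
    and n: "1 \<le> n" and K: "1 \<le> K"
    and err: "(\<Sum>k=1..K. quantile_error a b K (xs k)) \<le> ennreal (real K * d)" and d: "0 \<le> d" and l: "0 < l"
  defines "Q \<equiv> law_with_quantile
       (\<lambda>u. (\<Sum>k=1..K. quantile (xi_law a b (posterior p \<Theta> \<pi>0 K (xs k))) u) / real K)"
    and "s \<equiv> a \<bullet> (matrix_inv I0 *v a)"
  shows "real (K * n) * ((\<integral>\<xi>. \<xi> \<partial>Q) - (\<Sum>k=1..K. a \<bullet> est (xs k) + b) / real K)\<^sup>2 \<le> d"
    and "\<bar>real (K * n) * var Q - s\<bar> \<le> l * s + d / l + d"
proof -
  define q where "q k = quantile (xi_law a b (posterior p \<Theta> \<pi>0 K (xs k)))" for k
  define qq where "qq u = (\<Sum>k=1..K. q k u) / real K" for u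
  define cc where "cc = (\<Sum>k=1..K. a \<bullet> est (xs k) + b) / real K"
  define y where "y = sqrt (real (K * n))"
  let ?g = "quantile (gauss_proj I0 a)"
  have Kpos: "0 < real K" using K by simp
  have y: "0 < y" "y\<^sup>2 = real (K * n)" using K n by (auto simp: y_def)
  have dist: "real_distribution (xi_law a b (posterior p \<Theta> \<pi>0 K (xs k)))" if "k \<in> {1..K}" for k
    by (rule real_distribution_xi_law[OF mle[OF that]])
  have mono: "mono_on {0<..<1} qq"
    unfolding qq_def q_def
  proof (intro mono_onI divide_right_mono sum_mono)
    fix u v :: real and k assume "u \<in> {0<..<1}" "v \<in> {0<..<1}" "u \<le> v" "k \<in> {1..K}"
    then show "quantile (xi_law a b (posterior p \<Theta> \<pi>0 K (xs k))) u \<le> quantile (xi_law a b (posterior p \<Theta> \<pi>0 K (xs k))) v"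
      using mono_onD[OF mono_quantile[OF dist]] by blast
  qed simp
  have lc: "(qq \<longlongrightarrow> qq u) (at_left u)" if "0 < u" "u < 1" for u
    unfolding qq_def q_def using Kpos
    by (intro tendsto_divide tendsto_sum tendsto_const quantile_tendsto_at_left dist that) auto
  have Q: "Q = distr unif01 borel qq"
    unfolding Q_def using law_with_quantile_eq[OF mono lc] by (simp add: qq_def[abs_def] q_def)
  have qq_meas [measurable]: "qq \<in> borel_measurable unif01" by (rule measurable_mono_unif01[OF mono])
  have g_meas [measurable]: "?g \<in> borel_measurable unif01"
    by (rule measurable_quantile[OF real_distribution_gauss_proj[OF information]])
  define r where "r u = y * (qq u - cc)" for u
  have r_meas [measurable]: "r \<in> borel_measurable unif01" unfolding r_def[abs_def] by simp
  \<comment> \<open>Cauchy-Schwarz for a sum of \<open>K\<close> terms, with one factor K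
    cancelled.\<close>
  have pw: "real K * (r u - ?g u)\<^sup>2 \<le> (\<Sum>k=1..K. (y * (q k u - (a \<bullet> est (xs k) + b)) - ?g u)\<^sup>2)" for u
  proof -
    have "real K * (r u - ?g u) = (\<Sum>k=1..K. y * (q k u - (a \<bullet> est (xs k) + b)) - ?g u)"
    proof -
      have "(\<Sum>k=1..K. y * (q k u - x k) - ?g u) = y * ((\<Sum>k=1..K. q k u) - (\<Sum>k=1..K. x k)) - real K * ?g u" for x
        by (simp add: sum_subtractf sum_distrib_left[symmetric] right_diff_distrib)
      moreover have "real K * (y * (v / real K - w / real K) - z) = y * (v - w) - real K * z" for v w z
        using Kpos by (simp add: field_simps)
      ultimately show ?thesis unfolding r_def qq_def cc_def by (simp only:)
    qed
    then have "(real K * (r u - ?g u))\<^sup>2 \<le> real K * (\<Sum>k=1..K. (y * (q k u - (a \<bullet> est (xs k) + b)) - ?g u)\<^sup>2)"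
      using sum_squared_le_sum_of_squares[of "\<lambda>k. y * (q k u - (a \<bullet> est (xs k) + b)) - ?g u" "{1..K}"]
      by (simp add: mult.commute)
    then show ?thesis using Kpos by (simp add: power_mult_distrib power2_eq_square[of "real K"])
  qed
  have "ennreal (real K) * (\<integral>\<^sup>+u. ennreal ((r u - ?g u)\<^sup>2) \<partial>unif01)
      = (\<integral>\<^sup>+u. ennreal (real K * (r u - ?g u)\<^sup>2) \<partial>unif01)"
    by (simp add: nn_integral_cmult ennreal_mult')
  also have "\<dots> \<le> (\<integral>\<^sup>+u. (\<Sum>k=1..K. ennreal ((y * (q k u - (a \<bullet> est (xs k) + b)) - ?g u)\<^sup>2)) \<partial>unif01)"
    using pw by (intro nn_integral_mono) (auto simp: sum_ennreal intro: ennreal_leI)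
  also have "\<dots> = (\<Sum>k=1..K. quantile_error a b K (xs k))"
  proof (subst nn_integral_sum)
    fix k assume "k \<in> {1..K}"
    note [measurable] = measurable_quantile[OF dist[OF this]]
    show "(\<lambda>u. ennreal ((y * (q k u - (a \<bullet> est (xs k) + b)) - ?g u)\<^sup>2)) \<in> borel_measurable unif01"
      unfolding q_def by measurable
  qed (auto simp: quantile_error_def q_def y_def len)
  also have "\<dots> \<le> ennreal (real K) * ennreal d" using err by (simp add: ennreal_mult')
  finally have L2: "(\<integral>\<^sup>+u. ennreal ((r u - ?g u)\<^sup>2) \<partial>unif01) \<le> ennreal d"
    using Kpos by (subst (asm) ennreal_mult_le_mult_iff) auto
  interpret u01: prob_space unif01 by (rule prob_space_unif01)
  note P = u01.mean_variance_L2_perturbation[OF g_meas r_meas quantile_gauss_proj_moments[OF information] L2 d l]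
  have qq: "qq = (\<lambda>u. r u / y + cc)" using y by (auto simp: r_def)
  have mean_qq: "(\<integral>u. qq u \<partial>unif01) = (\<integral>u. r u \<partial>unif01) / y + cc"
    unfolding qq using P(1) u01.prob_space by (simp add: space_restrict_space)
  have mean: "(\<integral>\<xi>. \<xi> \<partial>Q) = (\<integral>u. qq u \<partial>unif01)"
    unfolding Q by (subst integral_distr) auto
  have "real (K * n) * ((\<integral>\<xi>. \<xi> \<partial>Q) - cc)\<^sup>2 = (\<integral>u. r u \<partial>unif01)\<^sup>2"
    unfolding mean mean_qq y(2)[symmetric] using y(1) by (simp add: power_divide)
  then show "real (K * n) * ((\<integral>\<xi>. \<xi> \<partial>Q) - (\<Sum>k=1..K. a \<bullet> est (xs k) + b) / real K)\<^sup>2 \<le> d"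
    using P(2) by (simp add: cc_def)
  have "var Q = (\<integral>u. (qq u - (\<integral>u. qq u \<partial>unif01))\<^sup>2 \<partial>unif01)"
    unfolding var_def mean unfolding Q by (subst integral_distr) auto
  also have "\<dots> = (\<integral>u. (r u - (\<integral>u. r u \<partial>unif01))\<^sup>2 / y\<^sup>2 \<partial>unif01)"
    unfolding mean_qq by (simp add: qq diff_divide_distrib[symmetric] power_divide)
  finally have "y\<^sup>2 * var Q = (\<integral>u. (r u - (\<integral>u. r u \<partial>unif01))\<^sup>2 \<partial>unif01)"
    using y(1) by simp
  then have "real (K * n) * var Q = (\<integral>u. (r u - (\<integral>u. r u \<partial>unif01))\<^sup>2 \<partial>unif01)"
    unfolding y(2) .
  then show "\<bar>real (K * n) * var Q - s\<bar> \<le> l * s + d / l + d"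
    using P(3) by (simp add: s_def)
qed

end

section \<open>Exceptional sets\<close>

lemma length_subseq_obs [simp]: "length (subseq_obs x n k) = n"
  by (simp add: subseq_obs_def obs_def algebra_simps)

lemma subseq_obs_1: "subseq_obs x n 1 = obs x 1 (int n)"
  by (simp add: subseq_obs_def)

lemma subseq_obs_Suc_0: "subseq_obs x n (Suc 0) = obs x 1 (int n)"
  by (simp add: subseq_obs_def)

lemma length_obs_1 [simp]: "length (obs x 1 (int n)) = n"
  by (simp add: obs_def)

lemma nth_obs_1: "i < n \<Longrightarrow> obs x 1 (int n) ! i = x (int i + 1)"
  by (simp add: obs_def add.commute)

text \<open>The form in which stationarity is applied: block \<open>k\<close> of a path is block 1
  of the path shifted by k - 1 block lengths.\<close>

lemma subseq_obs_shift: "subseq_obs x n k = subseq_obs (\<lambda>t. x (t + (int k - 1) * int n)) n 1"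
proof (rule nth_equalityI)
  fix i assume "i < length (subseq_obs x n k)"
  then have i: "i < n" by simp
  then have "subseq_obs x n k ! i = x ((int k - 1) * int n + 1 + int i)"
    unfolding subseq_obs_def obs_def by (subst nth_map) (auto simp: algebra_simps)
  then show "subseq_obs x n k ! i = subseq_obs (\<lambda>t. x (t + (int k - 1) * int n)) n 1 ! i"
    unfolding subseq_obs_1 nth_obs_1[OF i] by (simp add: algebra_simps)
qed simp

text \<open>Brings observations into the coordinate form in which measurability of
  \<open>env\<close>, \<open>est\<close> and the densities is assumed.\<close>

lemma obs_1_eq_map: "obs x 1 (int n) = map (\<lambda>i\<in>{..<n}. x (int i + 1)) [0..<n]"
  by (rule nth_equalityI) (simp_all add: nth_obs_1)

lemma take_obs_1: "t \<le> n \<Longrightarrow> take t (obs x 1 (int n)) = obs x 1 (int t)"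
  by (rule nth_equalityI) (auto simp: obs_def)

locale ts_data = local_model S \<Theta> p \<theta>0 \<delta>0 r0 env \<pi>0 I0 est B
  for S :: "(real ^ 'q) set" and \<Theta> :: "(real ^ 'd) set" and p \<theta>0 \<delta>0 r0 env \<pi>0 I0 est B +
  fixes P :: "(int \<Rightarrow> real ^ 'q) measure" and \<delta> :: real and m0 :: nat
  assumes prob_P: "prob_space P" and sets_P: "sets P = sets (path_space S)"
    and mle: "unique_mle S \<Theta> p P est"
    and stationary: "strictly_stationary P"
    and \<delta>_pos: "0 < \<delta>"
    and env_measurable: "\<And>n. (\<lambda>z. env (map z [0..<n]))
      \<in> borel_measurable (PiM {..<n} (\<lambda>_. values_measure S))"
    and envelope_moment: "limsup (\<lambda>T. \<integral>\<^sup>+x. ennreal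
      ((\<Sum>t=1..T. env (obs x 1 (int t)) powr (4 + 2 * \<delta>)) / real T) \<partial>P) < \<infinity>"
    and hessian_limit: "little_o_prob P
      (\<lambda>T x. norm (- (1 / real T) *\<^sub>R
         hess_within \<Theta> (\<lambda>\<theta>. real_of_ereal (loglik p \<theta> (obs x 1 (int T)))) \<theta>0 - I0)) (\<lambda>_. 1)"
    and identifiability: "\<And>\<eta>. 0 < \<eta> \<Longrightarrow> \<exists>\<epsilon>>0. (\<lambda>n. measure P {x\<in>space P.
      (SUP \<theta>\<in>{\<theta>\<in>\<Theta>. \<eta> \<le> norm (\<theta> - \<theta>0)}.
        (loglik p \<theta> (subseq_obs x n 1) - loglik p \<theta>0 (subseq_obs x n 1)) / ereal (real n))
      \<le> - ereal \<epsilon>}) \<longlonglongrightarrow> 1"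
    and uniform_integrability: "((\<lambda>C::real. SUP (n, k) \<in> {(n, k). n \<ge> m0 \<and> k \<ge> 1}.
      \<integral>\<^sup>+x. scaled_second_moment p \<Theta> \<pi>0 est k (subseq_obs x n 1) *
        indicator {x. ennreal C \<le> scaled_second_moment p \<Theta> \<pi>0 est k (subseq_obs x n 1)} x \<partial>P)
      \<longlongrightarrow> 0) at_top"
begin

section \<open>Path space, shifts and events of small probability\<close>

sublocale prob_space P by (rule prob_P)

abbreviation V :: "(real ^ 'q) measure" where "V \<equiv> values_measure S"

lemma space_V: "space V = S"
  by (simp add: values_measure_def space_restrict_space)

lemma space_P: "x \<in> space P \<Longrightarrow> x t \<in> S"
  using sets_eq_imp_space_eq[OF sets_P] by (auto simp: path_space_def space_PiM space_V)

lemma set_subseq_obs: "x \<in> space P \<Longrightarrow> set (subseq_obs x n k) \<subseteq> S"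
  using space_P by (auto simp: subseq_obs_def obs_def)

lemma coord_measurable: "(\<lambda>x. x t) \<in> P \<rightarrow>\<^sub>M V"
  unfolding measurable_cong_sets[OF sets_P refl] path_space_def by (rule measurable_component_singleton) simp

lemma shift_measurable: "(\<lambda>x t. x (t + j)) \<in> P \<rightarrow>\<^sub>M P"
proof -
  have "(\<lambda>x t. x (t + j)) \<in> P \<rightarrow>\<^sub>M PiM UNIV (\<lambda>_. V)"
    by (rule measurable_PiM_single') (auto simp: coord_measurable space_V space_P)
  then show ?thesis by (simp add: measurable_cong_sets[OF refl sets_P] path_space_def)
qed

lemma distr_shift: "distr P P (\<lambda>x t. x (t + j)) = P"
  using stationary by (simp add: strictly_stationary_def)

abbreviation block :: "nat \<Rightarrow> (int \<Rightarrow> real ^ 'q) \<Rightarrow> nat \<Rightarrow> real ^ 'q" where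
  "block n x \<equiv> (\<lambda>i\<in>{..<n}. x (int i + 1))"

lemma block_measurable: "block n \<in> P \<rightarrow>\<^sub>M PiM {..<n} (\<lambda>_. V)"
  by (intro measurable_restrict coord_measurable)

lemma env_nonneg:
  assumes "set xs \<subseteq> S" "xs \<noteq> []"
  shows "0 \<le> env xs"
proof -
  have "\<theta>0 \<in> B" using \<theta>0_in_U U_subset_B by blast
  moreover have "set (butlast xs) \<subseteq> S" "last xs \<in> S"
    using assms by (auto dest: in_set_butlastD)
  ultimately have "0 \<le> env (butlast xs @ [last xs])"
    using order_trans[OF abs_ge_zero envelope[of "butlast xs" "last xs" \<theta>0]] by blast
  then show ?thesis using assms by simp
qed

lemma env_sum_obs: "env_sum (obs x 1 (int n)) = (\<Sum>t=1..n. env (obs x 1 (int t)))"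
proof -
  have "env_sum (obs x 1 (int n)) = (\<Sum>t<n. env (obs x 1 (int (Suc t))))"
    unfolding env_sum_def by (intro sum.cong) (auto simp: obs_def take_obs_1[unfolded obs_def] simp del: of_nat_Suc)
  also have "\<dots> = (\<Sum>t=1..n. env (obs x 1 (int t)))"
    by (rule sum.reindex_bij_witness[of _ "\<lambda>t. t - 1" Suc]) auto
  finally show ?thesis .
qed

lemma env_obs_measurable [measurable]: "(\<lambda>x. env (obs x 1 (int n))) \<in> borel_measurable P"
  unfolding obs_1_eq_map by (rule measurable_compose[OF block_measurable env_measurable])

lemma env_sum_bounded_in_prob:
  assumes \<tau>: "0 < \<tau>"
  obtains M where "\<forall>\<^sub>F n in sequentially.
    emeasure P {x\<in>space P. M * real n < env_sum (obs x 1 (int n))} \<le> ennreal \<tau>"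
proof -
  define F where "F n x = (\<Sum>t=1..n. env (obs x 1 (int t)) powr (4 + 2 * \<delta>)) / real n" for n x
  have F_meas [measurable]: "F n \<in> borel_measurable P" for n
    unfolding F_def by measurable
  obtain L' where L': "limsup (\<lambda>n. \<integral>\<^sup>+x. ennreal (F n x) \<partial>P) < L'" "L' < \<infinity>"
    using envelope_moment dense unfolding F_def by blast
  define L where "L = enn2real L'"
  have L: "L' = ennreal L" "0 \<le> L" using L'(2) by (auto simp: L_def)
  have ev: "\<forall>\<^sub>F n in sequentially. (\<integral>\<^sup>+x. ennreal (F n x) \<partial>P) < ennreal L"
    using Limsup_lessD[OF L'(1)] by (simp add: L)
  \<comment> \<open>The summand 1 comes from u \<le> 1 + u^(4 + 2 \<delta>); the rest makes Markov's
    bound L / (M - 1) at most \<open>\<tau>\<close>, with L + 1 keeping M - 1 positive when L =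
    0.\<close>
  define M where "M = 1 + (L + 1) / \<tau>"
  have M: "0 < M - 1" using L \<tau> by (simp add: M_def)
  have "\<forall>\<^sub>F n in sequentially. emeasure P {x\<in>space P. M * real n < env_sum (obs x 1 (int n))} \<le> ennreal \<tau>"
    using ev eventually_gt_at_top[of 0]
  proof eventually_elim
    case (elim n)
    have sub: "{x\<in>space P. M * real n < env_sum (obs x 1 (int n))}
        \<subseteq> {x\<in>space P. 1 \<le> ennreal (1 / (M - 1)) * ennreal (F n x)}"
    proof safe
      fix x assume x: "x \<in> space P" "M * real n < env_sum (obs x 1 (int n))"
      have "env (obs x 1 (int t)) \<le> 1 + env (obs x 1 (int t)) powr (4 + 2 * \<delta>)" if "t \<in> {1..n}" for t
      proof -
        have "set (obs x 1 (int t)) \<subseteq> S" "obs x 1 (int t) \<noteq> []"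
          using that space_P[OF x(1)] by (auto simp: obs_def)
        then have e0: "0 \<le> env (obs x 1 (int t))" by (rule env_nonneg)
        show ?thesis
        proof (cases "env (obs x 1 (int t)) \<le> 1")
          case False
          then have "env (obs x 1 (int t)) powr 1 \<le> env (obs x 1 (int t)) powr (4 + 2 * \<delta>)"
            using \<delta>_pos by (intro powr_mono) auto
          then show ?thesis using e0 by simp
        qed (simp add: add_increasing2)
      qed
      then have "env_sum (obs x 1 (int n)) \<le> (\<Sum>t=1..n. 1 + env (obs x 1 (int t)) powr (4 + 2 * \<delta>))"
        unfolding env_sum_obs by (rule sum_mono)
      also have "\<dots> = real n * (1 + F n x)"
        using elim(2) by (simp add: F_def sum.distrib field_simps)
      finally have "real n * M < real n * (1 + F n x)" using x(2) by (simp add: mult.commute)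
      then have "M - 1 < F n x" using elim(2) by simp
      then have "1 \<le> 1 / (M - 1) * F n x" using M by (simp add: field_simps)
      then show "1 \<le> ennreal (1 / (M - 1)) * ennreal (F n x)"
        using M by (simp add: ennreal_mult'[symmetric] flip: ennreal_1 del: ennreal_1)
    qed
    have "emeasure P {x\<in>space P. M * real n < env_sum (obs x 1 (int n))}
        \<le> emeasure P {x\<in>space P. 1 \<le> ennreal (1 / (M - 1)) * ennreal (F n x)}"
      by (intro emeasure_mono sub) measurable
    also have "\<dots> \<le> ennreal (1 / (M - 1)) * (\<integral>\<^sup>+x. ennreal (F n x) * indicator (space P) x \<partial>P)"
      by (rule nn_integral_Markov_inequality) auto
    also have "(\<integral>\<^sup>+x. ennreal (F n x) * indicator (space P) x \<partial>P) = (\<integral>\<^sup>+x. ennreal (F n x) \<partial>P)"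
      by (intro nn_integral_cong) simp
    also have "ennreal (1 / (M - 1)) * \<dots> \<le> ennreal (1 / (M - 1)) * ennreal L"
      using elim(1) by (intro mult_left_mono) auto
    also have "\<dots> = ennreal (L / (M - 1))" using M L by (simp add: ennreal_mult'[symmetric])
    also have "\<dots> \<le> ennreal \<tau>"
      using L \<tau> by (intro ennreal_leI) (simp add: M_def field_simps)
    finally show ?case .
  qed
  then show thesis by (rule that)
qed

lemma AE_is_mle: "\<forall>\<^sub>F n in sequentially. AE x in P. is_mle (subseq_obs x n 1)"
proof -
  have "\<forall>\<^sub>F n in sequentially. \<forall>k\<ge>1. AE x in P. \<forall>\<theta>.
        is_arg_max (\<lambda>\<theta>. loglik p \<theta> (subseq_obs x n k)) (\<lambda>\<theta>. \<theta> \<in> \<Theta>) \<theta>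
          \<longleftrightarrow> \<theta> = est (subseq_obs x n k)"
    using mle by (simp add: unique_mle_def)
  then show ?thesis
  proof eventually_elim
    case (elim n)
    then have "AE x in P. \<forall>\<theta>. is_arg_max (\<lambda>\<theta>. loglik p \<theta> (subseq_obs x n 1)) (\<lambda>\<theta>. \<theta> \<in> \<Theta>) \<theta>
        \<longleftrightarrow> \<theta> = est (subseq_obs x n 1)" by simp
    then show ?case using AE_space
    proof eventually_elim
      case (elim x)
      then have "is_arg_max (\<lambda>\<theta>. loglik p \<theta> (subseq_obs x n 1)) (\<lambda>\<theta>. \<theta> \<in> \<Theta>) (est (subseq_obs x n 1))" by simp
      then show ?case using set_subseq_obs[OF elim(2)] by (auto simp: is_mle_def is_arg_max_def not_less)
    qed
  qed
qed

lemma identifiability_set: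
  assumes \<eta>: "0 < \<eta>"
  obtains \<epsilon> A where "0 < \<epsilon>" "\<And>n. A n \<in> sets P" "(\<lambda>n. emeasure P (A n)) \<longlonglongrightarrow> 0"
    "\<And>n x \<theta>. 0 < n \<Longrightarrow> x \<in> space P - A n \<Longrightarrow> \<theta> \<in> \<Theta> \<Longrightarrow> \<eta> \<le> norm (\<theta> - \<theta>0) \<Longrightarrow>
      loglik p \<theta> (subseq_obs x n 1) \<le> ereal (LL (subseq_obs x n 1) \<theta>0 - real n * \<epsilon>)"
proof -
  define G where "G \<epsilon> n = {x\<in>space P.
      (SUP \<theta>\<in>{\<theta>\<in>\<Theta>. \<eta> \<le> norm (\<theta> - \<theta>0)}.
        (loglik p \<theta> (subseq_obs x n 1) - loglik p \<theta>0 (subseq_obs x n 1)) / ereal (real n))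
      \<le> - ereal \<epsilon>}" for \<epsilon> n
  obtain \<epsilon> where \<epsilon>: "0 < \<epsilon>" "(\<lambda>n. measure P (G \<epsilon> n)) \<longlonglongrightarrow> 1"
    using identifiability[OF \<eta>] unfolding G_def by blast
  \<comment> \<open>\<open>measure\<close> is 0 on non-measurable sets, so taking the whole space in
    that case preserves the identity that A n has probability 1 -
    \<open>measure P (G \<epsilon> n)\<close>, and the limit 1 transfers.\<close>
  define A where "A n = (if G \<epsilon> n \<in> sets P then space P - G \<epsilon> n else space P)" for n
  show thesis
  proof (rule that[OF \<epsilon>(1)])
    show "A n \<in> sets P" for n by (auto simp: A_def)
    have "emeasure P (A n) = ennreal (1 - measure P (G \<epsilon> n))" for n
      by (auto simp: A_def emeasure_eq_measure prob_compl prob_space measure_notin_sets)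
    moreover have "(\<lambda>n. ennreal (1 - measure P (G \<epsilon> n))) \<longlonglongrightarrow> ennreal (1 - 1)"
      by (intro tendsto_ennrealI tendsto_intros \<epsilon>)
    ultimately show "(\<lambda>n. emeasure P (A n)) \<longlonglongrightarrow> 0" by simp
    fix n x \<theta> assume n: "0 < n" and x: "x \<in> space P - A n" and \<theta>: "\<theta> \<in> \<Theta>" "\<eta> \<le> norm (\<theta> - \<theta>0)"
    have x': "x \<in> space P" "x \<in> G \<epsilon> n" using x by (auto simp: A_def split: if_splits)
    have "\<theta>0 \<in> B" using \<theta>0_in_U U_subset_B by blast
    then have LL0: "loglik p \<theta>0 (subseq_obs x n 1) = ereal (LL (subseq_obs x n 1) \<theta>0)"
      by (intro loglik_local set_subseq_obs x')
    have le: "(loglik p \<theta> (subseq_obs x n 1) - ereal (LL (subseq_obs x n 1) \<theta>0)) / ereal (real n) \<le> - ereal \<epsilon>"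
    proof -
      have sup: "(SUP \<theta>\<in>{\<theta>\<in>\<Theta>. \<eta> \<le> norm (\<theta> - \<theta>0)}.
          (loglik p \<theta> (subseq_obs x n 1) - loglik p \<theta>0 (subseq_obs x n 1)) / ereal (real n)) \<le> - ereal \<epsilon>"
        using x'(2) unfolding G_def mem_Collect_eq by (rule conjunct2)
      have "\<theta> \<in> {\<theta>\<in>\<Theta>. \<eta> \<le> norm (\<theta> - \<theta>0)}" using \<theta> by simp
      from order_trans[OF SUP_upper[OF this] sup] show ?thesis unfolding LL0 .
    qed
    have "0 < real n" using n by simp
    from ereal_divide_le_minus[OF this le]
    show "loglik p \<theta> (subseq_obs x n 1) \<le> ereal (LL (subseq_obs x n 1) \<theta>0 - real n * \<epsilon>)" .
  qed
qed

text \<open>The hypothesis bounds an outer measure; a measurable hull of the bad event carries the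
  same mass.\<close>

lemma hessian_set:
  assumes \<eta>: "0 < \<eta>"
  obtains A where "\<And>n. A n \<in> sets P" "(\<lambda>n. emeasure P (A n)) \<longlonglongrightarrow> 0"
    "\<And>n x. x \<in> space P - A n \<Longrightarrow> norm (- (1 / real n) *\<^sub>R H (subseq_obs x n 1) \<theta>0 - I0) \<le> \<eta>"
proof -
  define D where "D n = {x\<in>space P. \<eta> < \<bar>norm (- (1 / real n) *\<^sub>R
         hess_within \<Theta> (\<lambda>\<theta>. real_of_ereal (loglik p \<theta> (obs x 1 (int n)))) \<theta>0 - I0) / 1\<bar>}" for n
  have D: "(\<lambda>n. outer_measure_of P (D n)) \<longlonglongrightarrow> 0"
    using hessian_limit \<eta> unfolding little_o_prob_def D_def by blast
  have "\<exists>E\<in>sets P. D n \<subseteq> E \<and> outer_measure_of P (D n) = emeasure P E" for n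
    by (rule outer_measure_of_attain) (auto simp: D_def)
  then obtain A where A: "\<And>n. A n \<in> sets P" "\<And>n. D n \<subseteq> A n" "\<And>n. outer_measure_of P (D n) = emeasure P (A n)"
    by metis
  show thesis
  proof (rule that[OF A(1)])
    show "(\<lambda>n. emeasure P (A n)) \<longlonglongrightarrow> 0" using D by (simp add: A(3))
    fix n x assume x: "x \<in> space P - A n"
    then have "x \<notin> D n" using A(2) by blast
    then show "norm (- (1 / real n) *\<^sub>R H (subseq_obs x n 1) \<theta>0 - I0) \<le> \<eta>"
      using x hess_within_local[OF set_subseq_obs[of x n 1] \<theta>0_in_U r0(3)]
      by (simp add: D_def subseq_obs_Suc_0)
  qed
qed

text \<open>Identifiability is applied twice: at radius \<open>r0\<close> for the tail gap, and at
  radius \<open>\<eta>\<close> for consistency of the estimate. The order is forced, since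
  \<open>\<eta>\<close> depends on the gap and on \<open>M\<close>. The exceptional set is the same
  for all \<open>K\<close> because \<open>good\<close> is independent of \<open>K\<close>.\<close>

lemma quantile_error_small_outside:
  assumes e: "0 < e" and \<tau>: "0 < \<tau>"
  shows "\<forall>\<^sub>F n in sequentially. \<exists>A\<in>sets P. emeasure P A \<le> ennreal \<tau> \<and>
    (\<forall>x\<in>space P - A. \<forall>K\<ge>1. quantile_error a b K (subseq_obs x n 1) \<le> ennreal e)"
proof -
  \<comment> \<open>Four sets share the probability: tail gap, consistency, Hessian and envelope.
    The fifth, for the existence of the estimate, is null.\<close>
  define t where "t = \<tau> / 4"
  have t: "0 < t" using \<tau> by (simp add: t_def)
  obtain \<epsilon> A1 where A1: "0 < \<epsilon>" "\<And>n. A1 n \<in> sets P" "(\<lambda>n. emeasure P (A1 n)) \<longlonglongrightarrow> 0"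
    "\<And>n x \<theta>. 0 < n \<Longrightarrow> x \<in> space P - A1 n \<Longrightarrow> \<theta> \<in> \<Theta> \<Longrightarrow> r0 \<le> norm (\<theta> - \<theta>0) \<Longrightarrow>
      loglik p \<theta> (subseq_obs x n 1) \<le> ereal (LL (subseq_obs x n 1) \<theta>0 - real n * \<epsilon>)"
    using identifiability_set[OF r0(1)] by metis
  obtain M where M: "\<forall>\<^sub>F n in sequentially. emeasure P {x\<in>space P. M * real n < env_sum (obs x 1 (int n))} \<le> ennreal t"
    using env_sum_bounded_in_prob[OF t] by blast
  obtain \<eta> N where \<eta>: "0 < \<eta>"
    "\<And>K xs. 1 \<le> K \<Longrightarrow> N \<le> length xs \<Longrightarrow> good \<eta> \<epsilon> M xs \<Longrightarrow> quantile_error a b K xs \<le> ennreal e"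
    using quantile_error_uniform[OF A1(1) e] by metis
  obtain \<epsilon>2 A2 where A2: "0 < \<epsilon>2" "\<And>n. A2 n \<in> sets P" "(\<lambda>n. emeasure P (A2 n)) \<longlonglongrightarrow> 0"
    "\<And>n x \<theta>. 0 < n \<Longrightarrow> x \<in> space P - A2 n \<Longrightarrow> \<theta> \<in> \<Theta> \<Longrightarrow> \<eta> \<le> norm (\<theta> - \<theta>0) \<Longrightarrow>
      loglik p \<theta> (subseq_obs x n 1) \<le> ereal (LL (subseq_obs x n 1) \<theta>0 - real n * \<epsilon>2)"
    using identifiability_set[OF \<eta>(1)] by metis
  obtain A3 where A3: "\<And>n. A3 n \<in> sets P" "(\<lambda>n. emeasure P (A3 n)) \<longlonglongrightarrow> 0"
    "\<And>n x. x \<in> space P - A3 n \<Longrightarrow> norm (- (1 / real n) *\<^sub>R H (subseq_obs x n 1) \<theta>0 - I0) \<le> \<eta>"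
    using hessian_set[OF \<eta>(1)] by metis
  have small: "\<forall>\<^sub>F n in sequentially. emeasure P (A n) < ennreal t" if "(\<lambda>n. emeasure P (A n)) \<longlonglongrightarrow> 0" for A
    using that t by (intro order_tendstoD(2)) auto
  show ?thesis
    using M small[OF A1(3)] small[OF A2(3)] small[OF A3(2)] AE_is_mle eventually_gt_at_top[of 0] eventually_ge_at_top[of N]
  proof eventually_elim
    case (elim n)
    obtain A0 where A0: "A0 \<in> null_sets P" "{x\<in>space P. \<not> is_mle (subseq_obs x n 1)} \<subseteq> A0"
      using elim(5) by (auto elim!: AE_E3)
    define A4 where "A4 = {x\<in>space P. M * real n < env_sum (obs x 1 (int n))}"
    have A4: "A4 \<in> sets P" unfolding A4_def env_sum_obs by measurable
    let ?A = "A0 \<union> (A1 n \<union> (A2 n \<union> (A3 n \<union> A4)))"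
    have A0s: "A0 \<in> sets P" using A0(1) by (auto simp: null_sets_def)
    show ?case
    proof (intro bexI[of _ ?A] conjI ballI allI impI)
      show "?A \<in> sets P" using A0s A1(2) A2(2) A3(1) A4 by auto
      have "emeasure P ?A \<le> emeasure P A0 + (emeasure P (A1 n) + (emeasure P (A2 n) + (emeasure P (A3 n) + emeasure P A4)))"
        using A0s A1(2) A2(2) A3(1) A4
        by (intro order_trans[OF emeasure_subadditive] add_left_mono) auto
      also have "\<dots> \<le> 0 + (ennreal t + (ennreal t + (ennreal t + ennreal t)))"
        using A0(1) elim(1-4) by (intro add_mono) (auto simp: A4_def null_sets_def)
      also have "\<dots> = ennreal \<tau>" using t by (simp add: t_def ennreal_plus[symmetric] del: ennreal_plus)
      finally show "emeasure P ?A \<le> ennreal \<tau>" .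
    next
      fix x K assume x: "x \<in> space P - ?A" and K: "1 \<le> (K :: nat)"
      let ?xs = "subseq_obs x n 1"
      have mle_x: "is_mle ?xs" using x A0(2) by blast
      have \<theta>0: "\<theta>0 \<in> B" "\<theta>0 \<in> \<Theta>" using \<theta>0_in_U U_subset_B B_subset by blast+
      \<comment> \<open>An estimate farther away would have a log-likelihood below that of
        \<open>\<theta>0\<close> by n times the gap, against its maximality.\<close>
      have "norm (est ?xs - \<theta>0) \<le> \<eta>"
      proof (rule ccontr)
        assume "\<not> ?thesis"
        then have "loglik p (est ?xs) ?xs \<le> ereal (LL ?xs \<theta>0 - real n * \<epsilon>2)"
          using x mle_x elim(6) by (intro A2(4)) (auto simp: is_mle_def)
        moreover have "ereal (LL ?xs \<theta>0) \<le> loglik p (est ?xs) ?xs"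
          using mle_x \<theta>0 loglik_local[OF _ \<theta>0(1), of ?xs] unfolding is_mle_def by metis
        ultimately have "ereal (LL ?xs \<theta>0) \<le> ereal (LL ?xs \<theta>0 - real n * \<epsilon>2)" by (rule order_trans[rotated])
        then show False using A2(1) elim(6) by (simp add: mult_le_0_iff)
      qed
      moreover have "env_sum ?xs \<le> M * real (length ?xs)"
        using x by (auto simp: A4_def subseq_obs_Suc_0)
      ultimately have "good \<eta> \<epsilon> M ?xs"
        unfolding good_def using mle_x A1(4)[OF elim(6), of x] A3(3)[of x n] x by auto
      then show "quantile_error a b K ?xs \<le> ennreal e"
        using elim(7) K by (intro \<eta>(2)) auto
    qed
  qed
qed

end

section \<open>Averaging over the blocks\<close>

text \<open>With outer measure in the definition, it suffices to cover the bad event by a small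
  measurable set; the posterior functionals themselves need no measurability in the data.\<close>

lemma little_o_probI:
  assumes "\<And>\<epsilon> \<tau>. 0 < \<epsilon> \<Longrightarrow> 0 < \<tau> \<Longrightarrow> \<forall>\<^sub>F n in sequentially.
    \<exists>A\<in>sets P. emeasure P A \<le> ennreal \<tau> \<and> (\<forall>x\<in>space P - A. \<bar>Z n x / c n\<bar> \<le> \<epsilon>)"
  shows "little_o_prob P Z c"
  unfolding little_o_prob_def
proof (intro allI impI order_tendstoI)
  fix \<epsilon> :: real and u :: ennreal assume \<epsilon>: "0 < \<epsilon>" and u: "0 < u"
  obtain u' where u': "0 < u'" "u' < u" using dense[OF u] by blast
  then obtain \<tau> where \<tau>: "u' = ennreal \<tau>" "0 < \<tau>" by (cases u') auto
  show "\<forall>\<^sub>F n in sequentially. outer_measure_of P {x\<in>space P. \<epsilon> < \<bar>Z n x / c n\<bar>} < u"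
    using assms[OF \<epsilon> \<tau>(2)]
  proof eventually_elim
    case (elim n)
    then obtain A where A: "A \<in> sets P" "emeasure P A \<le> ennreal \<tau>" "\<And>x. x \<in> space P - A \<Longrightarrow> \<bar>Z n x / c n\<bar> \<le> \<epsilon>"
      by blast
    have "{x\<in>space P. \<epsilon> < \<bar>Z n x / c n\<bar>} \<subseteq> A" using A(3) by (fastforce simp: not_less[symmetric])
    then have "outer_measure_of P {x\<in>space P. \<epsilon> < \<bar>Z n x / c n\<bar>} \<le> outer_measure_of P A"
      by (rule outer_measure_of_mono)
    also have "\<dots> \<le> u'" using A \<tau> by simp
    finally show ?case using u' by simp
  qed
qed simp

lemma powr_neg_half:
  assumes "0 < t"
  shows "t powr (- 1 / 2) = 1 / sqrt (t :: real)"
proof -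
  have "t powr (- 1 / 2) = t powr (- (1 / 2))" by simp
  also have "\<dots> = inverse (t powr (1 / 2))" by (rule powr_minus)
  also have "\<dots> = 1 / sqrt t" using powr_half_sqrt[of t] assms by (simp add: inverse_eq_divide)
  finally show ?thesis .
qed

lemma law_with_quantile_quantile:
  assumes "real_distribution M"
  shows "law_with_quantile (quantile M) = M"
  using law_with_quantile_eq[OF mono_quantile[OF assms] quantile_tendsto_at_left[OF assms]] distr_quantile[OF assms]
  by simp

lemma mean_mle_inner:
  assumes "1 \<le> K"
  shows "(\<Sum>k=1..K. a \<bullet> est (subseq_obs x n k) + b) / real K = a \<bullet> mean_mle est K n x + b"
  using assms by (simp add: mean_mle_def sum.distrib inner_sum_right add_divide_distrib)

section \<open>Measurability in the data and domination in mean\<close>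

context ts_data
begin

lemma lik_joint_measurable:
  "(\<lambda>(z, \<theta>). lik p \<theta> (map z [0..<n])) \<in> borel_measurable (PiM {..<n} (\<lambda>_. V) \<Otimes>\<^sub>M restrict_space borel \<Theta>)"
proof -
  have *: "(\<lambda>(z, \<theta>). p \<theta> (map z [0..<t]) (z t)) \<in> borel_measurable (PiM {..<n} (\<lambda>_. V) \<Otimes>\<^sub>M restrict_space borel \<Theta>)"
    if t: "t < n" for t
  proof -
    \<comment> \<open>\<open>density_model\<close> takes the parameter first and only the
      coordinates up to \<open>t\<close>, hence the swap and the restriction.\<close>
    let ?f = "\<lambda>(z, \<theta>). (\<theta>, restrict z {..t})"
    have "(\<lambda>w. restrict (fst w) {..t}) \<in> PiM {..<n} (\<lambda>_. V) \<Otimes>\<^sub>M restrict_space borel \<Theta> \<rightarrow>\<^sub>M PiM {..t} (\<lambda>_. V)"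
      using t by (intro measurable_compose[OF measurable_fst] measurable_restrict_subset) auto
    then have f: "?f \<in> PiM {..<n} (\<lambda>_. V) \<Otimes>\<^sub>M restrict_space borel \<Theta> \<rightarrow>\<^sub>M restrict_space borel \<Theta> \<Otimes>\<^sub>M PiM {..t} (\<lambda>_. V)"
      unfolding case_prod_beta by (intro measurable_Pair measurable_snd)
    have g: "(\<lambda>(\<theta>, z). p \<theta> (map z [0..<t]) (z t)) \<in> borel_measurable (restrict_space borel \<Theta> \<Otimes>\<^sub>M PiM {..t} (\<lambda>_. V))"
      using model by (simp add: density_model_def)
    have 1: "map (restrict z {..t}) [0..<t] = map z [0..<t]" for z :: "nat \<Rightarrow> real ^ 'q" by simp
    have 2: "restrict z {..t} t = z t" for z :: "nat \<Rightarrow> real ^ 'q" by simp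
    have "(\<lambda>w. (\<lambda>(\<theta>, z). p \<theta> (map z [0..<t]) (z t)) (?f w)) = (\<lambda>(z, \<theta>). p \<theta> (map z [0..<t]) (z t))"
      by (rule ext) (simp only: case_prod_beta fst_conv snd_conv 1 2)
    with measurable_compose[OF f g] show ?thesis by (simp only:)
  qed
  have "(\<lambda>(z, \<theta>). lik p \<theta> (map z [0..<n])) = (\<lambda>w. \<Prod>t<n. (\<lambda>(z, \<theta>). p \<theta> (map z [0..<t]) (z t)) w)"
    by (auto simp: lik_def take_map intro!: prod.cong)
  then show ?thesis by (simp only:) (intro borel_measurable_prod *, simp)
qed

text \<open>The scaled second moment is a quotient of parameter integrals of jointly measurable
  functions, so Tonelli's theorem applies. The majorant in \<open>quantile_error_dominated\<close>
  is built from it and must be integrable against \<open>P\<close>.\<close>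

lemma second_moment_measurable:
  "(\<lambda>x. scaled_second_moment p \<Theta> \<pi>0 est K (subseq_obs x n 1)) \<in> borel_measurable P"
proof -
  let ?N = "PiM {..<n} (\<lambda>_. V)" and ?R = "restrict_space lborel \<Theta>"
  let ?xs = "\<lambda>z :: nat \<Rightarrow> real ^ 'q. map z [0..<n]"
  define g where "g z \<theta> = ennreal (real (K * n) * (norm (\<theta> - est (?xs z)))\<^sup>2)" for z \<theta>
  define w where "w z \<theta> = ennreal (lik p \<theta> (?xs z) ^ K * \<pi>0 \<theta>)" for z \<theta>
  have R: "sets ?R = sets (restrict_space borel \<Theta>)" by (simp add: sets_restrict_space)
  have NR: "sets (?N \<Otimes>\<^sub>M ?R) = sets (?N \<Otimes>\<^sub>M restrict_space borel \<Theta>)" by (intro sets_pair_measure_cong R) simp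
  have lik_meas: "(\<lambda>(z, \<theta>). lik p \<theta> (?xs z)) \<in> borel_measurable (?N \<Otimes>\<^sub>M ?R)"
    using lik_joint_measurable by (simp add: measurable_cong_sets[OF NR refl])
  have \<pi>_meas: "(\<lambda>w. \<pi>0 (snd w)) \<in> borel_measurable (?N \<Otimes>\<^sub>M ?R)"
    using measurable_compose[OF measurable_snd prior_measurable, of ?N] by (simp add: measurable_cong_sets[OF NR refl])
  have w_meas: "(\<lambda>(z, \<theta>). w z \<theta>) \<in> borel_measurable (?N \<Otimes>\<^sub>M ?R)"
    using lik_meas \<pi>_meas unfolding w_def case_prod_beta
    by (intro measurable_compose[OF _ measurable_ennreal] borel_measurable_times borel_measurable_power)
  have est_meas: "(\<lambda>z. est (?xs z)) \<in> borel_measurable ?N"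
    using mle by (simp add: unique_mle_def)
  have id_meas: "(\<lambda>\<theta>. \<theta>) \<in> ?R \<rightarrow>\<^sub>M borel" by (intro measurable_restrict_space1) simp
  have "(\<lambda>w. snd w - est (?xs (fst w))) \<in> borel_measurable (?N \<Otimes>\<^sub>M ?R)"
    by (intro borel_measurable_diff measurable_compose[OF measurable_snd id_meas] measurable_compose[OF measurable_fst est_meas])
  moreover have "(\<lambda>v :: real ^ 'd. ennreal (real (K * n) * (norm v)\<^sup>2)) \<in> borel_measurable borel"
    by measurable
  ultimately have g_meas: "(\<lambda>(z, \<theta>). g z \<theta>) \<in> borel_measurable (?N \<Otimes>\<^sub>M ?R)"
    unfolding g_def case_prod_beta by (rule measurable_compose)
  interpret R: sigma_finite_measure ?R
    by (rule sigma_finite_measure_restrict_space[OF sigma_finite_lborel]) simp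
  have Z_meas: "(\<lambda>z. \<integral>\<^sup>+\<theta>. w z \<theta> \<partial>?R) \<in> borel_measurable ?N"
    by (rule R.borel_measurable_nn_integral[OF w_meas])
  have G_meas: "(\<lambda>z. \<integral>\<^sup>+\<theta>. w z \<theta> * g z \<theta> \<partial>?R) \<in> borel_measurable ?N"
    using w_meas g_meas by (intro R.borel_measurable_nn_integral) (simp add: case_prod_beta)
  have eq: "scaled_second_moment p \<Theta> \<pi>0 est K (?xs z) = (\<integral>\<^sup>+\<theta>. w z \<theta> * g z \<theta> \<partial>?R) / (\<integral>\<^sup>+\<theta>. w z \<theta> \<partial>?R)"
    if z: "z \<in> space ?N" for z
  proof -
    have "\<forall>i<n. z i \<in> S" using z by (simp add: space_PiM space_V PiE_iff)
    then have "set (?xs z) \<subseteq> S" by auto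
    then have "(\<lambda>\<theta>. if \<theta> \<in> \<Theta> then lik p \<theta> (?xs z) ^ K * \<pi>0 \<theta> else 0) \<in> borel_measurable borel"
      by (intro borel_measurable_extend_0 borel_measurable_times borel_measurable_power lik_measurable prior_measurable)
    then have "(\<lambda>\<theta>. ennreal (if \<theta> \<in> \<Theta> then lik p \<theta> (?xs z) ^ K * \<pi>0 \<theta> else 0)) \<in> borel_measurable borel"
      by (rule measurable_compose[OF _ measurable_ennreal])
    also have "(\<lambda>\<theta>. ennreal (if \<theta> \<in> \<Theta> then lik p \<theta> (?xs z) ^ K * \<pi>0 \<theta> else 0)) = posterior_weight p \<Theta> \<pi>0 K (?xs z)"
      by (auto simp: posterior_weight_def)
    finally have pw [measurable]: "posterior_weight p \<Theta> \<pi>0 K (?xs z) \<in> borel_measurable borel" .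
    have int_R: "(\<integral>\<^sup>+\<theta>. posterior_weight p \<Theta> \<pi>0 K (?xs z) \<theta> * f \<theta> \<partial>lborel) = (\<integral>\<^sup>+\<theta>. w z \<theta> * f \<theta> \<partial>?R)" for f
      by (subst nn_integral_restrict_space) (auto simp: posterior_weight_def w_def mult_ac intro!: nn_integral_cong)
    have Z: "(\<integral>\<^sup>+\<theta>. posterior_weight p \<Theta> \<pi>0 K (?xs z) \<theta> \<partial>lborel) = (\<integral>\<^sup>+\<theta>. w z \<theta> \<partial>?R)"
      using int_R[of "\<lambda>_. 1"] by simp
    have [measurable]: "g z \<in> borel_measurable borel" unfolding g_def by measurable
    have "scaled_second_moment p \<Theta> \<pi>0 est K (?xs z)
        = (\<integral>\<^sup>+\<theta>. posterior_weight p \<Theta> \<pi>0 K (?xs z) \<theta> / (\<integral>\<^sup>+\<theta>. w z \<theta> \<partial>?R) * g z \<theta> \<partial>lborel)"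
      unfolding scaled_second_moment_def posterior_def Z
      by (subst nn_integral_density) (auto simp: g_def)
    also have "\<dots> = (\<integral>\<^sup>+\<theta>. posterior_weight p \<Theta> \<pi>0 K (?xs z) \<theta> * g z \<theta> / (\<integral>\<^sup>+\<theta>. w z \<theta> \<partial>?R) \<partial>lborel)"
      by (simp add: divide_ennreal_def mult_ac)
    also have "\<dots> = (\<integral>\<^sup>+\<theta>. w z \<theta> * g z \<theta> \<partial>?R) / (\<integral>\<^sup>+\<theta>. w z \<theta> \<partial>?R)"
      by (subst nn_integral_divide) (auto simp: int_R)
    finally show ?thesis .
  qed
  have "(\<lambda>z. (\<integral>\<^sup>+\<theta>. w z \<theta> * g z \<theta> \<partial>?R) / (\<integral>\<^sup>+\<theta>. w z \<theta> \<partial>?R)) \<in> borel_measurable ?N"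
    using G_meas Z_meas by (rule borel_measurable_divide_ennreal)
  then have "(\<lambda>z. scaled_second_moment p \<Theta> \<pi>0 est K (?xs z)) \<in> borel_measurable ?N"
    by (subst measurable_cong[OF eq])
  from measurable_compose[OF block_measurable this] show ?thesis
    by (simp only: subseq_obs_1 obs_1_eq_map)
qed

lemma uniform_integrability_level:
  assumes "0 < \<tau>"
  obtains C where "0 < C" "\<And>n K. m0 \<le> n \<Longrightarrow> 1 \<le> K \<Longrightarrow>
    (\<integral>\<^sup>+x. scaled_second_moment p \<Theta> \<pi>0 est K (subseq_obs x n 1) *
        indicator {x. ennreal C \<le> scaled_second_moment p \<Theta> \<pi>0 est K (subseq_obs x n 1)} x \<partial>P) \<le> ennreal \<tau>"
proof -
  let ?f = "\<lambda>C (n, k). \<integral>\<^sup>+x. scaled_second_moment p \<Theta> \<pi>0 est k (subseq_obs x n 1) *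
        indicator {x. ennreal C \<le> scaled_second_moment p \<Theta> \<pi>0 est k (subseq_obs x n 1)} x \<partial>P"
  have "\<forall>\<^sub>F C in at_top. (SUP nk \<in> {(n, k). n \<ge> m0 \<and> k \<ge> 1}. ?f C nk) < ennreal \<tau>"
    using assms by (intro order_tendstoD(2)[OF uniform_integrability]) auto
  then have "\<forall>\<^sub>F C in at_top. (SUP nk \<in> {(n, k). n \<ge> m0 \<and> k \<ge> 1}. ?f C nk) < ennreal \<tau> \<and> 0 < C"
    using eventually_gt_at_top[of 0] by (rule eventually_conj)
  then have "\<exists>C. (SUP nk \<in> {(n, k). n \<ge> m0 \<and> k \<ge> 1}. ?f C nk) < ennreal \<tau> \<and> 0 < C"
    by (rule eventually_happens'[OF trivial_limit_at_top_linorder])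
  then obtain C :: real where C: "(SUP nk \<in> {(n, k). n \<ge> m0 \<and> k \<ge> 1}. ?f C nk) < ennreal \<tau>" "0 < C" by blast
  show thesis
  proof (rule that[OF C(2)])
    fix n K :: nat assume "m0 \<le> n" "1 \<le> K"
    then have "(n, K) \<in> {(n, k). n \<ge> m0 \<and> k \<ge> 1}" by simp
    then have "?f C (n, K) \<le> (SUP nk \<in> {(n, k). n \<ge> m0 \<and> k \<ge> 1}. ?f C nk)" by (rule SUP_upper)
    also note C(1)
    finally show "(\<integral>\<^sup>+x. scaled_second_moment p \<Theta> \<pi>0 est K (subseq_obs x n 1) *
        indicator {x. ennreal C \<le> scaled_second_moment p \<Theta> \<pi>0 est K (subseq_obs x n 1)} x \<partial>P) \<le> ennreal \<tau>"
      by simp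
  qed
qed

text \<open>Off a small set the error is small; on it the error is at most an affine function of the
  scaled second moment, which is split at the level \<open>C\<close>. The result is a measurable
  majorant, so integration and Markov's inequality apply whether or not the error is measurable in
  the data.\<close>

lemma quantile_error_dominated:
  assumes d: "0 < d"
  shows "\<forall>\<^sub>F n in sequentially. \<forall>K\<ge>1. \<exists>F\<in>borel_measurable P. (\<integral>\<^sup>+x. F x \<partial>P) \<le> ennreal d \<and>
    (AE x in P. is_mle (subseq_obs x n 1) \<and> quantile_error a b K (subseq_obs x n 1) \<le> F x)"
proof -
  define \<alpha> where "\<alpha> = 2 * (norm a)\<^sup>2"
  define s where "s = 2 * (a \<bullet> (matrix_inv I0 *v a))"
  have nonneg: "0 \<le> \<alpha>" "0 \<le> s"
    using gauss_proj_variance_nonneg[OF information, of a] by (auto simp: \<alpha>_def s_def)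
  \<comment> \<open>Three contributions of d / 3 each: the error off the small set, the truncated
    part on it, and the part above \<open>C\<close>. The level \<open>C\<close> comes from
    \<open>\<tau>\<close>, and only then the probability \<open>t\<close> of the small set, since
    its coefficient \<beta> contains \<open>C\<close>. Adding 1 in the denominators avoids division
    by zero.\<close>
  define \<tau> where "\<tau> = d / (3 * (\<alpha> + 1))"
  have \<tau>: "0 < \<tau>" "\<alpha> * \<tau> \<le> d / 3" using d nonneg by (auto simp: \<tau>_def field_simps)
  obtain C where C: "0 < C" "\<And>n K. m0 \<le> n \<Longrightarrow> 1 \<le> K \<Longrightarrow>
    (\<integral>\<^sup>+x. scaled_second_moment p \<Theta> \<pi>0 est K (subseq_obs x n 1) *
        indicator {x. ennreal C \<le> scaled_second_moment p \<Theta> \<pi>0 est K (subseq_obs x n 1)} x \<partial>P) \<le> ennreal \<tau>"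
    by (rule uniform_integrability_level[OF \<tau>(1)]) (rule that)
  define \<beta> where "\<beta> = \<alpha> * C + s"
  have \<beta>: "0 \<le> \<beta>" using nonneg C by (simp add: \<beta>_def)
  define t where "t = d / (3 * (\<beta> + 1))"
  have t: "0 < t" "\<beta> * t \<le> d / 3" using d \<beta> by (auto simp: t_def field_simps)
  have d3: "0 < d / 3" using d by simp
  show ?thesis
    using quantile_error_small_outside[OF d3 t(1), of a b] AE_is_mle eventually_ge_at_top[of m0]
  proof eventually_elim
    case (elim n)
    then obtain A where A [measurable]: "A \<in> sets P" and At: "emeasure P A \<le> ennreal t"
      and small: "\<And>x K. x \<in> space P - A \<Longrightarrow> 1 \<le> K \<Longrightarrow> quantile_error a b K (subseq_obs x n 1) \<le> ennreal (d / 3)"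
      by blast
    show ?case
    proof (intro allI impI)
      fix K :: nat assume K: "1 \<le> K"
      define \<psi> where "\<psi> x = scaled_second_moment p \<Theta> \<pi>0 est K (subseq_obs x n 1)" for x
      have [measurable]: "\<psi> \<in> borel_measurable P" unfolding \<psi>_def by (rule second_moment_measurable)
      define F where "F x = ennreal (d / 3) + (ennreal \<beta> * indicator A x
          + ennreal \<alpha> * (\<psi> x * indicator {x. ennreal C \<le> \<psi> x} x))" for x
      have [measurable]: "F \<in> borel_measurable P" unfolding F_def[abs_def] by measurable
      have "(\<integral>\<^sup>+x. F x \<partial>P) = ennreal (d / 3) + (ennreal \<beta> * emeasure P A
          + ennreal \<alpha> * (\<integral>\<^sup>+x. \<psi> x * indicator {x. ennreal C \<le> \<psi> x} x \<partial>P))"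
        unfolding F_def by (simp add: nn_integral_add nn_integral_cmult emeasure_space_1)
      also have "\<dots> \<le> ennreal (d / 3) + (ennreal \<beta> * ennreal t + ennreal \<alpha> * ennreal \<tau>)"
        using At C(2)[OF elim(3) K] by (intro add_left_mono add_mono mult_left_mono) (auto simp: \<psi>_def)
      also have "\<dots> = ennreal (d / 3 + (\<beta> * t + \<alpha> * \<tau>))"
        using d nonneg \<beta> t(1) \<tau>(1) by (simp add: ennreal_mult')
      also have "\<dots> \<le> ennreal d" using t(2) \<tau>(2) by (intro ennreal_leI) simp
      finally have F_int: "(\<integral>\<^sup>+x. F x \<partial>P) \<le> ennreal d" .
      have "AE x in P. is_mle (subseq_obs x n 1) \<and> quantile_error a b K (subseq_obs x n 1) \<le> F x"
        using elim(2) AE_space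
      proof eventually_elim
        case (elim x)
        have "quantile_error a b K (subseq_obs x n 1) \<le> F x"
        proof (cases "x \<in> A")
          case False
          then show ?thesis using small[of x K] elim(2) K by (auto simp: F_def intro: order_trans)
        next
          case True
          have "quantile_error a b K (subseq_obs x n 1) \<le> ennreal \<alpha> * \<psi> x + ennreal s"
            using quantile_error_le_second_moment[OF elim(1), of a b K] by (simp only: \<alpha>_def s_def \<psi>_def)
          also have "\<psi> x \<le> ennreal C + \<psi> x * indicator {x. ennreal C \<le> \<psi> x} x"
            by (cases "ennreal C \<le> \<psi> x") auto
          then have "ennreal \<alpha> * \<psi> x + ennreal s
              \<le> ennreal \<alpha> * (ennreal C + \<psi> x * indicator {x. ennreal C \<le> \<psi> x} x) + ennreal s"
            by (intro add_right_mono mult_left_mono) auto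
          also have "\<dots> = ennreal \<beta> + ennreal \<alpha> * (\<psi> x * indicator {x. ennreal C \<le> \<psi> x} x)"
            using nonneg C(1) by (simp add: \<beta>_def distrib_left ennreal_mult' ac_simps)
          also have "\<dots> \<le> F x" using True by (simp add: F_def add_increasing)
          finally show ?thesis .
        qed
        then show ?case using elim(1) by simp
      qed
      then show "\<exists>F\<in>borel_measurable P. (\<integral>\<^sup>+x. F x \<partial>P) \<le> ennreal d \<and>
        (AE x in P. is_mle (subseq_obs x n 1) \<and> quantile_error a b K (subseq_obs x n 1) \<le> F x)"
        using F_int by (intro bexI[of _ F]) auto
    qed
  qed
qed

text \<open>Expectations add whatever the dependence between the blocks, and by stationarity every block
  contributes as much as the first one.\<close>

lemma average_quantile_error_small:
  assumes d: "0 < d" and \<tau>: "0 < \<tau>"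
  shows "\<forall>\<^sub>F n in sequentially. \<forall>K\<ge>1. \<exists>A\<in>sets P. emeasure P A \<le> ennreal \<tau> \<and>
    (\<forall>x\<in>space P - A. (\<forall>k\<in>{1..K}. is_mle (subseq_obs x n k)) \<and>
      (\<Sum>k=1..K. quantile_error a b K (subseq_obs x n k)) \<le> ennreal (real K * d))"
proof -
  \<comment> \<open>With mean at most d \<tau> per block, Markov's inequality for the sum of
    \<open>K\<close> blocks at the level K d leaves probability at most \<open>\<tau>\<close>, for
    every \<open>K\<close>.\<close>
  have "0 < d * \<tau>" using d \<tau> by simp
  from quantile_error_dominated[OF this, of a b] show ?thesis
  proof (rule eventually_mono, intro allI impI)
    fix n K :: nat
    assume "\<forall>K\<ge>1. \<exists>F\<in>borel_measurable P. (\<integral>\<^sup>+x. F x \<partial>P) \<le> ennreal (d * \<tau>) \<and>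
      (AE x in P. is_mle (subseq_obs x n 1) \<and> quantile_error a b K (subseq_obs x n 1) \<le> F x)"
      and K: "1 \<le> K"
    then obtain F where F [measurable]: "F \<in> borel_measurable P" and F_int: "(\<integral>\<^sup>+x. F x \<partial>P) \<le> ennreal (d * \<tau>)"
      and F_AE: "AE x in P. is_mle (subseq_obs x n 1) \<and> quantile_error a b K (subseq_obs x n 1) \<le> F x"
      by blast
    define sh where "sh k x = (\<lambda>t. x (t + (int k - 1) * int n))" for k and x :: "int \<Rightarrow> real ^ 'q"
    have sh_meas [measurable]: "sh k \<in> P \<rightarrow>\<^sub>M P" for k unfolding sh_def[abs_def] by (rule shift_measurable)
    have sh_distr: "distr P P (sh k) = P" for k unfolding sh_def[abs_def] by (rule distr_shift)
    have sh_obs: "subseq_obs (sh k x) n 1 = subseq_obs x n k" for k x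
      unfolding sh_def by (rule subseq_obs_shift[symmetric])
    have "AE x in P. is_mle (subseq_obs x n k) \<and> quantile_error a b K (subseq_obs x n k) \<le> F (sh k x)" for k
    proof -
      have "AE x in distr P P (sh k). is_mle (subseq_obs x n 1) \<and> quantile_error a b K (subseq_obs x n 1) \<le> F x"
        unfolding sh_distr by (rule F_AE)
      from AE_distrD[OF sh_meas this] show ?thesis unfolding sh_obs .
    qed
    then have "AE x in P. \<forall>k. is_mle (subseq_obs x n k) \<and> quantile_error a b K (subseq_obs x n k) \<le> F (sh k x)"
      unfolding AE_all_countable by blast
    then obtain N where N: "N \<in> null_sets P"
      "{x\<in>space P. \<not> (\<forall>k. is_mle (subseq_obs x n k) \<and> quantile_error a b K (subseq_obs x n k) \<le> F (sh k x))} \<subseteq> N"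
      by (auto elim!: AE_E3)
    define Y where "Y x = (\<Sum>k=1..K. F (sh k x))" for x
    have [measurable]: "Y \<in> borel_measurable P" unfolding Y_def[abs_def] by measurable
    have "(\<integral>\<^sup>+x. Y x \<partial>P) = (\<Sum>k=1..K. \<integral>\<^sup>+x. F (sh k x) \<partial>P)"
      unfolding Y_def by (rule nn_integral_sum) measurable
    also have "\<dots> = (\<Sum>k=1..K. \<integral>\<^sup>+x. F x \<partial>P)"
    proof (rule sum.cong[OF refl])
      fix k
      show "(\<integral>\<^sup>+x. F (sh k x) \<partial>P) = (\<integral>\<^sup>+x. F x \<partial>P)"
        using nn_integral_distr[OF sh_meas, of F k] by (simp add: sh_distr)
    qed
    also have "\<dots> \<le> ennreal (real K) * ennreal (d * \<tau>)"
      using F_int by (simp add: ennreal_of_nat_eq_real_of_nat mult_left_mono)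
    finally have Y_int: "(\<integral>\<^sup>+x. Y x \<partial>P) \<le> ennreal (real K * (d * \<tau>))"
      using d \<tau> by (simp add: ennreal_mult')
    define c where "c = 1 / (real K * d)"
    have c: "0 < c" "c * (real K * d) = 1" using K d by (auto simp: c_def)
    define A where "A = N \<union> {x\<in>space P. 1 \<le> ennreal c * Y x}"
    have "emeasure P {x\<in>space P. 1 \<le> ennreal c * Y x} \<le> ennreal c * (\<integral>\<^sup>+x. Y x * indicator (space P) x \<partial>P)"
      by (rule nn_integral_Markov_inequality) auto
    also have "(\<integral>\<^sup>+x. Y x * indicator (space P) x \<partial>P) = (\<integral>\<^sup>+x. Y x \<partial>P)"
      by (intro nn_integral_cong) simp
    also have "ennreal c * \<dots> \<le> ennreal c * ennreal (real K * (d * \<tau>))"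
      using Y_int by (rule mult_left_mono) simp
    also have "\<dots> = ennreal (c * (real K * d) * \<tau>)"
      using c(1) by (simp add: ennreal_mult'[symmetric] mult_ac)
    finally have mk: "emeasure P {x\<in>space P. 1 \<le> ennreal c * Y x} \<le> ennreal \<tau>" by (simp add: c(2))
    show "\<exists>A\<in>sets P. emeasure P A \<le> ennreal \<tau> \<and>
      (\<forall>x\<in>space P - A. (\<forall>k\<in>{1..K}. is_mle (subseq_obs x n k)) \<and>
        (\<Sum>k=1..K. quantile_error a b K (subseq_obs x n k)) \<le> ennreal (real K * d))"
    proof (intro bexI[of _ A] conjI ballI)
      show "A \<in> sets P" using N(1) unfolding A_def by (intro sets.Un) (auto simp: null_sets_def)
      have "emeasure P A = emeasure P {x\<in>space P. 1 \<le> ennreal c * Y x}"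
        unfolding A_def using N(1) by (subst Un_commute, intro emeasure_Un_null_set) auto
      then show "emeasure P A \<le> ennreal \<tau>" using mk by simp
    next
      fix x assume x: "x \<in> space P - A"
      then have all: "is_mle (subseq_obs x n k) \<and> quantile_error a b K (subseq_obs x n k) \<le> F (sh k x)" for k
        using N(2) by (auto simp: A_def)
      show "is_mle (subseq_obs x n k)" for k using all by blast
      have "(\<Sum>k=1..K. quantile_error a b K (subseq_obs x n k)) \<le> Y x"
        unfolding Y_def using all by (intro sum_mono) auto
      also have "Y x \<le> ennreal (real K * d)"
      proof -
        have "ennreal c * Y x \<le> 1" using x by (auto simp: A_def not_le)
        then have "ennreal (real K * d) * (ennreal c * Y x) \<le> ennreal (real K * d) * 1"
          by (rule mult_left_mono) simp
        then have "ennreal (c * (real K * d)) * Y x \<le> ennreal (real K * d)"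
          using c(1) by (simp add: ennreal_mult' mult_ac)
        then show ?thesis by (simp add: c(2))
      qed
      finally show "(\<Sum>k=1..K. quantile_error a b K (subseq_obs x n k)) \<le> ennreal (real K * d)" .
    qed
  qed
qed

text \<open>The threshold for the block length is independent of \<open>K\<close>. One statement
  therefore covers growing numbers of blocks and, with a single block, the full posterior;
  \<open>is_mle\<close> of the first block is kept for the latter.\<close>

lemma aggregated_close:
  assumes \<epsilon>: "0 < \<epsilon>" and \<tau>: "0 < \<tau>"
  shows "\<forall>\<^sub>F n in sequentially. \<forall>K\<ge>1. \<exists>A\<in>sets P. emeasure P A \<le> ennreal \<tau> \<and>
    (\<forall>x\<in>space P - A. is_mle (subseq_obs x n 1) \<and>
      \<bar>(bias (a \<bullet> \<theta>0 + b) (aggregated_xi_posterior p \<Theta> \<pi>0 a b K n x)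
          - ((a \<bullet> mean_mle est K n x + b) - (a \<bullet> \<theta>0 + b))) / real (K * n) powr (- 1 / 2)\<bar> \<le> \<epsilon> \<and>
      \<bar>(var (aggregated_xi_posterior p \<Theta> \<pi>0 a b K n x) - inverse (info_xi I0 a) / real (K * n))
          / (1 / real (K * n))\<bar> \<le> \<epsilon>)"
proof -
  define s where "s = a \<bullet> (matrix_inv I0 *v a)"
  have s: "0 \<le> s" "inverse (info_xi I0 a) = s"
    using gauss_proj_variance_nonneg[OF information, of a] by (auto simp: s_def info_xi_def)
  \<comment> \<open>The variance error l s + d / l + d is split into three parts of at most
    \<epsilon> / 3: \<open>l\<close> handles the first, then \<open>d\<close> the other two. The
    further condition d \<le> \<epsilon>^2 is for the bias, whose square is what is bounded. Adding
    1 to s allows s = 0.\<close>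
  define l where "l = \<epsilon> / (3 * (s + 1))"
  have l: "0 < l" "l * s \<le> \<epsilon> / 3" using \<epsilon> s by (auto simp: l_def field_simps)
  define d where "d = min (\<epsilon>\<^sup>2) (min (\<epsilon> / 3 * l) (\<epsilon> / 3))"
  have d: "0 < d" "d \<le> \<epsilon>\<^sup>2" "d / l \<le> \<epsilon> / 3" "d \<le> \<epsilon> / 3"
    using \<epsilon> l(1) by (auto simp: d_def divide_le_eq)
  show ?thesis
    using average_quantile_error_small[OF d(1) \<tau>, of a b] eventually_ge_at_top[of 1]
  proof eventually_elim
    case (elim n)
    show ?case
    proof (intro allI impI)
      fix K :: nat assume K: "1 \<le> K"
      from elim(1) K obtain A where A': "A \<in> sets P" "emeasure P A \<le> ennreal \<tau>"
        "\<forall>x\<in>space P - A. (\<forall>k\<in>{1..K}. is_mle (subseq_obs x n k)) \<and>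
          (\<Sum>k=1..K. quantile_error a b K (subseq_obs x n k)) \<le> ennreal (real K * d)"
        by blast
      then have A: "A \<in> sets P" "emeasure P A \<le> ennreal \<tau>"
        "\<And>x k. x \<in> space P - A \<Longrightarrow> k \<in> {1..K} \<Longrightarrow> is_mle (subseq_obs x n k)"
        "\<And>x. x \<in> space P - A \<Longrightarrow> (\<Sum>k=1..K. quantile_error a b K (subseq_obs x n k)) \<le> ennreal (real K * d)"
        by simp_all
      have T: "0 < real (K * n)" using K elim(2) by simp
      show "\<exists>A\<in>sets P. emeasure P A \<le> ennreal \<tau> \<and>
        (\<forall>x\<in>space P - A. is_mle (subseq_obs x n 1) \<and>
          \<bar>(bias (a \<bullet> \<theta>0 + b) (aggregated_xi_posterior p \<Theta> \<pi>0 a b K n x)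
              - ((a \<bullet> mean_mle est K n x + b) - (a \<bullet> \<theta>0 + b))) / real (K * n) powr (- 1 / 2)\<bar> \<le> \<epsilon> \<and>
          \<bar>(var (aggregated_xi_posterior p \<Theta> \<pi>0 a b K n x) - inverse (info_xi I0 a) / real (K * n))
              / (1 / real (K * n))\<bar> \<le> \<epsilon>)"
      proof (intro bexI[OF _ A(1)] conjI A(2) ballI)
        fix x assume x: "x \<in> space P - A"
        show "is_mle (subseq_obs x n 1)" using A(3)[OF x] K by simp
        let ?Q = "aggregated_xi_posterior p \<Theta> \<pi>0 a b K n x"
        note mv = aggregated_law_mean_var[where xs = "subseq_obs x n" and a = a and b = b and l = l,
            OF A(3)[OF x] length_subseq_obs elim(2) K A(4)[OF x] less_imp_le[OF d(1)] l(1)]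
        have mv1: "real (K * n) * ((\<integral>\<xi>. \<xi> \<partial>?Q) - (a \<bullet> mean_mle est K n x + b))\<^sup>2 \<le> d"
          unfolding aggregated_xi_posterior_def mean_mle_inner[OF K, symmetric] by (rule mv(1))
        have mv2: "\<bar>real (K * n) * var ?Q - s\<bar> \<le> l * s + d / l + d"
          unfolding aggregated_xi_posterior_def s_def by (rule mv(2))
        have half: "real (K * n) powr (- 1 / 2) = 1 / sqrt (real (K * n))"
          using T by (rule powr_neg_half)
        define w where "w = (\<integral>\<xi>. \<xi> \<partial>?Q) - (a \<bullet> mean_mle est K n x + b)"
        have "(bias (a \<bullet> \<theta>0 + b) ?Q - ((a \<bullet> mean_mle est K n x + b) - (a \<bullet> \<theta>0 + b))) / real (K * n) powr (- 1 / 2)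
            = w * sqrt (real (K * n))"
          unfolding half by (simp add: bias_def w_def)
        moreover have "(w * sqrt (real (K * n)))\<^sup>2 \<le> \<epsilon>\<^sup>2"
          using mv1 d(2) T by (simp add: w_def power_mult_distrib mult.commute)
        then have "\<bar>w * sqrt (real (K * n))\<bar> \<le> \<epsilon>" using \<epsilon> by (simp add: abs_le_square_iff[symmetric])
        ultimately show "\<bar>(bias (a \<bullet> \<theta>0 + b) ?Q - ((a \<bullet> mean_mle est K n x + b) - (a \<bullet> \<theta>0 + b)))
            / real (K * n) powr (- 1 / 2)\<bar> \<le> \<epsilon>" by (simp only:)
        have "(var ?Q - inverse (info_xi I0 a) / real (K * n)) / (1 / real (K * n)) = real (K * n) * var ?Q - s"
        proof -
          have "(v - s / t) / (1 / t) = t * v - s" if "0 < t" for v t :: real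
            using that by (simp add: field_simps)
          from this[OF T] show ?thesis unfolding s(2) .
        qed
        moreover have "\<bar>real (K * n) * var ?Q - s\<bar> \<le> \<epsilon>" using mv2 l(2) d(3,4) by linarith
        ultimately show "\<bar>(var ?Q - inverse (info_xi I0 a) / real (K * n)) / (1 / real (K * n))\<bar> \<le> \<epsilon>"
          by (simp only:)
      qed
    qed
  qed
qed

text \<open>With one block the averaged quantile function is that of the posterior itself, and a law
  is recovered from its quantile function. The estimate ensures that the posterior is a probability
  law.\<close>

lemma full_eq_aggregated:
  assumes "is_mle (subseq_obs x n 1)"
  shows "full_xi_posterior p \<Theta> \<pi>0 a b n x = aggregated_xi_posterior p \<Theta> \<pi>0 a b 1 n x"
  using law_with_quantile_quantile[OF real_distribution_xi_law[OF assms, of a b 1]]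
  by (simp add: full_xi_posterior_def aggregated_xi_posterior_def subseq_obs_Suc_0)

lemma mean_mle_1: "mean_mle est 1 n x = est (obs x 1 (int n))"
  by (simp add: mean_mle_def subseq_obs_Suc_0)

lemma posterior_moments:
  assumes K: "\<forall>\<^sub>F n in sequentially. 1 \<le> K n" and m: "filterlim m at_top sequentially"
  shows
    "little_o_prob P
       (\<lambda>n x. bias (a \<bullet> \<theta>0 + b) (aggregated_xi_posterior p \<Theta> \<pi>0 a b (K n) (m n) x)
          - ((a \<bullet> mean_mle est (K n) (m n) x + b) - (a \<bullet> \<theta>0 + b)))
       (\<lambda>n. real (K n * m n) powr (- 1 / 2))" (is ?g1)
    "little_o_prob P
       (\<lambda>n x. bias (a \<bullet> \<theta>0 + b) (full_xi_posterior p \<Theta> \<pi>0 a b (K n * m n) x)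
          - ((a \<bullet> est (obs x 1 (int (K n * m n))) + b) - (a \<bullet> \<theta>0 + b)))
       (\<lambda>n. real (K n * m n) powr (- 1 / 2))" (is ?g2)
    "little_o_prob P
       (\<lambda>n x. var (aggregated_xi_posterior p \<Theta> \<pi>0 a b (K n) (m n) x)
          - inverse (info_xi I0 a) / real (K n * m n))
       (\<lambda>n. 1 / real (K n * m n))" (is ?g3)
    "little_o_prob P
       (\<lambda>n x. var (full_xi_posterior p \<Theta> \<pi>0 a b (K n * m n) x)
          - inverse (info_xi I0 a) / real (K n * m n))
       (\<lambda>n. 1 / real (K n * m n))" (is ?g4)
proof -
  have Km: "filterlim (\<lambda>n. K n * m n) at_top sequentially"
    using K by (intro filterlim_at_top_mono[OF m]) (auto elim!: eventually_mono)
  note agg = eventually_compose_filterlim[OF aggregated_close m]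
  \<comment> \<open>The whole series viewed as one block of length \<open>K n * m n\<close>; the
    number of blocks is set to 1 below.\<close>
  note full = eventually_compose_filterlim[OF aggregated_close Km]
  show ?g1
  proof (rule little_o_probI)
    fix \<epsilon> \<tau> :: real assume "0 < \<epsilon>" "0 < \<tau>"
    from agg[OF this, of a b] K show "\<forall>\<^sub>F n in sequentially. \<exists>A\<in>sets P. emeasure P A \<le> ennreal \<tau> \<and>
      (\<forall>x\<in>space P - A. \<bar>(bias (a \<bullet> \<theta>0 + b) (aggregated_xi_posterior p \<Theta> \<pi>0 a b (K n) (m n) x)
          - ((a \<bullet> mean_mle est (K n) (m n) x + b) - (a \<bullet> \<theta>0 + b))) / real (K n * m n) powr (- 1 / 2)\<bar> \<le> \<epsilon>)"
      by eventually_elim meson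
  qed
  show ?g3
  proof (rule little_o_probI)
    fix \<epsilon> \<tau> :: real assume "0 < \<epsilon>" "0 < \<tau>"
    from agg[OF this, of a b] K show "\<forall>\<^sub>F n in sequentially. \<exists>A\<in>sets P. emeasure P A \<le> ennreal \<tau> \<and>
      (\<forall>x\<in>space P - A. \<bar>(var (aggregated_xi_posterior p \<Theta> \<pi>0 a b (K n) (m n) x)
          - inverse (info_xi I0 a) / real (K n * m n)) / (1 / real (K n * m n))\<bar> \<le> \<epsilon>)"
      by eventually_elim meson
  qed
  have full': "\<forall>\<^sub>F n in sequentially. \<exists>A\<in>sets P. emeasure P A \<le> ennreal \<tau> \<and>
      (\<forall>x\<in>space P - A. \<bar>(bias (a \<bullet> \<theta>0 + b) (full_xi_posterior p \<Theta> \<pi>0 a b (K n * m n) x)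
          - ((a \<bullet> est (obs x 1 (int (K n * m n))) + b) - (a \<bullet> \<theta>0 + b))) / real (K n * m n) powr (- 1 / 2)\<bar> \<le> \<epsilon> \<and>
        \<bar>(var (full_xi_posterior p \<Theta> \<pi>0 a b (K n * m n) x)
          - inverse (info_xi I0 a) / real (K n * m n)) / (1 / real (K n * m n))\<bar> \<le> \<epsilon>)"
    if "0 < \<epsilon>" "0 < \<tau>" for \<epsilon> \<tau>
    using full[OF that, of a b]
  proof eventually_elim
    case (elim n)
    from elim[rule_format, of 1] show ?case
      unfolding mean_mle_1 mult_1 using full_eq_aggregated[of _ "K n * m n" a b] by (metis order_refl)
  qed
  show ?g2
    by (rule little_o_probI, drule (1) full') (erule eventually_mono, blast)
  show ?g4
    by (rule little_o_probI, drule (1) full') (erule eventually_mono, blast)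
qed

end

theorem theorem2:
  fixes S :: "(real ^ 'q) set"
    and \<Theta> B :: "(real ^ 'd) set"
    and p :: "('q, 'd) ts_model"
    and \<theta>0 a :: "real ^ 'd"
    and P :: "(int \<Rightarrow> real ^ 'q) measure"
    and est :: "(real ^ 'q) list \<Rightarrow> real ^ 'd"
    and \<pi>0 :: "real ^ 'd \<Rightarrow> real"
    and env :: "(real ^ 'q) list \<Rightarrow> real"
    and I0 :: "real ^ 'd ^ 'd"
    and \<delta> \<delta>0 \<rho>0 C0 b :: real
    and m0 :: nat
    and K m :: "nat \<Rightarrow> nat"
  defines "B \<equiv> {\<theta>\<in>\<Theta>. norm (\<theta> - \<theta>0) \<le> \<delta>0}"
  assumes model: "density_model S \<Theta> p"
    and true_parameter: "\<theta>0 \<in> interior \<Theta>"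
    and law: "data_law S p \<theta>0 P"
    and mle: "unique_mle S \<Theta> p P est"
    and stationary: "strictly_stationary P"
    and ergodic: "ergodic P"
    and \<delta>_pos: "0 < \<delta>"
    and mixing: "summable (\<lambda>j. mixing_coeff S P (Suc j) powr (\<delta> / (2 + \<delta>)))"
    and \<rho>0: "0 < \<rho>0" "\<rho>0 < 1"
    and C0: "0 < C0"
    and score_decay: "\<forall>\<^sub>F N in sequentially. \<forall>i>N. \<forall>j>N.
      (\<integral>\<^sup>+x. ennreal (l1_norm
          (grad_within \<Theta> (\<lambda>\<theta>. ln (p \<theta> (obs x (- int i) 0) (x 1))) \<theta>0
           - grad_within \<Theta> (\<lambda>\<theta>. ln (p \<theta> (obs x (- int j) 0) (x 1))) \<theta>0)) \<partial>P)
        \<le> ennreal (C0 * \<rho>0 ^ N)"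
    and support: "\<And>t \<theta> h. t \<ge> 1 \<Longrightarrow> \<theta> \<in> \<Theta> \<Longrightarrow> length h = t - 1 \<Longrightarrow> set h \<subseteq> S \<Longrightarrow>
      measure_support (density (values_measure S) (\<lambda>y. ennreal (p \<theta> h y)))
        = measure_support (distr P (values_measure S) (\<lambda>x. x (int t)))"
    and \<delta>0_pos: "0 < \<delta>0"
    and smooth: "\<And>h y. set h \<subseteq> S \<Longrightarrow> y \<in> S \<Longrightarrow>
      (\<forall>\<theta>\<in>B. 0 < p \<theta> h y) \<and> three_times_differentiable_on (\<lambda>\<theta>. ln (p \<theta> h y)) B"
    and env_measurable: "\<And>n. (\<lambda>z. env (map z [0..<n]))
      \<in> borel_measurable (PiM {..<n} (\<lambda>_. values_measure S))"
    and envelope: "\<And>h y \<theta> i j k. set h \<subseteq> S \<Longrightarrow> y \<in> S \<Longrightarrow> \<theta> \<in> B \<Longrightarrow>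
      \<bar>pd_within B i (\<lambda>\<theta>. ln (p \<theta> h y)) \<theta>\<bar> \<le> env (h @ [y]) \<and>
      \<bar>pd_within B i (pd_within B j (\<lambda>\<theta>. ln (p \<theta> h y))) \<theta>\<bar> \<le> env (h @ [y]) \<and>
      \<bar>pd_within B i (pd_within B j (pd_within B k (\<lambda>\<theta>. ln (p \<theta> h y)))) \<theta>\<bar> \<le> env (h @ [y])"
    and envelope_moment: "limsup (\<lambda>T. \<integral>\<^sup>+x. ennreal
      ((\<Sum>t=1..T. env (obs x 1 (int t)) powr (4 + 2 * \<delta>)) / real T) \<partial>P) < \<infinity>"
    and interchange: "\<And>n. interchange_at P \<Theta> \<theta>0
      (\<lambda>\<theta> x. lik_ratio p \<theta>0 \<theta> (obs x 1 (int n)))"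
    and interchange2: "\<And>n i. interchange_at P \<Theta> \<theta>0
      (\<lambda>\<theta> x. pd_within \<Theta> i (\<lambda>\<theta>. lik_ratio p \<theta>0 \<theta> (obs x 1 (int n))) \<theta>)"
    and martingale: "\<And>s. s \<ge> 1 \<Longrightarrow> is_martingale P (\<lambda>n. gen_algebra S {s..<s + int n})
      (\<lambda>n x. grad_within \<Theta> (\<lambda>\<theta>. real_of_ereal (loglik p \<theta> (obs x s (s + int n - 1)))) \<theta>0)"
    and information: "positive_definite I0"
    and hessian_limit: "little_o_prob P
      (\<lambda>T x. norm (- (1 / real T) *\<^sub>R
         hess_within \<Theta> (\<lambda>\<theta>. real_of_ereal (loglik p \<theta> (obs x 1 (int T)))) \<theta>0 - I0)) (\<lambda>_. 1)"
    and hessian_bounds: "\<exists>c C. 0 < c \<and> (\<forall>\<^sub>F n in sequentially. \<forall>xs \<theta>.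
      length xs = n \<and> set xs \<subseteq> S \<and> \<theta> \<in> B \<longrightarrow>
        positive_definite
          (- (1 / real n) *\<^sub>R hess_within B (\<lambda>\<theta>. real_of_ereal (loglik p \<theta> xs)) \<theta>) \<and>
        (\<forall>l. is_eigenvalue
            (- (1 / real n) *\<^sub>R hess_within B (\<lambda>\<theta>. real_of_ereal (loglik p \<theta> xs)) \<theta>) l
          \<longrightarrow> c \<le> l \<and> l \<le> C))"
    and identifiability: "\<And>\<eta>. 0 < \<eta> \<Longrightarrow> \<exists>\<epsilon>>0. (\<lambda>n. measure P {x\<in>space P.
      (SUP \<theta>\<in>{\<theta>\<in>\<Theta>. \<eta> \<le> norm (\<theta> - \<theta>0)}.
        (loglik p \<theta> (subseq_obs x n 1) - loglik p \<theta>0 (subseq_obs x n 1)) / ereal (real n))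
      \<le> - ereal \<epsilon>}) \<longlonglongrightarrow> 1"
    and prior_nonneg: "\<And>\<theta>. \<theta> \<in> \<Theta> \<Longrightarrow> 0 \<le> \<pi>0 \<theta>"
    and prior_measurable: "\<pi>0 \<in> borel_measurable (restrict_space borel \<Theta>)"
    and prior_prob: "(\<integral>\<^sup>+\<theta>\<in>\<Theta>. ennreal (\<pi>0 \<theta>) \<partial>lborel) = 1"
    and prior_continuous: "continuous (at \<theta>0 within \<Theta>) \<pi>0"
    and prior_pos: "0 < \<pi>0 \<theta>0"
    and prior_second_moment: "(\<integral>\<^sup>+\<theta>\<in>\<Theta>. ennreal ((norm \<theta>)\<^sup>2 * \<pi>0 \<theta>) \<partial>lborel) < \<infinity>"
    and m0: "m0 \<ge> 1"
    and uniform_integrability: "((\<lambda>C::real. SUP (n, k) \<in> {(n, k). n \<ge> m0 \<and> k \<ge> 1}.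
      \<integral>\<^sup>+x. scaled_second_moment p \<Theta> \<pi>0 est k (subseq_obs x n 1) *
        indicator {x. ennreal C \<le> scaled_second_moment p \<Theta> \<pi>0 est k (subseq_obs x n 1)} x \<partial>P)
      \<longlongrightarrow> 0) at_top"
    and a_nonzero: "a \<noteq> 0"
    and K_lim: "filterlim K at_top sequentially"
    and m_lim: "filterlim m at_top sequentially"
  shows
    "little_o_prob P
       (\<lambda>n x. bias (a \<bullet> \<theta>0 + b) (aggregated_xi_posterior p \<Theta> \<pi>0 a b (K n) (m n) x)
          - ((a \<bullet> mean_mle est (K n) (m n) x + b) - (a \<bullet> \<theta>0 + b)))
       (\<lambda>n. real (K n * m n) powr (- 1 / 2))
     \<and> little_o_prob P
       (\<lambda>n x. bias (a \<bullet> \<theta>0 + b) (full_xi_posterior p \<Theta> \<pi>0 a b (K n * m n) x)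
          - ((a \<bullet> est (obs x 1 (int (K n * m n))) + b) - (a \<bullet> \<theta>0 + b)))
       (\<lambda>n. real (K n * m n) powr (- 1 / 2))
     \<and> little_o_prob P
       (\<lambda>n x. var (aggregated_xi_posterior p \<Theta> \<pi>0 a b (K n) (m n) x)
          - inverse (info_xi I0 a) / real (K n * m n))
       (\<lambda>n. 1 / real (K n * m n))
     \<and> little_o_prob P
       (\<lambda>n x. var (full_xi_posterior p \<Theta> \<pi>0 a b (K n * m n) x)
          - inverse (info_xi I0 a) / real (K n * m n))
       (\<lambda>n. 1 / real (K n * m n))"
proof -
  obtain e where e: "0 < e" "ball \<theta>0 e \<subseteq> \<Theta>"
    using true_parameter mem_interior by blast
  have cont: "continuous (at \<theta>0) \<pi>0"
    using prior_continuous at_within_interior[OF true_parameter] by simp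
  then have "\<forall>\<^sub>F \<theta> in at \<theta>0. 0 < \<pi>0 \<theta> \<and> \<pi>0 \<theta> < 2 * \<pi>0 \<theta>0"
    using prior_pos unfolding continuous_at by (intro eventually_conj order_tendstoD) auto
  then obtain e' where e': "0 < e'" "\<And>\<theta>. \<theta> \<noteq> \<theta>0 \<Longrightarrow> dist \<theta> \<theta>0 < e' \<Longrightarrow> 0 < \<pi>0 \<theta> \<and> \<pi>0 \<theta> < 2 * \<pi>0 \<theta>0"
    by (auto simp: eventually_at)
  \<comment> \<open>Three radii at once: \<open>e\<close> keeps the ball in \<open>\<Theta>\<close>,
    \<open>e'\<close> keeps the prior positive and below twice its value at
    \<open>\<theta>0\<close>, and \<open>\<delta>0\<close> keeps the ball where the log-densities
    are smooth.\<close>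
  define r0 where "r0 = min \<delta>0 (min e e')"
  have r0: "0 < r0" "r0 \<le> \<delta>0" "ball \<theta>0 r0 \<subseteq> \<Theta>"
    using e e'(1) \<delta>0_pos by (auto simp: r0_def)
  have prior_local: "0 < \<pi>0 \<theta> \<and> \<pi>0 \<theta> \<le> 2 * \<pi>0 \<theta>0" if "\<theta> \<in> ball \<theta>0 r0" for \<theta>
    using that e'(2)[of \<theta>] prior_pos by (cases "\<theta> = \<theta>0") (auto simp: r0_def dist_commute)
  have P: "prob_space P" "sets P = sets (path_space S)"
    using law by (simp_all add: data_law_def)
  have third: "\<bar>pd_within B i (pd_within B j (pd_within B k (\<lambda>\<theta>. ln (p \<theta> h y)))) \<theta>\<bar> \<le> env (h @ [y])"
    if "set h \<subseteq> S" "y \<in> S" "\<theta> \<in> B" for h y \<theta> i j k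
    using envelope[OF that] by blast
  note facts = model r0 smooth[unfolded B_def] third[unfolded B_def] information
    hessian_bounds[unfolded B_def] prior_nonneg prior_measurable prior_prob prior_second_moment
    prior_local cont P mle stationary \<delta>_pos env_measurable envelope_moment hessian_limit
    identifiability uniform_integrability
  interpret prob_space P by (rule P(1))
  interpret ts_data S \<Theta> p \<theta>0 \<delta>0 r0 env \<pi>0 I0 est B P \<delta> m0
    by unfold_locales (fact facts | simp add: B_def)+
  have "\<forall>\<^sub>F n in sequentially. 1 \<le> K n"
    using K_lim by (simp add: filterlim_at_top)
  from posterior_moments[OF this m_lim] show ?thesis by blast
qed

end
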